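(* Let $i\in\mathbb S^2$ and $p>1$. Then $\rho_{p,i}$ is a complete seminorm on $\mathfrak B_{p,i}$ such that $\mathfrak B_{p,i}$ modulo the constant functions, endowed with the norm induced by $\rho_{p,i}$, is a Banach space, and it satisfies $$\rho_{p,i}(f\circ_iT_a)=\rho_{p,i}(f)$$ for all $f\in\mathfrak B_{p,i}$ and all $a\in\mathbb B_i$.
   Context: $\mathbb H$ denotes the quaternions with real part coordinate $x_0$, $\mathbb S^2$ the sphere of purely imaginary unit quaternions, $\mathbb C(i)=\{x+iy:x,y\in\mathbb R\}$ for $i\in\mathbb S^2$, $\mathbb B$ the open unit ball of $\mathbb H$, $\mathbb B_i=\mathbb B\cap\mathbb C(i)$. A real differentiable function $f:\mathbb B\to\mathbb H$ is (left) slice regular if for every $i\in\mathbb S^2$, $\left(\frac{\partial}{\partial x}+i\frac{\partial}{\partial y}\right)f(x+iy)=0$ on $\mathbb B_i$; $\mathcal{SR}(\mathbb B)$ is the set of these functions. $dA_i=\frac1\pi dx\,dy$ on $\mathbb B_i$ and $d\lambda_i(z)=\frac{dA_i(z)}{(1-|z|^2)^2}$. For $p>0$, $\mathfrak B_{p,i}$ is the quaternionic right linear space of $f\in\mathcal{SR}(\mathbb B)$ such that $\int_{\mathbb B_i}|(1-|z|^2)^n\partial_{x_0}^nf(z)|^pd\lambda_i(z)<\infty$ for some $n\in\mathbb N$ with $np>1$ (this does not depend on the choice of $n$). For $p>1$ and $f\in\mathfrak B_{p,i}$, $$\rho_{p,i}(f)=\left[\int_{\mathbb B_i}(1-|z|^2)^p|\partial_{x_0}f(z)|^pd\lambda_i(z)\right]^{1/p}.$$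 $Q_i[f]=f|_{\mathbb B_i}$. For $j\in\mathbb S^2$ orthogonal to $i$, every $f\in\mathcal{SR}(\mathbb B)$ satisfies $Q_i[f]=f_1+f_2j$ with $f_1,f_2:\mathbb B_i\to\mathbb C(i)$ holomorphic. For $g=g_1+g_2j$ with $g_1,g_2$ holomorphic $\mathbb B_i\to\mathbb C(i)$, $P_i[g]\in\mathcal{SR}(\mathbb B)$ is the slice regular extension $P_i[g](x+I_qy)=\frac12[(1+I_qi)g(x-yi)+(1-I_qi)g(x+yi)]$. $T_a(q)=(1-q\bar a)^{-\ast}\ast(a-q)$, where $\ast$ is the slice regular product (for power series, $(\sum q^na_n)\ast(\sum q^nb_n)=\sum_nq^n\sum_ka_kb_{n-k}$) and $(1-q\bar a)^{-\ast}=\sum_{n\ge0}q^n\bar a^n$; for $a\in\mathbb B_i$, on $\mathbb B_i$ it equals $\frac{a-z}{1-\bar az}$. The composition is $f\circ_iT_a:=P_i[f_1\circ Q_i[T_a]]+P_i[f_2\circ Q_i[T_a]]\,j$. *)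

theory Defs
  imports "HOL-Analysis.Analysis"
begin

section \<open>Quaternions\<close>

datatype quat = Quat (qre: real) (qim1: real) (qim2: real) (qim3: real)

lemma quat_eq_iff:
  "p = q \<longleftrightarrow> qre p = qre q \<and> qim1 p = qim1 q \<and> qim2 p = qim2 q \<and> qim3 p = qim3 q"
  by (cases p; cases q) simp

instantiation quat :: ab_group_add
begin

definition "0 = Quat 0 0 0 0"
definition "p + q = Quat (qre p + qre q) (qim1 p + qim1 q) (qim2 p + qim2 q) (qim3 p + qim3 q)"
definition "p - q = Quat (qre p - qre q) (qim1 p - qim1 q) (qim2 p - qim2 q) (qim3 p - qim3 q)"
definition "- q = Quat (- qre q) (- qim1 q) (- qim2 q) (- qim3 q)"

instance
  by standard
    (simp_all add: quat_eq_iff zero_quat_def plus_quat_def minus_quat_def uminus_quat_def)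

end

instantiation quat :: ring_1
begin

definition "1 = Quat 1 0 0 0"
definition "p * q = Quat
  (qre p * qre q - qim1 p * qim1 q - qim2 p * qim2 q - qim3 p * qim3 q)
  (qre p * qim1 q + qim1 p * qre q + qim2 p * qim3 q - qim3 p * qim2 q)
  (qre p * qim2 q - qim1 p * qim3 q + qim2 p * qre q + qim3 p * qim1 q)
  (qre p * qim3 q + qim1 p * qim2 q - qim2 p * qim1 q + qim3 p * qre q)"

instance
  by standard
    (simp_all add: quat_eq_iff zero_quat_def plus_quat_def one_quat_def times_quat_def,
      simp_all add: algebra_simps)

end

definition qcnj :: "quat \<Rightarrow> quat"
  where "qcnj q = Quat (qre q) (- qim1 q) (- qim2 q) (- qim3 q)"

instantiation quat :: real_vector
begin

definition "r *\<^sub>R q = Quat (r * qre q) (r * qim1 q) (r * qim2 q) (r * qim3 q)"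

instance
  by standard (simp_all add: quat_eq_iff plus_quat_def scaleR_quat_def algebra_simps)

end

instantiation quat :: real_inner
begin

definition "p \<bullet> q = qre p * qre q + qim1 p * qim1 q + qim2 p * qim2 q + qim3 p * qim3 q"
definition "norm (q::quat) = sqrt (q \<bullet> q)"
definition "dist (p::quat) q = norm (p - q)"
definition "sgn (q::quat) = q /\<^sub>R norm q"
definition [code del]: "(uniformity :: (quat \<times> quat) filter) = (INF e\<in>{0 <..}. principal {(x, y). dist x y < e})"
definition [code del]: "open (U :: quat set) \<longleftrightarrow> (\<forall>x\<in>U. eventually (\<lambda>(x', y). x' = x \<longrightarrow> y \<in> U) uniformity)"

instance
proof
  fix p q r :: quat and a b :: real
  show "p \<bullet> p = 0 \<longleftrightarrow> p = 0"
    by (auto simp: inner_quat_def quat_eq_iff zero_quat_def add_nonneg_eq_0_iff)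
  show "0 \<le> p \<bullet> p"
    by (simp add: inner_quat_def)
qed (simp_all add: quat_eq_iff zero_quat_def plus_quat_def minus_quat_def uminus_quat_def
    scaleR_quat_def inner_quat_def norm_quat_def dist_quat_def sgn_quat_def
    uniformity_quat_def open_quat_def algebra_simps)

end

instantiation quat :: real_normed_div_algebra
begin

definition "inverse (q::quat) = qcnj q /\<^sub>R (norm q)\<^sup>2"
definition "p div (q::quat) = p * inverse q"

instance
proof
  fix p q :: quat and a :: real
  have sq: "(norm x)\<^sup>2 = qre x * qre x + qim1 x * qim1 x + qim2 x * qim2 x + qim3 x * qim3 x" for x :: quat
    by (simp add: norm_quat_def inner_quat_def)
  have cnj: "x * qcnj x = (norm x)\<^sup>2 *\<^sub>R 1" "qcnj x * x = (norm x)\<^sup>2 *\<^sub>R 1" for x :: quat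
    unfolding sq by (simp_all add: quat_eq_iff qcnj_def times_quat_def one_quat_def scaleR_quat_def)
  show 1: "a *\<^sub>R p * q = a *\<^sub>R (p * q)" for a and p q :: quat
    by (simp add: quat_eq_iff times_quat_def scaleR_quat_def algebra_simps)
  show 2: "p * a *\<^sub>R q = a *\<^sub>R (p * q)" for a and p q :: quat
    by (simp add: quat_eq_iff times_quat_def scaleR_quat_def algebra_simps)
  show "inverse p * p = 1" "p * inverse p = 1" if "p \<noteq> 0"
    unfolding inverse_quat_def 1 2 cnj using that by simp_all
  show "p div q = p * inverse q"
    by (rule divide_quat_def)
  show "inverse (0::quat) = 0"
    by (simp add: inverse_quat_def quat_eq_iff qcnj_def zero_quat_def scaleR_quat_def)
  have "(norm (p * q))\<^sup>2 = (norm p * norm q)\<^sup>2"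
    unfolding power_mult_distrib sq by (simp add: times_quat_def algebra_simps)
  then show "norm (p * q) = norm p * norm q"
    by (rule power2_eq_imp_eq) simp_all
qed

end

instantiation quat :: euclidean_space
begin

definition "Basis = {Quat 1 0 0 0, Quat 0 1 0 0, Quat 0 0 1 0, Quat 0 0 0 1}"

instance
proof
  show "(Basis :: quat set) \<noteq> {}" "finite (Basis :: quat set)"
    by (simp_all add: Basis_quat_def)
  have inner: "q \<bullet> Quat a b c d = qre q * a + qim1 q * b + qim2 q * c + qim3 q * d" for q a b c d
    by (simp add: inner_quat_def)
  show "u \<bullet> v = (if u = v then 1 else 0)" if "u \<in> Basis" "v \<in> Basis" for u v :: quat
    using that unfolding Basis_quat_def by (elim insertE emptyE; simp add: inner)
  show "(\<forall>u\<in>Basis. q \<bullet> u = 0) \<longleftrightarrow> q = 0" for q :: quat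
    by (simp add: Basis_quat_def inner quat_eq_iff zero_quat_def)
qed

end

definition qimag :: "quat \<Rightarrow> quat"
  where "qimag q = q - of_real (qre q)"


section \<open>Slices of the unit ball\<close>

definition imag_sphere :: "quat set"
  where "imag_sphere = {q. qre q = 0 \<and> norm q = 1}"

definition slice_pt :: "quat \<Rightarrow> real \<Rightarrow> real \<Rightarrow> quat"
  where "slice_pt i x y = of_real x + i * of_real y"

definition slice_plane :: "quat \<Rightarrow> quat set"
  where "slice_plane i = {slice_pt i x y | x y. True}"

abbreviation qball :: "quat set"
  where "qball \<equiv> ball 0 1"

definition slice_ball :: "quat \<Rightarrow> quat set"
  where "slice_ball i = qball \<inter> slice_plane i"

text \<open>
  The measures dA = dx dy / pi and dlambda = dA / (1 - |z|^2)^2 of the slice disc, regarded as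
  measures on all of the quaternions that are concentrated on the disc.
\<close>

definition slice_area :: "quat \<Rightarrow> quat measure"
  where "slice_area i =
    density (distr lborel borel (\<lambda>z::complex. slice_pt i (Re z) (Im z)))
      (\<lambda>z. ennreal (indicator (slice_ball i) z / pi))"

definition slice_hyp :: "quat \<Rightarrow> quat measure"
  where "slice_hyp i = density (slice_area i) (\<lambda>z. ennreal (1 / (1 - (norm z)\<^sup>2)\<^sup>2))"


section \<open>Slice regular functions\<close>

text \<open>
  A function on the open unit ball is represented by the total function that vanishes outside
  the ball, so that equality of such functions is equality on the ball.
\<close>

definition slice_regular :: "(quat \<Rightarrow> quat) set"
  where "slice_regular = {f. (\<forall>q. q \<notin> qball \<longrightarrow> f q = 0) \<and> f differentiable_on qball \<and>
    (\<forall>i\<in>imag_sphere. \<forall>x y. slice_pt i x y \<in> slice_ball i \<longrightarrow>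
      vector_derivative (\<lambda>s. f (slice_pt i s y)) (at x) +
      i * vector_derivative (\<lambda>t. f (slice_pt i x t)) (at y) = 0)}"

definition real_deriv :: "(quat \<Rightarrow> quat) \<Rightarrow> quat \<Rightarrow> quat"
  where "real_deriv f q = vector_derivative (\<lambda>t. f (q + of_real t)) (at 0)"

text \<open>
  The extension of a function on a slice of the ball. With y the norm of the imaginary part of q,
  sgn (qimag q) is the imaginary unit of q, except that it is 0 for real q; there y = 0 and
  the formula returns g q for any value of the unit.
\<close>

definition slice_ext :: "quat \<Rightarrow> (quat \<Rightarrow> quat) \<Rightarrow> quat \<Rightarrow> quat"
  where "slice_ext i g q =
    (if q \<in> qball then
       let x = qre q; y = norm (qimag q); I = sgn (qimag q) in
       (1/2) *\<^sub>R ((1 + I * i) * g (slice_pt i x (- y)) + (1 - I * i) * g (slice_pt i x y))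
     else 0)"

text \<open>The two coordinates of w in the splitting of the quaternions as C(i) + C(i) j.\<close>

definition slice_fst :: "quat \<Rightarrow> quat \<Rightarrow> quat \<Rightarrow> quat"
  where "slice_fst i j w = (THE u. u \<in> slice_plane i \<and> (\<exists>v\<in>slice_plane i. w = u + v * j))"

definition slice_snd :: "quat \<Rightarrow> quat \<Rightarrow> quat \<Rightarrow> quat"
  where "slice_snd i j w = (THE v. v \<in> slice_plane i \<and> (\<exists>u\<in>slice_plane i. w = u + v * j))"

definition star_coeff :: "(nat \<Rightarrow> quat) \<Rightarrow> (nat \<Rightarrow> quat) \<Rightarrow> nat \<Rightarrow> quat"
  where "star_coeff a b n = (\<Sum>k\<le>n. a k * b (n - k))"

definition qseries :: "(nat \<Rightarrow> quat) \<Rightarrow> quat \<Rightarrow> quat"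
  where "qseries a q = (\<Sum>n. q ^ n * a n)"

text \<open>
  The star product of (1 - q cnj(a))^(-*), which is the series of q^n cnj(a)^n, with the
  polynomial a - q.
\<close>

definition slice_moebius :: "quat \<Rightarrow> quat \<Rightarrow> quat"
  where "slice_moebius a =
    qseries (star_coeff (\<lambda>n. qcnj a ^ n) (\<lambda>n. if n = 0 then a else if n = 1 then - 1 else 0))"

text \<open>
  The composition of f with the Moebius map through the splitting f = f_1 + f_2 j on the slice
  of i. It does not depend on the choice of j: replacing j = u k with u in C(i) replaces f_2 by
  f_2 u, and slice_ext is right linear.
\<close>

definition slice_comp :: "quat \<Rightarrow> quat \<Rightarrow> (quat \<Rightarrow> quat) \<Rightarrow> quat \<Rightarrow> quat \<Rightarrow> quat"
  where "slice_comp i j f a q =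
    slice_ext i (\<lambda>z. slice_fst i j (f (slice_moebius a z))) q +
    slice_ext i (\<lambda>z. slice_snd i j (f (slice_moebius a z))) q * j"


section \<open>Besov spaces\<close>

definition besov :: "real \<Rightarrow> quat \<Rightarrow> (quat \<Rightarrow> quat) set"
  where "besov p i = {f \<in> slice_regular. \<exists>n::nat. real n * p > 1 \<and>
    (\<integral>\<^sup>+z\<in>slice_ball i.
      ennreal (norm ((1 - (norm z)\<^sup>2) ^ n *\<^sub>R (real_deriv ^^ n) f z) powr p) \<partial>slice_hyp i) < \<infinity>}"

definition besov_integrand :: "real \<Rightarrow> (quat \<Rightarrow> quat) \<Rightarrow> quat \<Rightarrow> real"
  where "besov_integrand p f z = (1 - (norm z)\<^sup>2) powr p * norm (real_deriv f z) powr p"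

definition besov_rho :: "real \<Rightarrow> quat \<Rightarrow> (quat \<Rightarrow> quat) \<Rightarrow> real"
  where "besov_rho p i f = (LINT z:slice_ball i|slice_hyp i. besov_integrand p f z) powr (1 / p)"

definition fun_add :: "(quat \<Rightarrow> quat) \<Rightarrow> (quat \<Rightarrow> quat) \<Rightarrow> quat \<Rightarrow> quat"
  where "fun_add f g = (\<lambda>q. f q + g q)"

definition fun_scale :: "(quat \<Rightarrow> quat) \<Rightarrow> quat \<Rightarrow> quat \<Rightarrow> quat"
  where "fun_scale f c = (\<lambda>q. f q * c)"

definition fun_zero :: "quat \<Rightarrow> quat"
  where "fun_zero = (\<lambda>q. 0)"

text \<open>The quotient by the constant functions, as a set of equivalence classes.\<close>

definition besov_rel :: "real \<Rightarrow> quat \<Rightarrow> ((quat \<Rightarrow> quat) \<times> (quat \<Rightarrow> quat)) set"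
  where "besov_rel p i =
    {(f, g). f \<in> besov p i \<and> g \<in> besov p i \<and> (\<exists>c. \<forall>q\<in>qball. f q = g q + c)}"

definition besov_quot :: "real \<Rightarrow> quat \<Rightarrow> (quat \<Rightarrow> quat) set set"
  where "besov_quot p i = besov p i // besov_rel p i"

definition besov_class :: "real \<Rightarrow> quat \<Rightarrow> (quat \<Rightarrow> quat) \<Rightarrow> (quat \<Rightarrow> quat) set"
  where "besov_class p i f = besov_rel p i `` {f}"

definition quot_add ::
    "real \<Rightarrow> quat \<Rightarrow> (quat \<Rightarrow> quat) set \<Rightarrow> (quat \<Rightarrow> quat) set \<Rightarrow> (quat \<Rightarrow> quat) set"
  where "quot_add p i X Y = (\<Union>f\<in>X. \<Union>g\<in>Y. besov_class p i (fun_add f g))"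

definition quot_scale :: "real \<Rightarrow> quat \<Rightarrow> (quat \<Rightarrow> quat) set \<Rightarrow> quat \<Rightarrow> (quat \<Rightarrow> quat) set"
  where "quot_scale p i X c = (\<Union>f\<in>X. besov_class p i (fun_scale f c))"

text \<open>the_elem presupposes that the seminorm takes a single value on each class.\<close>

definition quot_norm :: "real \<Rightarrow> quat \<Rightarrow> (quat \<Rightarrow> quat) set \<Rightarrow> real"
  where "quot_norm p i X = the_elem (besov_rho p i ` X)"


section \<open>Complete seminormed right quaternionic spaces\<close>

locale quat_right_space =
  fixes V :: "'v set" and add :: "'v \<Rightarrow> 'v \<Rightarrow> 'v" and zero :: 'v and scale :: "'v \<Rightarrow> quat \<Rightarrow> 'v"
  assumes zero_closed: "zero \<in> V"
    and add_closed: "\<lbrakk>u \<in> V; v \<in> V\<rbrakk> \<Longrightarrow> add u v \<in> V"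
    and scale_closed: "v \<in> V \<Longrightarrow> scale v c \<in> V"
    and add_assoc: "\<lbrakk>u \<in> V; v \<in> V; w \<in> V\<rbrakk> \<Longrightarrow> add (add u v) w = add u (add v w)"
    and add_commute: "\<lbrakk>u \<in> V; v \<in> V\<rbrakk> \<Longrightarrow> add u v = add v u"
    and add_zero: "v \<in> V \<Longrightarrow> add v zero = v"
    and add_neg: "v \<in> V \<Longrightarrow> add v (scale v (- 1)) = zero"
    and scale_add: "\<lbrakk>u \<in> V; v \<in> V\<rbrakk> \<Longrightarrow> scale (add u v) c = add (scale u c) (scale v c)"
    and scale_add_scalar: "v \<in> V \<Longrightarrow> scale v (c + d) = add (scale v c) (scale v d)"
    and scale_scale: "v \<in> V \<Longrightarrow> scale (scale v c) d = scale v (c * d)"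
    and scale_one: "v \<in> V \<Longrightarrow> scale v 1 = v"

locale quat_seminormed_space = quat_right_space V add zero scale
  for V :: "'v set" and add zero scale +
  fixes nrm :: "'v \<Rightarrow> real"
  assumes nrm_nonneg: "v \<in> V \<Longrightarrow> nrm v \<ge> 0"
    and nrm_triangle: "\<lbrakk>u \<in> V; v \<in> V\<rbrakk> \<Longrightarrow> nrm (add u v) \<le> nrm u + nrm v"
    and nrm_scale: "v \<in> V \<Longrightarrow> nrm (scale v c) = nrm v * norm c"

locale quat_complete_seminormed_space = quat_seminormed_space V add zero scale nrm
  for V :: "'v set" and add zero scale nrm +
  assumes complete: "\<lbrakk>\<And>n::nat. s n \<in> V;
      \<And>e. e > 0 \<Longrightarrow> \<exists>N. \<forall>m\<ge>N. \<forall>n\<ge>N. nrm (add (s m) (scale (s n) (- 1))) < e\<rbrakk>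
    \<Longrightarrow> \<exists>v\<in>V. (\<lambda>n. nrm (add (s n) (scale v (- 1)))) \<longlonglongrightarrow> 0"

locale quat_banach_space = quat_complete_seminormed_space V add zero scale nrm
  for V :: "'v set" and add zero scale nrm +
  assumes nrm_eq_0: "\<lbrakk>v \<in> V; nrm v = 0\<rbrakk> \<Longrightarrow> v = zero"

end

theory Submission
  imports Defs "HOL-Complex_Analysis.Complex_Analysis"
begin

text \<open>
  On the slice of i a slice regular function is a pair of holomorphic functions F, G on the unit
  disc, and rho is the norm of (F', G') in L^p with weight (1 - |z|^2)^(p - 2). The triangle
  inequality is Minkowski's; completeness follows because norm convergence forces locally uniform
  convergence of (F', G'), whose limit has a primitive, and Fatou's lemma controls the tail. A
  function of seminorm zero is constant on the slice of i, hence on the real axis, hence by the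
  identity theorem on every slice. Invariance comes from
  (1 - |z|^2) |T'(z)| = 1 - |T(z)|^2 and the change of variables w = T(z).
  The seminorm uses the first derivative while membership in the space allows any order n; one
  descends from n + 1 to n by a Hardy inequality along radii, obtained from Jensen's inequality on
  the segment from z/2 to z and dilations of the disc.
\<close>

unbundle no fps_syntax

section \<open>Change of variables in the complex plane\<close>

text \<open>All estimates are made on extended-valued integrals over the disc, in the form
  \<open>besov_energy p f \<le> ennreal (pi * A powr p)\<close>, which expresses rho \<le> A without
  roots of possibly infinite numbers; the factor pi undoes the normalisation of the area measure.
  Two obstacles shape the rest. First, functions produced on one slice (a composite with a Moebius
  map, a primitive of a limit) must become differentiable functions of four real variables; the
  extension formula contains the imaginary unit of q, which is discontinuous at real points, so
  these need a separate argument. Second, n p > 1 excludes n = 0, so the descent ends at n = 1, and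
  each step down to some n \<ge> 1 meets the weight exponent n p - 2 > -1, which is the range of the
  Hardy inequality. The segment starts at z/2 and not at 0 so that the dilations by t \<ge> 1/2 cost
  at most a factor 4, while values on the inner disc of radius 1/2 are bounded by
  compactness.\<close>

definition cplane :: "real^2 \<Rightarrow> complex"
  where "cplane x = Complex (x$1) (x$2)"

text \<open>The change of variables theorem speaks of \<open>real^'n\<close>; \<open>cvec\<close>
  and its inverse \<open>cplane\<close> carry it over to the complex plane.\<close>

definition cvec :: "complex \<Rightarrow> real^2"
  where "cvec z = (\<chi> k. if k = 1 then Re z else Im z)"

lemma cplane_cvec [simp]: "cplane (cvec z) = z"
  by (simp add: cplane_def cvec_def complex_eq_iff)

lemma cvec_cplane [simp]: "cvec (cplane x) = x"
  by (simp add: cplane_def cvec_def vec_eq_iff forall_2)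

lemma cvec_image: "cvec ` A = cplane -` A"
proof
  show "cplane -` A \<subseteq> cvec ` A"
    by (metis cvec_cplane image_eqI subsetI vimage_eq)
qed auto

lemma bounded_linear_cplane: "bounded_linear cplane"
  by (rule linear_conv_bounded_linear[THEN iffD1], rule linearI)
     (simp_all add: cplane_def complex_eq_iff)

lemma bounded_linear_cvec: "bounded_linear cvec"
  by (rule linear_conv_bounded_linear[THEN iffD1], rule linearI)
     (simp_all add: cvec_def vec_eq_iff)

lemma measurable_cplane [measurable]: "cplane \<in> borel_measurable borel"
  by (intro borel_measurable_continuous_onI linear_continuous_on bounded_linear_cplane)

lemma Basis_real2: "(Basis :: (real^2) set) = {axis 1 1, axis 2 1}"
  by (auto simp: Basis_vec_def UNIV_2)

text \<open>Lebesgue measure is determined by its values on boxes, and \<open>cplane\<close> pulls a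
  box back to a box with the same side lengths.\<close>

lemma lborel_complex: "(lborel :: complex measure) = distr lborel borel cplane"
proof (rule lborel_eqI)
  fix l u :: complex
  assume le: "\<And>b. b \<in> Basis \<Longrightarrow> l \<bullet> b \<le> u \<bullet> b"
  then have re: "Re l \<le> Re u" and im: "Im l \<le> Im u"
    using le[of 1] le[of \<i>] by (auto simp: Basis_complex_def)
  have ne: "axis 1 1 \<noteq> (axis 2 1 :: real^2)"
    by (simp add: axis_eq_axis)
  have "cplane -` box l u = box (cvec l) (cvec u)"
    by (auto simp: box_def Basis_complex_def Basis_real2 inner_axis cplane_def cvec_def)
  then have "emeasure (distr lborel borel cplane) (box l u) = emeasure lborel (box (cvec l) (cvec u))"
    by (simp add: emeasure_distr)
  also have "\<dots> = (\<Prod>b\<in>Basis. (cvec u - cvec l) \<bullet> b)"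
    by (rule emeasure_lborel_box) (auto simp: Basis_real2 inner_axis cvec_def re im)
  also have "\<dots> = (\<Prod>b\<in>Basis. (u - l) \<bullet> b)"
    using ne by (simp add: Basis_real2 Basis_complex_def inner_axis cvec_def inner_diff_left complex_eq_iff)
  finally show "emeasure (distr lborel borel cplane) (box l u) = (\<Prod>b\<in>Basis. (u - l) \<bullet> b)" .
qed simp

lemma nn_integral_cplane:
  fixes f :: "complex \<Rightarrow> ennreal"
  assumes [measurable]: "f \<in> borel_measurable borel"
  shows "(\<integral>\<^sup>+z. f z \<partial>lborel) = (\<integral>\<^sup>+x. f (cplane x) \<partial>lborel)"
  by (subst lborel_complex, subst nn_integral_distr) auto

text \<open>
  The functions d and h replace the Jacobian and the composition f o g by total functions that are
  Borel measurable; outside S they are arbitrary.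
\<close>

lemma nn_integral_change_of_variables:
  fixes f :: "real^'n::{finite,wellorder} \<Rightarrow> real" and g :: "real^'n::_ \<Rightarrow> real^'n::_"
  assumes S: "S \<in> sets borel" and gS: "g ` S \<in> sets borel"
    and f [measurable]: "f \<in> borel_measurable borel" and nn: "\<And>x. 0 \<le> f x"
    and d: "d \<in> borel_measurable borel" "\<And>x. x \<in> S \<Longrightarrow> d x = \<bar>det (matrix (g' x))\<bar>"
    and h: "h \<in> borel_measurable borel" "\<And>x. x \<in> S \<Longrightarrow> h x = f (g x)"
    and der_g: "\<And>x. x \<in> S \<Longrightarrow> (g has_derivative g' x) (at x within S)"
    and inj: "inj_on g S"
  shows "(\<integral>\<^sup>+x. ennreal (indicator (g ` S) x * f x) \<partial>lborel) =
         (\<integral>\<^sup>+x. ennreal (indicator S x * (d x * h x)) \<partial>lborel)" (is "?L = ?R")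
proof -
  note [measurable] = S gS d(1) h(1)
  have 1: "(\<lambda>x. \<bar>det (matrix (g' x))\<bar> * f (g x)) absolutely_integrable_on S \<and>
           integral S (\<lambda>x. \<bar>det (matrix (g' x))\<bar> * f (g x)) = b
     \<longleftrightarrow> f absolutely_integrable_on (g ` S) \<and> integral (g ` S) f = b" for b
    using has_absolute_integral_change_of_variables[OF _ der_g inj, where f="\<lambda>x. vec (f x) :: real^1" and b = "vec b"] S
    by (simp add: absolutely_integrable_on_1_iff integral_on_1_eq)
  have dh: "d x * h x = \<bar>det (matrix (g' x))\<bar> * f (g x)" if "x \<in> S" for x
    using that d h by simp
  have nn2: "0 \<le> d x * h x" if "x \<in> S" for x
    using dh[OF that] nn by simp
  have "(\<lambda>x. d x * h x) absolutely_integrable_on S \<longleftrightarrow> (\<lambda>x. \<bar>det (matrix (g' x))\<bar> * f (g x)) absolutely_integrable_on S"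
    using dh by (intro set_integrable_cong) auto
  moreover have "integral S (\<lambda>x. d x * h x) = integral S (\<lambda>x. \<bar>det (matrix (g' x))\<bar> * f (g x))"
    using dh by (intro integral_cong) auto
  ultimately have 2: "(\<lambda>x. d x * h x) absolutely_integrable_on S \<and>
           integral S (\<lambda>x. d x * h x) = b
     \<longleftrightarrow> f absolutely_integrable_on (g ` S) \<and> integral (g ` S) f = b" for b
    using 1[of b] by simp
  have fin: "(\<integral>\<^sup>+x. ennreal (indicator A x * k x) \<partial>lborel) = ennreal b \<longleftrightarrow>
      k absolutely_integrable_on A \<and> integral A k = b"
    if A[measurable]: "A \<in> sets borel" and k[measurable]: "k \<in> borel_measurable borel"
    and nn: "\<And>x. x \<in> A \<Longrightarrow> 0 \<le> k x" and b: "0 \<le> b" for A k b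
  proof
    assume L: "(\<integral>\<^sup>+x. ennreal (indicator A x * k x) \<partial>lborel) = ennreal b"
    have "((\<lambda>x. indicator A x * k x) has_integral b) UNIV"
      using nn L b by (intro nn_integral_has_integral) (auto simp: indicator_def)
    moreover have "(\<lambda>x. indicator A x * k x) = (\<lambda>x. if x \<in> A then k x else 0)"
      by (auto simp: indicator_def)
    ultimately have "(k has_integral b) A"
      by (simp add: has_integral_restrict_UNIV)
    then show "k absolutely_integrable_on A \<and> integral A k = b"
      using nn by (auto simp: has_integral_iff nonnegative_absolutely_integrable_1)
  next
    assume "k absolutely_integrable_on A \<and> integral A k = b"
    then have "(k has_integral b) A"
      by (auto simp: has_integral_iff set_lebesgue_integral_eq_integral)
    from nn_integral_has_integral_lebesgue[OF _ this] nn
    show "(\<integral>\<^sup>+x. ennreal (indicator A x * k x) \<partial>lborel) = ennreal b" by simp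
  qed
  \<comment> \<open>Both integrals assume the same finite values b, so one is finite exactly when
    the other is; the infinite case then agrees as well.\<close>
  have 3: "?L = ennreal b \<longleftrightarrow> ?R = ennreal b" if b: "b \<ge> 0" for b
    using fin[of "g ` S" f b] fin[of S "\<lambda>x. d x * h x" b] 2 nn nn2 b by auto
  show ?thesis
  proof (cases ?L)
    case (real b)
    then show ?thesis using 3[of b] by auto
  next
    case top
    show ?thesis
    proof (cases ?R)
      case (real b)
      then show ?thesis using 3[of b] by auto
    next
      case top2: top
      then show ?thesis using top by simp
    qed
  qed
qed

text \<open>Multiplication by a + b i has the matrix with rows (a, -b) and (b, a).\<close>

lemma det_cvec_mult: "det (matrix (\<lambda>x. cvec (c * cplane x))) = (norm c)\<^sup>2"
  unfolding det_2 by (simp add: matrix_def cvec_def cplane_def axis_def cmod_power2) (simp add: power2_eq_square)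

text \<open>The real derivative of a holomorphic map is multiplication by \<open>deriv T\<close>,
  with Jacobian the square of its modulus. Stated for extended-valued integrals, the formula applies
  before any integrability is known.\<close>

lemma nn_integral_holomorphic_change_of_variables:
  fixes f :: "complex \<Rightarrow> real"
  assumes S: "open S" and T: "T holomorphic_on S" "inj_on T S"
    and f [measurable]: "f \<in> borel_measurable borel" and nn: "\<And>x. 0 \<le> f x"
  shows "(\<integral>\<^sup>+z. ennreal (indicator (T ` S) z * f z) \<partial>lborel) =
         (\<integral>\<^sup>+z. ennreal (indicator S z * ((norm (deriv T z))\<^sup>2 * f (T z))) \<partial>lborel)"
proof -
  \<comment> \<open>\<open>T\<close> and its derivative are controlled on S only; cut off by 0 they
    become Borel on the whole plane.\<close>
  define T' where "T' z = (if z \<in> S then T z else 0)" for z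
  define d' where "d' z = (if z \<in> S then (norm (deriv T z))\<^sup>2 else 0)" for z
  define g where "g = cvec \<circ> T \<circ> cplane"
  have TS: "open (T ` S)"
    using open_mapping_thm3[OF T(1) S T(2)] .
  have Sb [measurable]: "S \<in> sets borel" "T ` S \<in> sets borel"
    using S TS by auto
  have [measurable]: "T' \<in> borel_measurable borel"
    unfolding T'_def using T S by (intro borel_measurable_continuous_on_if) (auto intro: holomorphic_on_imp_continuous_on)
  have [measurable]: "d' \<in> borel_measurable borel"
    unfolding d'_def using T S
    by (intro borel_measurable_continuous_on_if continuous_intros) (auto intro!: holomorphic_on_imp_continuous_on holomorphic_deriv)
  have Seq: "cvec ` S = cplane -` S"
    by (rule cvec_image)
  have gS: "g ` (cvec ` S) = cplane -` (T ` S)"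
  proof -
    have "g ` (cvec ` S) = cvec ` (T ` S)" by (auto simp: g_def image_iff)
    also have "\<dots> = cplane -` (T ` S)"
      by (rule cvec_image)
    finally show ?thesis .
  qed
  have m1 [measurable]: "cvec ` S \<in> sets borel" "g ` (cvec ` S) \<in> sets borel"
    using measurable_sets[OF measurable_cplane] Sb by (auto simp: gS) (auto simp: Seq)
  have "(\<integral>\<^sup>+z. ennreal (indicator (T ` S) z * f z) \<partial>lborel) =
      (\<integral>\<^sup>+x. ennreal (indicator (T ` S) (cplane x) * f (cplane x)) \<partial>lborel)"
    by (rule nn_integral_cplane) simp
  also have "\<dots> = (\<integral>\<^sup>+x. ennreal (indicator (g ` (cvec ` S)) x * f (cplane x)) \<partial>lborel)"
    unfolding gS by (simp add: indicator_def)
  also have "\<dots> = (\<integral>\<^sup>+x. ennreal (indicator (cvec ` S) x * (d' (cplane x) * f (T' (cplane x)))) \<partial>lborel)"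
  proof (rule nn_integral_change_of_variables[where g' = "\<lambda>x v. cvec (deriv T (cplane x) * cplane v)"])
    fix x assume "x \<in> cvec ` S"
    then have x: "cplane x \<in> S" by (auto simp: Seq)
    show "d' (cplane x) = \<bar>det (matrix (\<lambda>v. cvec (deriv T (cplane x) * cplane v)))\<bar>"
      unfolding det_cvec_mult using x by (simp add: d'_def)
    show "f (T' (cplane x)) = f (cplane (g x))"
      using x by (simp add: T'_def g_def)
    have "(T has_derivative (\<lambda>v. deriv T (cplane x) * v)) (at (cplane x))"
      using holomorphic_derivI[OF T(1) S x] by (simp add: has_field_derivative_def)
    from has_derivative_compose[OF bounded_linear_imp_has_derivative[OF bounded_linear_cplane] this]
    have "((\<lambda>x. cvec (T (cplane x))) has_derivative (\<lambda>v. cvec (deriv T (cplane x) * cplane v))) (at x)"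
      by (rule bounded_linear.has_derivative[OF bounded_linear_cvec])
    then show "(g has_derivative (\<lambda>v. cvec (deriv T (cplane x) * cplane v))) (at x within cvec ` S)"
      by (simp add: g_def o_def has_derivative_at_withinI)
  next
    show "inj_on g (cvec ` S)"
      using T(2) by (auto simp: inj_on_def g_def) (metis cplane_cvec)
  qed (use m1 nn in auto)
  also have "\<dots> = (\<integral>\<^sup>+x. ennreal (indicator S (cplane x) * (d' (cplane x) * f (T' (cplane x)))) \<partial>lborel)"
    unfolding Seq by (simp add: indicator_def)
  also have "\<dots> = (\<integral>\<^sup>+z. ennreal (indicator S z * (d' z * f (T' z))) \<partial>lborel)"
    by (rule nn_integral_cplane[symmetric]) simp
  also have "\<dots> = (\<integral>\<^sup>+z. ennreal (indicator S z * ((norm (deriv T z))\<^sup>2 * f (T z))) \<partial>lborel)"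
    by (intro nn_integral_cong) (auto simp: indicator_def d'_def T'_def)
  finally show ?thesis .
qed

section \<open>Point bounds for holomorphic functions in weighted Lebesgue spaces\<close>

lemma ball_in_borel [measurable]: "ball z r \<in> sets borel"
  by auto

text \<open>A rotation maps the ball onto itself with Jacobian 1. This removes the angle after the
  exchange of integrals in \<open>area_submean_value\<close>.\<close>

lemma nn_integral_rotate_ball:
  fixes u :: "complex \<Rightarrow> real"
  assumes "norm c = 1" and [measurable]: "u \<in> borel_measurable borel" and "\<And>x. 0 \<le> u x"
  shows "(\<integral>\<^sup>+w. ennreal (indicator (ball 0 s) w * u (c * w)) \<partial>lborel) =
         (\<integral>\<^sup>+w. ennreal (indicator (ball 0 s) w * u w) \<partial>lborel)"
proof -
  have c: "c \<noteq> 0" using assms(1) by auto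
  have "(*) c ` ball 0 s = ball 0 s"
  proof -
    have "w \<in> (*) c ` ball 0 s" if "w \<in> ball 0 s" for w
      using that assms(1) c by (intro image_eqI[of _ _ "w / c"]) (auto simp: norm_divide)
    moreover have "c * w \<in> ball 0 s" if "w \<in> ball 0 s" for w
      using that assms(1) by (auto simp: norm_mult)
    ultimately show ?thesis by blast
  qed
  moreover have "deriv ((*) c) w = c" for w
    by (intro DERIV_imp_deriv) (auto intro!: derivative_eq_intros)
  moreover have "inj_on ((*) c) (ball 0 s)" using c by (auto simp: inj_on_def)
  moreover have "(*) c holomorphic_on ball 0 s" by (intro holomorphic_intros)
  ultimately show ?thesis
    using nn_integral_holomorphic_change_of_variables[of "ball 0 s" "(*) c" u] assms by simp
qed

text \<open>Cauchy's formula at the centre: along \<open>circlepath 0 1\<close> the derivative is 2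
  pi i times the point itself, which cancels the kernel 1/u.\<close>

lemma circle_mean_value:
  assumes "continuous_on (cball 0 1) k" "k holomorphic_on ball 0 1"
  shows "((\<lambda>t. k (exp (2 * of_real pi * \<i> * of_real t))) has_integral k 0) {0..1}"
proof -
  have "((\<lambda>u. k u / (u - 0)) has_contour_integral (2 * of_real pi * \<i> * k 0)) (circlepath 0 1)"
    by (rule Cauchy_integral_circlepath) (use assms in auto)
  then have "((\<lambda>x. k (circlepath 0 1 x) / circlepath 0 1 x * vector_derivative (circlepath 0 1) (at x within {0..1}))
     has_integral (2 * of_real pi * \<i> * k 0)) {0..1}"
    by (simp add: has_contour_integral_def)
  then have "((\<lambda>x. (2 * of_real pi * \<i>) * k (exp (2 * of_real pi * \<i> * of_real x)))
     has_integral (2 * of_real pi * \<i> * k 0)) {0..1}"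
  proof (rule has_integral_eq[rotated])
    fix x :: real assume x: "x \<in> {0..1}"
    have "vector_derivative (circlepath 0 1) (at x within {0..1}) = 2 * of_real pi * \<i> * circlepath 0 1 x"
      using vector_derivative_circlepath01[of x 0 1] x by (simp add: circlepath)
    then show "k (circlepath 0 1 x) / circlepath 0 1 x * vector_derivative (circlepath 0 1) (at x within {0..1}) =
      (2 * of_real pi * \<i>) * k (exp (2 * of_real pi * \<i> * of_real x))"
      unfolding \<open>vector_derivative _ _ = _\<close> by (simp add: circlepath)
  qed
  from has_integral_mult_right[OF this, of "1 / (2 * of_real pi * \<i>)"]
  show ?thesis by simp
qed

text \<open>The integrands to come are continuous on a ball and arbitrary outside it; the indicator
  is what makes them Borel on the whole plane.\<close>

lemma borel_measurable_indicator_ball_powr: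
  fixes h :: "complex \<Rightarrow> 'b::real_normed_vector" and v :: "complex \<Rightarrow> real"
  assumes h: "continuous_on (ball z r) h" and [measurable]: "v \<in> borel_measurable borel"
  shows "(\<lambda>w. indicator (ball z r) w * (v w * norm (h w) powr p)) \<in> borel_measurable borel"
proof -
  have [measurable]: "(\<lambda>w. if w \<in> ball z r then norm (h w) else 0) \<in> borel_measurable borel"
    by (intro borel_measurable_continuous_on_if continuous_intros h) auto
  have [measurable]: "(indicator (ball z r) :: complex \<Rightarrow> real) \<in> borel_measurable borel"
    by (intro borel_measurable_indicator) auto
  have "(\<lambda>w. indicator (ball z r) w * (v w * (if w \<in> ball z r then norm (h w) else 0) powr p)) \<in> borel_measurable borel"
    by measurable
  then show ?thesis
    by (rule measurable_cong[THEN iffD1, rotated]) (auto simp: indicator_def)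
qed

text \<open>In place of polar coordinates, every w in \<open>ball 0 s\<close> bounds |h z| by the
  average of |h| over the circle about z through z + w. Integrating over w and exchanging the
  integrals leaves, for each angle, an integral over a rotated ball, which does not depend on the
  angle.\<close>

lemma area_submean_value:
  fixes h :: "complex \<Rightarrow> complex"
  assumes h: "h holomorphic_on ball z R" and s: "s \<le> R"
  shows "ennreal (norm (h z)) * emeasure lborel (ball z s) \<le>
    (\<integral>\<^sup>+w. ennreal (indicator (ball z s) w * norm (h w)) \<partial>lborel)"
proof -
  define k where "k w = (if w \<in> ball 0 s then norm (h (z + w)) else 0)" for w
  define e where "e t = exp (2 * of_real pi * \<i> * of_real t)" for t :: real
  have ne: "norm (e t) = 1" for t by (simp add: e_def norm_exp)
  have hol: "(\<lambda>w. h (z + w)) holomorphic_on ball 0 s"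
    by (rule holomorphic_on_compose[unfolded o_def, OF _ holomorphic_on_subset[OF h], of "\<lambda>w. z + w"])
       (use s in \<open>auto intro!: holomorphic_intros simp: dist_norm\<close>)
  have k [measurable]: "k \<in> borel_measurable borel"
    unfolding k_def
    by (intro borel_measurable_continuous_on_if continuous_intros holomorphic_on_imp_continuous_on hol) auto
  have [measurable]: "e \<in> borel_measurable borel"
    unfolding e_def by (intro borel_measurable_continuous_onI continuous_intros)
  have knn: "0 \<le> k w" for w by (simp add: k_def)
  have pt: "ennreal (norm (h z)) \<le> (\<integral>\<^sup>+t. indicator {0..1} t * ennreal (k (e t * w)) \<partial>lborel)"
    if w: "w \<in> ball 0 s" for w
  proof -
    have "(\<lambda>u. u * w) ` cball 0 1 \<subseteq> ball 0 s"
    proof safe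
      fix u :: complex assume "u \<in> cball 0 1"
      then have "norm u * norm w \<le> 1 * norm w" by (intro mult_right_mono) auto
      then show "u * w \<in> ball 0 s" using w by (simp add: norm_mult)
    qed
    then have "(\<lambda>u. h (z + u * w)) holomorphic_on cball 0 1"
      by (intro holomorphic_on_compose[unfolded o_def, OF _ holomorphic_on_subset[OF hol], of "\<lambda>u. u * w"] holomorphic_intros)
    from circle_mean_value[OF holomorphic_on_imp_continuous_on[OF this] holomorphic_on_subset[OF this ball_subset_cball]]
    have 1: "((\<lambda>t. h (z + e t * w)) has_integral h z) {0..1}"
      by (simp add: e_def)
    have ew: "e t * w \<in> ball 0 s" for t using w ne by (simp add: norm_mult)
    have "continuous_on {0..1} (\<lambda>t. (\<lambda>u. h (z + u)) (e t * w))"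
      by (rule continuous_on_compose2[OF holomorphic_on_imp_continuous_on[OF hol]])
         (use ew in \<open>auto intro!: continuous_intros simp: e_def\<close>)
    then have 2: "(\<lambda>t. norm (h (z + e t * w))) integrable_on {0..1}"
      by (intro integrable_continuous_interval continuous_intros) simp
    have "norm (h z) \<le> integral {0..1} (\<lambda>t. norm (h (z + e t * w)))"
      using integral_norm_bound_integral[OF has_integral_integrable[OF 1] 2] 1 by (simp add: integral_unique)
    also have "\<dots> = integral {0..1} (\<lambda>t. k (e t * w))"
      using ew by (simp add: k_def)
    finally have 3: "norm (h z) \<le> integral {0..1} (\<lambda>t. k (e t * w))" .
    have "((\<lambda>t. k (e t * w)) has_integral integral {0..1} (\<lambda>t. k (e t * w))) {0..1}"
      using 2 ew by (auto simp: k_def)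
    from nn_integral_has_integral_lebesgue[OF knn this]
    have "ennreal (integral {0..1} (\<lambda>t. k (e t * w))) = (\<integral>\<^sup>+t. ennreal (indicator {0..1} t * k (e t * w)) \<partial>lborel)"
      by simp
    also have "\<dots> = (\<integral>\<^sup>+t. indicator {0..1} t * ennreal (k (e t * w)) \<partial>lborel)"
      by (intro nn_integral_cong) (auto simp: indicator_def)
    finally have "(\<integral>\<^sup>+t. indicator {0..1} t * ennreal (k (e t * w)) \<partial>lborel) = ennreal (integral {0..1} (\<lambda>t. k (e t * w)))" ..
    then show ?thesis using 3 by (simp add: ennreal_leI)
  qed
  have "ennreal (norm (h z)) * emeasure lborel (ball z s) = ennreal (norm (h z)) * emeasure lborel (ball (0::complex) s)"
  proof -
    have "emeasure (lborel :: complex measure) (ball z s) = emeasure (distr lborel borel ((+) z)) (ball z s)"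
      by (simp add: lborel_distr_plus)
    also have "\<dots> = emeasure (lborel :: complex measure) ((+) z -` ball z s)" by (subst emeasure_distr) auto
    also have "(+) z -` ball z s = ball 0 s" by (auto simp: dist_norm)
    finally show ?thesis by simp
  qed
  also have "\<dots> = (\<integral>\<^sup>+w. ennreal (norm (h z)) * indicator (ball (0::complex) s) w \<partial>lborel)"
    by (simp add: nn_integral_cmult_indicator)
  also have "\<dots> \<le> (\<integral>\<^sup>+w. (\<integral>\<^sup>+t. indicator (ball 0 s) w * (indicator {0..1} t * ennreal (k (e t * w))) \<partial>lborel) \<partial>lborel)"
    using pt by (intro nn_integral_mono) (auto simp: indicator_def)
  also have "\<dots> = (\<integral>\<^sup>+t. (\<integral>\<^sup>+w. indicator (ball 0 s) w * (indicator {0..1} t * ennreal (k (e t * w))) \<partial>lborel) \<partial>lborel)"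
    by (rule lborel_pair.Fubini'[symmetric]) measurable
  also have "\<dots> = (\<integral>\<^sup>+t. indicator {0..1} t * (\<integral>\<^sup>+w. ennreal (indicator (ball 0 s) w * k (e t * w)) \<partial>lborel) \<partial>lborel)"
    by (subst nn_integral_cmult[symmetric]) (auto intro!: nn_integral_cong simp: indicator_def)
  also have "\<dots> = (\<integral>\<^sup>+t. indicator {0..1::real} t * (\<integral>\<^sup>+w. ennreal (indicator (ball 0 s) w * k w) \<partial>lborel) \<partial>lborel)"
    by (subst nn_integral_rotate_ball[OF ne k knn]) simp
  also have "\<dots> = (\<integral>\<^sup>+w. ennreal (indicator (ball 0 s) w * k w) \<partial>lborel)"
    by (subst nn_integral_multc) auto
  also have "\<dots> = (\<integral>\<^sup>+w. ennreal (indicator (ball z s) (z + w) * norm (h (z + w))) \<partial>lborel)"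
    by (intro nn_integral_cong) (auto simp: indicator_def k_def dist_norm)
  also have "\<dots> = (\<integral>\<^sup>+w. ennreal (indicator (ball z s) w * norm (h w)) \<partial>distr lborel borel ((+) z))"
    using borel_measurable_indicator_ball_powr[OF holomorphic_on_imp_continuous_on[OF holomorphic_on_subset[OF h subset_ball[OF s]]], of "\<lambda>_. 1" 1]
    by (subst nn_integral_distr) auto
  finally show ?thesis by (simp add: lborel_distr_plus)
qed

abbreviation disc_Lp :: "real \<Rightarrow> real \<Rightarrow> (complex \<Rightarrow> complex) \<Rightarrow> ennreal"
  where "disc_Lp p a F \<equiv>
    \<integral>\<^sup>+z. ennreal (indicator (ball 0 1) z * ((1 - (norm z)\<^sup>2) powr a * norm (F z) powr p)) \<partial>lborel"

text \<open>On a small ball about z the weight is at least m, and x \<le> 1 + x^p with x = |h| / N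
  takes the place of Hoelder's inequality after the mean value bound. Dividing by N first makes the
  result linear in N.\<close>

lemma weighted_Lp_point_bound:
  fixes r p :: real
  assumes r: "0 \<le> r" "r < 1" and p: "p \<ge> 1"
  obtains C where "C > 0" and "\<And>h N z. h holomorphic_on ball 0 1 \<Longrightarrow> N > 0 \<Longrightarrow>
    disc_Lp p (p - 2) h \<le> ennreal (N powr p) \<Longrightarrow>
    norm z \<le> r \<Longrightarrow> norm (h z) \<le> C * N"
proof -
  \<comment> \<open>With this radius r + s = 1 - s, so the balls about points of norm at most r stay
    at distance s from the unit circle.\<close>
  define s where "s = (1 - r) / 2"
  \<comment> \<open>On those balls 1 - |w|^2 lies between s and 1; its power p - 2 is at least
    s^(p-2) if p \<ge> 2 and at least 1 if p < 2.\<close>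
  define m where "m = min 1 (s powr (p - 2))"
  define E where "E = measure lborel (ball (0::complex) s)"
  have s: "s > 0" "s \<le> 1" using r by (auto simp: s_def)
  have m: "m > 0" using s by (simp add: m_def)
  have E: "E > 0" using s by (simp add: E_def content_ball_pos)
  have Ez: "emeasure lborel (ball z s) = ennreal E" for z :: complex
    using s by (simp add: E_def emeasure_ball content_ball)
  show ?thesis
  proof (rule that)
    show "(E + 1 / m) / E > 0" using E m by (simp add: add_pos_pos)
  next
    fix h :: "complex \<Rightarrow> complex" and N and z :: complex
    assume h: "h holomorphic_on ball 0 1" and N: "N > 0"
      and I: "disc_Lp p (p - 2) h \<le> ennreal (N powr p)"
      and z: "norm z \<le> r"
    have sub: "ball z s \<subseteq> ball 0 (1 - s)"
    proof
      fix w assume "w \<in> ball z s"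
      then have "norm (z - w) < s" by (simp add: dist_norm)
      moreover have "norm w \<le> norm z + norm (z - w)"
        by (metis norm_minus_commute norm_triangle_sub)
      moreover have "r + s = 1 - s" by (simp add: s_def field_simps)
      ultimately show "w \<in> ball 0 (1 - s)" using z by simp
    qed
    then have sub1: "ball z s \<subseteq> ball 0 1" using s by auto
    have pt: "norm (h w) \<le> N * (1 + (1 / m) * ((1 - (norm w)\<^sup>2) powr (p - 2) * norm (h w) powr p / N powr p))"
      if w: "w \<in> ball z s" for w
    proof -
      have "norm w \<le> 1 - s" using sub w by auto
      then have a: "s \<le> 1 - (norm w)\<^sup>2"
        using s by (smt (verit) norm_ge_zero power2_eq_square mult_left_le_one_le)
      have b: "m \<le> (1 - (norm w)\<^sup>2) powr (p - 2)"
      proof (cases "p \<ge> 2")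
        case True
        then show ?thesis using powr_mono2[of "p - 2" s "1 - (norm w)\<^sup>2"] a s by (auto simp: m_def)
      next
        case False
        then have "1 powr (p - 2) \<le> (1 - (norm w)\<^sup>2) powr (p - 2)"
          using a s by (intro powr_mono2') auto
        then show ?thesis by (auto simp: m_def)
      qed
      define x where "x = norm (h w) / N"
      have x: "x \<ge> 0" using N by (simp add: x_def)
      have "x \<le> 1 + x powr p"
      proof (cases "x \<le> 1")
        case False
        then have "x powr 1 \<le> x powr p" using p by (intro powr_mono) auto
        then show ?thesis using False by auto
      qed (smt (verit) powr_ge_zero)
      also have "x powr p \<le> (1 / m) * ((1 - (norm w)\<^sup>2) powr (p - 2) * x powr p)"
        using mult_right_mono[OF b, of "x powr p"] m by (simp add: field_simps)
      finally have "x \<le> 1 + (1 / m) * ((1 - (norm w)\<^sup>2) powr (p - 2) * x powr p)" by simp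
      from mult_left_mono[OF this, of N] show ?thesis
        using N by (simp add: x_def powr_divide)
    qed
    have meas: "(\<lambda>w. indicator (ball 0 1) w * ((1 - (norm w)\<^sup>2) powr (p - 2) * norm (h w) powr p)) \<in> borel_measurable borel"
      by (rule borel_measurable_indicator_ball_powr) (intro holomorphic_on_imp_continuous_on h, measurable)
    have "ennreal (norm (h z)) * ennreal E \<le> (\<integral>\<^sup>+w. ennreal (indicator (ball z s) w * norm (h w)) \<partial>lborel)"
      using area_submean_value[OF holomorphic_on_subset[OF h sub1], of s] by (simp add: Ez)
    also have "\<dots> \<le> (\<integral>\<^sup>+w. ennreal N * indicator (ball z s) w + ennreal (N / m / N powr p) * ennreal (indicator (ball 0 1) w * ((1 - (norm w)\<^sup>2) powr (p - 2) * norm (h w) powr p)) \<partial>lborel)"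
    proof (intro nn_integral_mono)
      fix w
      show "ennreal (indicator (ball z s) w * norm (h w)) \<le> ennreal N * indicator (ball z s) w + ennreal (N / m / N powr p) * ennreal (indicator (ball 0 1) w * ((1 - (norm w)\<^sup>2) powr (p - 2) * norm (h w) powr p))"
      proof (cases "w \<in> ball z s")
        case True
        then have "w \<in> ball 0 1" using sub1 by auto
        with True pt[OF True] N m show ?thesis
          by (simp add: ennreal_mult'[symmetric] ennreal_plus[symmetric] algebra_simps ennreal_leI del: ennreal_plus)
      qed auto
    qed
    also have "\<dots> = ennreal N * ennreal E + ennreal (N / m / N powr p) * disc_Lp p (p - 2) h"
    proof (subst nn_integral_add)
      note [measurable] = meas ball_in_borel
      show "(\<lambda>w. ennreal N * indicator (ball z s) w) \<in> borel_measurable lborel"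
        "(\<lambda>w. ennreal (N / m / N powr p) * ennreal (indicator (ball 0 1) w * ((1 - (norm w)\<^sup>2) powr (p - 2) * norm (h w) powr p))) \<in> borel_measurable lborel"
        by measurable
    qed (use meas in \<open>simp add: nn_integral_cmult nn_integral_cmult_indicator Ez\<close>)
    also have "\<dots> \<le> ennreal N * ennreal E + ennreal (N / m / N powr p) * ennreal (N powr p)"
      by (intro add_mono mult_left_mono I) auto
    also have "\<dots> = ennreal (N * (E + 1 / m))"
      using N E m by (simp add: ennreal_mult'[symmetric] ennreal_plus[symmetric] algebra_simps del: ennreal_plus)
    finally have "norm (h z) * E \<le> N * (E + 1 / m)"
      using N E m by (simp add: ennreal_mult'[symmetric] )
    then show "norm (h z) \<le> (E + 1 / m) / E * N"
      using E by (simp add: field_simps)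
  qed
qed

section \<open>A Hardy inequality on the disc\<close>

text \<open>Young's inequality for y times c^(p-1), with exponents p and p/(p-1), is the convexity
  of the p-th power in disguise and covers y = 0 and c = 0 without differentiation. The Jensen and
  Minkowski inequalities below both rest on it.\<close>

lemma powr_tangent:
  fixes p y c :: real
  assumes p: "p > 1" and "y \<ge> 0" "c \<ge> 0"
  shows "c powr p + p * c powr (p - 1) * (y - c) \<le> y powr p"
proof -
  have "y * c powr (p - 1) \<le> y powr p / p + (c powr (p - 1)) powr (p / (p - 1)) / (p / (p - 1))"
    by (rule Youngs_inequality) (use assms in \<open>auto simp: field_simps\<close>)
  then have "p * (y * c powr (p - 1)) \<le> p * (y powr p / p + c powr p * (p - 1) / p)"
    using p by (intro mult_left_mono) (auto simp: powr_powr)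
  then have 1: "p * (y * c powr (p - 1)) \<le> y powr p + c powr p * (p - 1)"
    using p by (simp add: distrib_left)
  have "c powr (p - 1) * c = c powr p"
    using assms by (cases "c = 0") (auto simp: powr_diff)
  then have "p * c powr (p - 1) * (y - c) = p * (y * c powr (p - 1)) - p * c powr p"
    by (simp add: algebra_simps)
  moreover have "c powr p * (p - 1) = p * c powr p - c powr p" by (simp add: algebra_simps)
  ultimately show ?thesis using 1 by linarith
qed

text \<open>Jensen's inequality for the function h/w and the probability measure with density w / W:
  the tangent inequality at the mean c = H / W is integrated, and at the mean the linear term
  vanishes.\<close>

lemma weighted_Jensen_integral:
  fixes h w :: "real \<Rightarrow> real" and p :: real
  assumes ab: "a < b" and p: "p > 1"
    and h: "continuous_on {a..b} h" "\<And>t. t \<in> {a..b} \<Longrightarrow> 0 \<le> h t"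
    and w: "continuous_on {a..b} w" "\<And>t. t \<in> {a..b} \<Longrightarrow> 0 < w t"
  shows "(integral {a..b} h) powr p \<le> (integral {a..b} w) powr (p - 1) * integral {a..b} (\<lambda>t. h t powr p * w t powr (1 - p))"
proof -
  define H where "H = integral {a..b} h"
  define W where "W = integral {a..b} w"
  define c where "c = H / W"
  have H: "H \<ge> 0" unfolding H_def using h by (intro integral_nonneg integrable_continuous_interval) auto
  have W: "W > 0"
  proof -
    have "W \<ge> 0" unfolding W_def using w by (intro integral_nonneg integrable_continuous_interval) (auto simp: less_imp_le)
    moreover have "W \<noteq> 0"
    proof
      assume "W = 0"
      then have "(w has_integral 0) {a..b}"
        unfolding W_def using integrable_continuous_interval[OF w(1)] by (metis integrable_integral)
      then have "w a = 0"
        using has_integral_0_cbox_imp_0[of a b w a] w ab by (auto simp: cbox_interval less_imp_le)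
      then show False using w(2)[of a] ab by simp
    qed
    ultimately show ?thesis by simp
  qed
  have c: "c \<ge> 0" using H W by (simp add: c_def)
  have pt: "w t * c powr p + p * c powr (p - 1) * (h t - c * w t) \<le> h t powr p * w t powr (1 - p)"
    if t: "t \<in> {a..b}" for t
  proof -
    have wt: "w t > 0" and ht: "h t \<ge> 0" using t w h by auto
    have "w t * (c powr p + p * c powr (p - 1) * (h t / w t - c)) \<le> w t * (h t / w t) powr p"
      using powr_tangent[OF p _ c, of "h t / w t"] wt ht by (intro mult_left_mono) auto
    also have "w t * (h t / w t) powr p = h t powr p * w t powr (1 - p)"
      using wt ht by (simp add: powr_divide powr_diff)
    finally show ?thesis using wt by (simp add: algebra_simps)
  qed
  have hi: "h integrable_on {a..b}" and wi: "w integrable_on {a..b}"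
    using h w by (auto intro: integrable_continuous_interval)
  have "((\<lambda>t. w t * c powr p + p * c powr (p - 1) * (h t - c * w t)) has_integral
      (W * c powr p + p * c powr (p - 1) * (H - c * W))) {a..b}"
    unfolding H_def W_def
    by (intro has_integral_add has_integral_mult_left has_integral_mult_right has_integral_diff integrable_integral hi wi)
  moreover have "((\<lambda>t. h t powr p * w t powr (1 - p)) has_integral integral {a..b} (\<lambda>t. h t powr p * w t powr (1 - p))) {a..b}"
    by (intro integrable_integral integrable_continuous_interval continuous_on_mult continuous_on_powr' continuous_on_const h w)
       (use h w p in \<open>force+\<close>)
  ultimately have "W * c powr p + p * c powr (p - 1) * (H - c * W) \<le> integral {a..b} (\<lambda>t. h t powr p * w t powr (1 - p))"
    using pt by (rule has_integral_le)
  moreover have "H - c * W = 0" using W by (simp add: c_def)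
  ultimately have 1: "W * c powr p \<le> integral {a..b} (\<lambda>t. h t powr p * w t powr (1 - p))" by simp
  have "H powr p = W powr (p - 1) * (W * c powr p)"
    using W H by (simp add: c_def powr_divide powr_diff)
  also have "\<dots> \<le> W powr (p - 1) * integral {a..b} (\<lambda>t. h t powr p * w t powr (1 - p))"
    using 1 by (intro mult_left_mono) auto
  finally show ?thesis by (simp add: H_def W_def)
qed

text \<open>From the explicit antiderivative; the endpoint 1/2 contributes a nonpositive term, which
  is dropped.\<close>

lemma radial_weight_integral:
  fixes \<gamma> \<delta> :: real
  assumes "\<gamma> > 1" "\<delta> > 0"
  shows "integral {1/2..1} (\<lambda>t. (1 - t + \<delta>) powr - \<gamma>) \<le> \<delta> powr (1 - \<gamma>) / (\<gamma> - 1)"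
proof -
  have "((\<lambda>t. (1 - t + \<delta>) powr - \<gamma>) has_integral ((1 - 1 + \<delta>) powr (1 - \<gamma>) / (\<gamma> - 1) - (1 - 1/2 + \<delta>) powr (1 - \<gamma>) / (\<gamma> - 1))) {1/2..1}"
  proof (rule fundamental_theorem_of_calculus)
    fix t :: real assume "t \<in> {1/2..1}"
    then have t: "1 - t + \<delta> > 0" using assms by auto
    show "((\<lambda>t. (1 - t + \<delta>) powr (1 - \<gamma>) / (\<gamma> - 1)) has_vector_derivative (1 - t + \<delta>) powr - \<gamma>) (at t within {1/2..1})"
    proof -
      have "((\<lambda>t. (1 - t + \<delta>) powr (1 - \<gamma>)) has_real_derivative (\<gamma> - 1) * (1 - t + \<delta>) powr - \<gamma>) (at t within {1/2..1})"
      proof -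
        have "((\<lambda>t. 1 - t + \<delta>) has_real_derivative -1) (at t)" by (auto intro!: derivative_eq_intros)
        from DERIV_fun_powr[OF this t, of "1 - \<gamma>"]
        have "((\<lambda>t. (1 - t + \<delta>) powr (1 - \<gamma>)) has_real_derivative (\<gamma> - 1) * (1 - t + \<delta>) powr - \<gamma>) (at t)"
          by (simp add: algebra_simps)
        then show ?thesis by (rule has_field_derivative_at_within)
      qed
      from DERIV_cdivide[OF this, of "\<gamma> - 1"] show ?thesis
        using assms by (simp add: has_real_derivative_iff_has_vector_derivative)
    qed
  qed auto
  from integral_unique[OF this] show ?thesis using assms by simp
qed

text \<open>
  Jensen's inequality with weight (1 - t + \<delta>)^(-\<gamma>). Any \<gamma> strictly between 1 and
  1 + (\<alpha> + 1) / (p - 1) would do; the midpoint leaves an integrable power of \<delta> after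
  multiplication by \<delta>^\<alpha>.
\<close>

lemma Hardy_pointwise:
  fixes \<alpha> p :: real
  assumes \<alpha>: "\<alpha> > -1" and p: "p > 1"
  obtains C where "C > 0" and "\<And>k \<delta>. \<delta> > 0 \<Longrightarrow> continuous_on {1/2..1} k \<Longrightarrow> (\<And>t. t \<in> {1/2..1} \<Longrightarrow> 0 \<le> k t) \<Longrightarrow>
    (integral {1/2..1} k) powr p \<le> C * \<delta> powr (- (\<alpha> + 1) / 2) *
      integral {1/2..1} (\<lambda>t. (1 - t + \<delta>) powr (p - 1 + (\<alpha> + 1) / 2) * k t powr p)"
proof -
  define \<gamma> where "\<gamma> = 1 + (\<alpha> + 1) / (2 * (p - 1))"
  have \<gamma>: "\<gamma> > 1" using \<alpha> p by (simp add: \<gamma>_def)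
  have g1: "(\<gamma> - 1) * (p - 1) = (\<alpha> + 1) / 2" using p by (simp add: \<gamma>_def field_simps)
  show ?thesis
  proof (rule that)
    show "(\<gamma> - 1) powr (1 - p) > 0" using \<gamma> by simp
    fix k :: "real \<Rightarrow> real" and \<delta> :: real
    assume \<delta>: "\<delta> > 0" and k: "continuous_on {1/2..1} k" "\<And>t. t \<in> {1/2..1} \<Longrightarrow> 0 \<le> k t"
    define w where "w t = (1 - t + \<delta>) powr - \<gamma>" for t
    have w: "continuous_on {1/2..1} w" "\<And>t. t \<in> {1/2..1} \<Longrightarrow> 0 < w t"
      unfolding w_def using \<delta> by (auto intro!: continuous_intros)
    have ww: "w t powr (1 - p) = (1 - t + \<delta>) powr (p - 1 + (\<alpha> + 1) / 2)" for t
    proof -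
      have "- \<gamma> * (1 - p) = (p - 1) + (\<gamma> - 1) * (p - 1)" by (simp add: algebra_simps)
      then show ?thesis using g1 by (simp add: w_def powr_powr)
    qed
    have "integral {1/2..1} w \<ge> 0"
      using w by (intro integral_nonneg integrable_continuous_interval) (auto simp: less_imp_le)
    then have "(integral {1/2..1} w) powr (p - 1) \<le> (\<delta> powr (1 - \<gamma>) / (\<gamma> - 1)) powr (p - 1)"
      using radial_weight_integral[OF \<gamma> \<delta>] p by (intro powr_mono2) (auto simp: w_def[abs_def])
    also have "\<dots> = \<delta> powr ((1 - \<gamma>) * (p - 1)) * (\<gamma> - 1) powr (1 - p)"
      using \<gamma> powr_minus_divide[of "\<gamma> - 1" "p - 1"] by (simp add: powr_divide powr_powr)
    also have "(1 - \<gamma>) * (p - 1) = - (\<alpha> + 1) / 2" using g1 by (simp add: algebra_simps)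
    finally have W: "(integral {1/2..1} w) powr (p - 1) \<le> (\<gamma> - 1) powr (1 - p) * \<delta> powr (- (\<alpha> + 1) / 2)"
      by (simp add: mult.commute)
    have "(integral {1/2..1} k) powr p \<le> (integral {1/2..1} w) powr (p - 1) * integral {1/2..1} (\<lambda>t. k t powr p * w t powr (1 - p))"
      by (rule weighted_Jensen_integral[OF _ p k w]) auto
    also have "\<dots> \<le> (\<gamma> - 1) powr (1 - p) * \<delta> powr (- (\<alpha> + 1) / 2) * integral {1/2..1} (\<lambda>t. k t powr p * w t powr (1 - p))"
      by (intro mult_right_mono W integral_nonneg integrable_continuous_interval
            continuous_on_mult continuous_on_powr' continuous_on_const k w)
         (use k w p in \<open>force+\<close>)
    finally show "(integral {1/2..1} k) powr p \<le> (\<gamma> - 1) powr (1 - p) * \<delta> powr (- (\<alpha> + 1) / 2) *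
      integral {1/2..1} (\<lambda>t. (1 - t + \<delta>) powr (p - 1 + (\<alpha> + 1) / 2) * k t powr p)"
      by (simp add: ww mult.commute)
  qed
qed

text \<open>The dilation by t has Jacobian t^2 in the plane, and t \<ge> 1/2 bounds its inverse by
  4.\<close>

lemma nn_integral_dilation_le:
  fixes g :: "complex \<Rightarrow> ennreal"
  assumes [measurable]: "g \<in> borel_measurable borel" and t: "t \<ge> 1/2"
  shows "(\<integral>\<^sup>+z. g (t *\<^sub>R z) \<partial>lborel) \<le> 4 * (\<integral>\<^sup>+z. g z \<partial>lborel)"
proof -
  have "(\<integral>\<^sup>+z. g z \<partial>lborel) = (\<integral>\<^sup>+z. g z \<partial>density (distr lborel borel (\<lambda>x. 0 + t *\<^sub>R x)) (\<lambda>_. \<bar>t\<bar>^DIM(complex)))"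
    using t by (subst lborel_affine[of t 0]) auto
  also have "\<dots> = ennreal (t\<^sup>2) * (\<integral>\<^sup>+z. g (t *\<^sub>R z) \<partial>lborel)"
    by (simp add: nn_integral_density nn_integral_distr nn_integral_cmult)
  finally have "4 * (\<integral>\<^sup>+z. g z \<partial>lborel) = ennreal (4 * t\<^sup>2) * (\<integral>\<^sup>+z. g (t *\<^sub>R z) \<partial>lborel)"
    by (simp add: ennreal_mult' mult.assoc)
  moreover have "1 \<le> 4 * t\<^sup>2" using power_mono[OF t, of 2] by (simp add: power2_eq_square)
  ultimately show ?thesis
    by (metis ennreal_1 ennreal_leI mult_1 mult_right_mono zero_le)
qed

lemma nn_integral_powr_from:
  fixes a \<beta> :: real
  assumes "\<beta> > -1" "a < 1"
  shows "(\<integral>\<^sup>+t. ennreal (indicator {a<..1} t * (t - a) powr \<beta>) \<partial>lborel) = ennreal ((1 - a) powr (\<beta> + 1) / (\<beta> + 1))"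
proof -
  have "(\<integral>\<^sup>+t. ennreal (indicator {a<..1} t * (t - a) powr \<beta>) \<partial>lborel) = (\<integral>\<^sup>+t. ennreal (indicator {0..1-a} t * t powr \<beta>) \<partial>lborel)"
    by (subst nn_integral_real_affine[of _ 1 a]) (auto intro!: nn_integral_cong simp: indicator_def)
  also have "\<dots> = ennreal ((1 - a) powr (\<beta> + 1) / (\<beta> + 1))"
    by (rule nn_integral_has_integral_lebesgue) (use has_integral_powr_from_0[of \<beta> "1 - a"] assms in auto)
  finally show ?thesis .
qed

text \<open>Here w stands for t z, so |w| / t is the modulus of z. With \<delta> = 1 - |w| / t and
  1/2 \<le> t \<le> 1, \<delta> lies between t - |w| and twice that, and 1 - t + \<delta> \<le> 2 (1
  - |w|). What remains is the integral of (t - |w|)^\<beta> from |w| to 1, convergent because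
  \<beta> > -1.\<close>

lemma nn_integral_radial_kernel_le:
  fixes \<beta> \<eta> :: real and w :: complex
  assumes \<beta>: "\<beta> > -1" and \<eta>: "\<eta> \<ge> 0" and w: "norm w < 1"
  shows "(\<integral>\<^sup>+t. ennreal (indicator {1/2..1} t * (indicator (ball 0 1) ((1 / t) *\<^sub>R w) *
            ((1 - norm w / t) powr \<beta> * (1 - t + (1 - norm w / t)) powr \<eta>))) \<partial>lborel)
         \<le> ennreal (2 powr (\<bar>\<beta>\<bar> + \<eta>) / (\<beta> + 1) * (1 - norm w) powr (\<beta> + \<eta> + 1))"
proof -
  let ?K = "2 powr (\<bar>\<beta>\<bar> + \<eta>) * (1 - norm w) powr \<eta>"
  have "(\<integral>\<^sup>+t. ennreal (indicator {1/2..1} t * (indicator (ball 0 1) ((1 / t) *\<^sub>R w) *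
            ((1 - norm w / t) powr \<beta> * (1 - t + (1 - norm w / t)) powr \<eta>))) \<partial>lborel)
     \<le> (\<integral>\<^sup>+t. ennreal ?K * ennreal (indicator {norm w<..1} t * (t - norm w) powr \<beta>) \<partial>lborel)"
  proof (intro nn_integral_mono)
    fix t :: real
    show "ennreal (indicator {1/2..1} t * (indicator (ball 0 1) ((1 / t) *\<^sub>R w) *
            ((1 - norm w / t) powr \<beta> * (1 - t + (1 - norm w / t)) powr \<eta>)))
       \<le> ennreal ?K * ennreal (indicator {norm w<..1} t * (t - norm w) powr \<beta>)"
    proof (cases "t \<in> {1/2..1} \<and> norm w < t")
      case True
      define \<delta> where "\<delta> = 1 - norm w / t"
      have d: "\<delta> = (t - norm w) / t" using True by (simp add: \<delta>_def field_simps)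
      have d1: "t - norm w \<le> \<delta>" and d2: "\<delta> \<le> 2 * (t - norm w)"
        using True mult_right_mono[of t 1 "t - norm w"] mult_right_mono[of "1/2" t "t - norm w"]
        unfolding d by (auto simp: field_simps)
      have d0: "\<delta> > 0" using d1 True by auto
      have b: "\<delta> powr \<beta> \<le> 2 powr \<bar>\<beta>\<bar> * (t - norm w) powr \<beta>"
      proof (cases "\<beta> \<ge> 0")
        case b0: True
        have "\<delta> powr \<beta> \<le> (2 * (t - norm w)) powr \<beta>" using d2 d0 b0 by (intro powr_mono2) auto
        also have "\<dots> = 2 powr \<beta> * (t - norm w) powr \<beta>" by (rule powr_mult)
        finally show ?thesis using b0 by simp
      next
        case b0: False
        have "\<delta> powr \<beta> \<le> (t - norm w) powr \<beta>" using d1 True b0 by (intro powr_mono2') auto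
        also have "\<dots> \<le> 2 powr \<bar>\<beta>\<bar> * (t - norm w) powr \<beta>"
          using ge_one_powr_ge_zero[of 2 "\<bar>\<beta>\<bar>"] mult_right_mono[of 1 "2 powr \<bar>\<beta>\<bar>" "(t - norm w) powr \<beta>"] by simp
        finally show ?thesis .
      qed
      have "(1 - t + \<delta>) powr \<eta> \<le> (2 * (1 - norm w)) powr \<eta>"
        using d2 d0 True \<eta> by (intro powr_mono2) auto
      then have e: "(1 - t + \<delta>) powr \<eta> \<le> 2 powr \<eta> * (1 - norm w) powr \<eta>"
        by (simp only: powr_mult)
      have "\<delta> powr \<beta> * (1 - t + \<delta>) powr \<eta> \<le> (2 powr \<bar>\<beta>\<bar> * (t - norm w) powr \<beta>) * (2 powr \<eta> * (1 - norm w) powr \<eta>)"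
        by (intro mult_mono b e) auto
      also have "\<dots> = ?K * (t - norm w) powr \<beta>" by (simp add: powr_add)
      finally have "\<delta> powr \<beta> * (1 - t + \<delta>) powr \<eta> \<le> ?K * (t - norm w) powr \<beta>" .
      then show ?thesis using True
        by (simp add: \<delta>_def[symmetric] ennreal_mult'[symmetric] ennreal_leI indicator_def)
    next
      case False
      then show ?thesis by (auto simp: indicator_def field_simps)
    qed
  qed
  also have "\<dots> = ennreal ?K * ennreal ((1 - norm w) powr (\<beta> + 1) / (\<beta> + 1))"
    using nn_integral_powr_from[OF \<beta> w] by (subst nn_integral_cmult) auto
  also have "\<dots> = ennreal (2 powr (\<bar>\<beta>\<bar> + \<eta>) / (\<beta> + 1) * (1 - norm w) powr (\<beta> + \<eta> + 1))"
    using \<beta> by (simp add: ennreal_mult'[symmetric] powr_add algebra_simps)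
  finally show ?thesis .
qed

abbreviation radial_Lp :: "real \<Rightarrow> real \<Rightarrow> (complex \<Rightarrow> real) \<Rightarrow> ennreal"
  where "radial_Lp p a h \<equiv> \<integral>\<^sup>+z. ennreal (indicator (ball 0 1) z * ((1 - norm z) powr a * h z powr p)) \<partial>lborel"

text \<open>\<open>Hardy_pointwise\<close> is applied on each radius with \<delta> = 1 - |z|. After
  exchanging the integrals, w = t z is substituted for fixed t; after exchanging them back, the
  kernel is integrated over t for fixed w.\<close>

lemma Hardy_inequality_disc:
  fixes \<alpha> p :: real
  assumes \<alpha>: "\<alpha> > -1" and p: "p > 1"
  obtains C where "C \<ge> 0" and "\<And>h. continuous_on (ball (0::complex) 1) h \<Longrightarrow> (\<And>z. 0 \<le> h z) \<Longrightarrow>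
    radial_Lp p \<alpha> (\<lambda>z. integral {1/2..1} (\<lambda>t. h (t *\<^sub>R z)))
    \<le> ennreal C * radial_Lp p (\<alpha> + p) h"
proof -
  \<comment> \<open>\<beta> is \<alpha> minus the power (\<alpha> + 1) / 2 lost in the pointwise
    bound, and still exceeds -1. With \<eta>, the exponent inside that bound, \<beta> + \<eta> + 1 =
    \<alpha> + p.\<close>
  define \<beta> where "\<beta> = (\<alpha> - 1) / 2"
  define \<eta> where "\<eta> = p - 1 + (\<alpha> + 1) / 2"
  have \<beta>: "\<beta> > -1" and \<eta>: "\<eta> \<ge> 0" using \<alpha> p by (auto simp: \<beta>_def \<eta>_def)
  from Hardy_pointwise[OF assms] obtain C1 where C1: "C1 > 0" and
    pt: "\<And>k \<delta>. \<delta> > 0 \<Longrightarrow> continuous_on {1/2..1} k \<Longrightarrow> (\<And>t. t \<in> {1/2..1} \<Longrightarrow> 0 \<le> k t) \<Longrightarrow>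
      (integral {1/2..1} k) powr p \<le> C1 * \<delta> powr (- (\<alpha> + 1) / 2) * integral {1/2..1} (\<lambda>t. (1 - t + \<delta>) powr \<eta> * k t powr p)"
    unfolding \<eta>_def by blast
  define C2 where "C2 = 2 powr (\<bar>\<beta>\<bar> + \<eta>) / (\<beta> + 1)"
  have C2: "C2 \<ge> 0" using \<beta> by (simp add: C2_def)
  show ?thesis
  proof (rule that)
    show "4 * C1 * C2 \<ge> 0" using C1 C2 by simp
  next
    fix h :: "complex \<Rightarrow> real"
    assume h: "continuous_on (ball 0 1) h" and hnn: "\<And>z. 0 \<le> h z"
    define g where "g z = (if z \<in> ball 0 1 then h z else 0)" for z
    have g [measurable]: "g \<in> borel_measurable borel"
      unfolding g_def by (intro borel_measurable_continuous_on_if continuous_intros h) auto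
    \<comment> \<open>The weights in terms of w = t z; the indicator keeps the original point w / t
      in the disc.\<close>
    define G where "G t w = indicator (ball 0 1) ((1 / t) *\<^sub>R w) *
            ((1 - norm w / t) powr \<beta> * (1 - t + (1 - norm w / t)) powr \<eta>)" for t :: real and w :: complex
    have Gnn: "G t w \<ge> 0" for t w by (simp add: G_def)
    have G [measurable]: "case_prod G \<in> borel_measurable (borel \<Otimes>\<^sub>M borel)"
    proof -
      have "(\<lambda>(t::real, w::complex). (1 / t) *\<^sub>R w) \<in> borel_measurable (borel \<Otimes>\<^sub>M borel)"
        by measurable
      then show ?thesis unfolding G_def by measurable
    qed
    have pt2: "ennreal (indicator (ball 0 1) z * ((1 - norm z) powr \<alpha> * (integral {1/2..1} (\<lambda>t. h (t *\<^sub>R z))) powr p))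
       \<le> (\<integral>\<^sup>+t. ennreal C1 * ennreal (indicator {1/2..1} t * (G t (t *\<^sub>R z) * g (t *\<^sub>R z) powr p)) \<partial>lborel)" for z
    proof (cases "z \<in> ball 0 1")
      case z: True
      define \<delta> where "\<delta> = 1 - norm z"
      have \<delta>: "\<delta> > 0" using z by (simp add: \<delta>_def)
      have tz: "t *\<^sub>R z \<in> ball 0 1" if "t \<in> {1/2..1}" for t
        using z that mult_left_le_one_le[of "norm z" t] by auto
      have c: "continuous_on {1/2..1} (\<lambda>t. h (t *\<^sub>R z))"
        by (rule continuous_on_compose2[OF h]) (use tz in \<open>auto intro!: continuous_intros\<close>)
      let ?I = "integral {1/2..1} (\<lambda>t. (1 - t + \<delta>) powr \<eta> * h (t *\<^sub>R z) powr p)"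
      have "(integral {1/2..1} (\<lambda>t. h (t *\<^sub>R z))) powr p \<le> C1 * \<delta> powr (- (\<alpha> + 1) / 2) * ?I"
        by (rule pt[OF \<delta> c]) (use hnn in auto)
      then have "\<delta> powr \<alpha> * (integral {1/2..1} (\<lambda>t. h (t *\<^sub>R z))) powr p \<le> \<delta> powr \<alpha> * (C1 * \<delta> powr (- (\<alpha> + 1) / 2) * ?I)"
        by (intro mult_left_mono) auto
      also have "\<dots> = C1 * (\<delta> powr \<beta> * ?I)"
      proof -
        have "\<beta> = \<alpha> + (- (\<alpha> + 1) / 2)" by (simp add: \<beta>_def field_simps)
        then have "\<delta> powr \<beta> = \<delta> powr \<alpha> * \<delta> powr (- (\<alpha> + 1) / 2)" by (simp only: powr_add)
        then show ?thesis by simp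
      qed
      finally have 1: "\<delta> powr \<alpha> * (integral {1/2..1} (\<lambda>t. h (t *\<^sub>R z))) powr p \<le> C1 * (\<delta> powr \<beta> * ?I)" .
      have "continuous_on {1/2..1} (\<lambda>t. (1 - t + \<delta>) powr \<eta> * h (t *\<^sub>R z) powr p)"
        by (intro continuous_on_mult continuous_on_powr' continuous_on_const c continuous_intros) (use \<delta> p hnn in auto)
      then have "((\<lambda>t. (1 - t + \<delta>) powr \<eta> * h (t *\<^sub>R z) powr p) has_integral ?I) {1/2..1}"
        by (intro integrable_integral integrable_continuous_interval)
      from has_integral_mult_right[OF this, of "\<delta> powr \<beta>"]
      have "((\<lambda>t. G t (t *\<^sub>R z) * g (t *\<^sub>R z) powr p) has_integral (\<delta> powr \<beta> * ?I)) {1/2..1}"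
        by (rule has_integral_eq[rotated]) (use tz z in \<open>auto simp: G_def g_def \<delta>_def\<close>)
      from nn_integral_has_integral_lebesgue[OF _ this] Gnn
      have "(\<integral>\<^sup>+t. ennreal (indicator {1/2..1} t * (G t (t *\<^sub>R z) * g (t *\<^sub>R z) powr p)) \<partial>lborel) = ennreal (\<delta> powr \<beta> * ?I)"
        by simp
      then have "(\<integral>\<^sup>+t. ennreal C1 * ennreal (indicator {1/2..1} t * (G t (t *\<^sub>R z) * g (t *\<^sub>R z) powr p)) \<partial>lborel) = ennreal (C1 * (\<delta> powr \<beta> * ?I))"
        using C1 by (subst nn_integral_cmult) (auto simp: ennreal_mult')
      then show ?thesis using 1 z by (simp add: \<delta>_def ennreal_leI)
    qed auto
    have "radial_Lp p \<alpha> (\<lambda>z. integral {1/2..1} (\<lambda>t. h (t *\<^sub>R z)))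
      \<le> (\<integral>\<^sup>+z. (\<integral>\<^sup>+t. ennreal C1 * ennreal (indicator {1/2..1} t * (G t (t *\<^sub>R z) * g (t *\<^sub>R z) powr p)) \<partial>lborel) \<partial>lborel)"
      by (intro nn_integral_mono pt2)
    also have "\<dots> = (\<integral>\<^sup>+t. (\<integral>\<^sup>+z. ennreal C1 * ennreal (indicator {1/2..1} t * (G t (t *\<^sub>R z) * g (t *\<^sub>R z) powr p)) \<partial>lborel) \<partial>lborel)"
      by (rule lborel_pair.Fubini'[symmetric]) measurable
    also have "\<dots> \<le> (\<integral>\<^sup>+t. 4 * (\<integral>\<^sup>+w. ennreal C1 * ennreal (indicator {1/2..1} t * (G t w * g w powr p)) \<partial>lborel) \<partial>lborel)"
    proof (intro nn_integral_mono)
      fix t :: real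
      show "(\<integral>\<^sup>+z. ennreal C1 * ennreal (indicator {1/2..1} t * (G t (t *\<^sub>R z) * g (t *\<^sub>R z) powr p)) \<partial>lborel)
        \<le> 4 * (\<integral>\<^sup>+w. ennreal C1 * ennreal (indicator {1/2..1} t * (G t w * g w powr p)) \<partial>lborel)"
      proof (cases "t \<ge> 1/2")
        case True
        show ?thesis by (rule nn_integral_dilation_le[OF _ True]) measurable
      next
        case False
        then show ?thesis by (simp add: indicator_def)
      qed
    qed
    also have "\<dots> = (\<integral>\<^sup>+t. (\<integral>\<^sup>+w. ennreal (4 * C1) * ennreal (indicator {1/2..1} t * (G t w * g w powr p)) \<partial>lborel) \<partial>lborel)"
      by (subst nn_integral_cmult[symmetric], measurable)
         (auto intro!: nn_integral_cong simp: ennreal_mult' mult.assoc)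
    also have "\<dots> = (\<integral>\<^sup>+w. (\<integral>\<^sup>+t. ennreal (4 * C1) * ennreal (indicator {1/2..1} t * (G t w * g w powr p)) \<partial>lborel) \<partial>lborel)"
      by (rule lborel_pair.Fubini') measurable
    also have "\<dots> \<le> (\<integral>\<^sup>+w. ennreal (4 * C1 * C2) * ennreal (indicator (ball 0 1) w * ((1 - norm w) powr (\<alpha> + p) * h w powr p)) \<partial>lborel)"
    proof (intro nn_integral_mono)
      fix w :: complex
      show "(\<integral>\<^sup>+t. ennreal (4 * C1) * ennreal (indicator {1/2..1} t * (G t w * g w powr p)) \<partial>lborel)
         \<le> ennreal (4 * C1 * C2) * ennreal (indicator (ball 0 1) w * ((1 - norm w) powr (\<alpha> + p) * h w powr p))"
      proof (cases "w \<in> ball 0 1")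
        case True
        have "(\<integral>\<^sup>+t. ennreal (4 * C1) * ennreal (indicator {1/2..1} t * (G t w * g w powr p)) \<partial>lborel)
          = (\<integral>\<^sup>+t. ennreal (4 * C1 * g w powr p) * ennreal (indicator {1/2..1} t * G t w) \<partial>lborel)"
          using C1 Gnn by (intro nn_integral_cong) (simp add: ennreal_mult'[symmetric] algebra_simps)
        also have "\<dots> = ennreal (4 * C1 * g w powr p) * (\<integral>\<^sup>+t. ennreal (indicator {1/2..1} t * G t w) \<partial>lborel)"
          by (rule nn_integral_cmult) measurable
        also have "\<dots> \<le> ennreal (4 * C1 * g w powr p) * ennreal (C2 * (1 - norm w) powr (\<beta> + \<eta> + 1))"
          using nn_integral_radial_kernel_le[OF \<beta> \<eta>, of w] True
          by (intro mult_left_mono) (auto simp: G_def C2_def)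
        also have "\<beta> + \<eta> + 1 = \<alpha> + p" by (simp add: \<beta>_def \<eta>_def field_simps)
        also have "ennreal (4 * C1 * g w powr p) * ennreal (C2 * (1 - norm w) powr (\<alpha> + p)) =
          ennreal (4 * C1 * C2) * ennreal (indicator (ball 0 1) w * ((1 - norm w) powr (\<alpha> + p) * h w powr p))"
          using True C1 C2 by (simp add: ennreal_mult'[symmetric] g_def algebra_simps)
        finally show ?thesis .
      qed (use p in \<open>simp add: g_def\<close>)
    qed
    also have "\<dots> = ennreal (4 * C1 * C2) * radial_Lp p (\<alpha> + p) h"
      using borel_measurable_indicator_ball_powr[OF h, of "\<lambda>w. (1 - norm w) powr (\<alpha> + p)" p] hnn
      by (subst nn_integral_cmult) auto
    finally show "radial_Lp p \<alpha> (\<lambda>z. integral {1/2..1} (\<lambda>t. h (t *\<^sub>R z)))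
      \<le> ennreal (4 * C1 * C2) * radial_Lp p (\<alpha> + p) h" .
  qed
qed

text \<open>The quotient of 1 - x^2 and 1 - x is 1 + x, which lies between 1 and 2; the absolute
  value in the exponent serves both signs of a. Hardy's inequality uses the weight 1 - |z|, the
  Besov integrals 1 - |z|^2.\<close>

lemma disc_weight_compare:
  fixes x a :: real
  assumes "0 \<le> x" "x < 1"
  shows "(1 - x\<^sup>2) powr a \<le> 2 powr \<bar>a\<bar> * (1 - x) powr a"
    and "(1 - x) powr a \<le> 2 powr \<bar>a\<bar> * (1 - x\<^sup>2) powr a"
proof -
  have "1 - x\<^sup>2 = (1 + x) * (1 - x)" by (simp add: power2_eq_square algebra_simps)
  then have eq: "(1 - x\<^sup>2) powr a = (1 + x) powr a * (1 - x) powr a"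
    using assms by (simp only: powr_mult)
  have "(1 + x) powr a \<le> 2 powr \<bar>a\<bar>"
  proof -
    have "(1 + x) powr a \<le> (1 + x) powr \<bar>a\<bar>" using assms by (intro powr_mono) auto
    also have "\<dots> \<le> 2 powr \<bar>a\<bar>" using assms by (intro powr_mono2) auto
    finally show ?thesis .
  qed
  then show "(1 - x\<^sup>2) powr a \<le> 2 powr \<bar>a\<bar> * (1 - x) powr a"
    unfolding eq by (intro mult_right_mono) auto
  have "1 \<le> 2 powr \<bar>a\<bar> * (1 + x) powr a"
  proof -
    have "(1 + x) powr - a \<le> (1 + x) powr \<bar>a\<bar>" using assms by (intro powr_mono) auto
    also have "\<dots> \<le> 2 powr \<bar>a\<bar>" using assms by (intro powr_mono2) auto
    finally have "(1 + x) powr - a * (1 + x) powr a \<le> 2 powr \<bar>a\<bar> * (1 + x) powr a"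
      by (intro mult_right_mono) auto
    then show ?thesis using assms by (simp add: powr_add[symmetric])
  qed
  from mult_right_mono[OF this, of "(1 - x) powr a"]
  show "(1 - x) powr a \<le> 2 powr \<bar>a\<bar> * (1 - x\<^sup>2) powr a"
    unfolding eq by (simp add: mult.assoc)
qed

text \<open>A crude constant, for places where only finiteness matters; the sharp version is
  \<open>powr_add_le_weighted\<close>.\<close>

lemma powr_add_le:
  fixes a b p :: real
  assumes "a \<ge> 0" "b \<ge> 0" "p \<ge> 0"
  shows "(a + b) powr p \<le> 2 powr p * (a powr p + b powr p)"
proof -
  have "(a + b) powr p \<le> (2 * max a b) powr p"
    using assms by (intro powr_mono2) auto
  also have "\<dots> = 2 powr p * max a b powr p" by (rule powr_mult)
  also have "max a b powr p \<le> a powr p + b powr p" by (auto simp: max_def)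
  finally show ?thesis by simp
qed

text \<open>F is integrated from z/2 to z; the value at z/2 is bounded because it lies in the
  compact disc of radius 1/2.\<close>

lemma holomorphic_radial_bound:
  assumes F: "F holomorphic_on ball 0 1"
  obtains M where "M \<ge> 0" and
    "\<And>z. z \<in> ball 0 1 \<Longrightarrow> norm (F z) \<le> integral {1/2..1} (\<lambda>t. norm (deriv F (t *\<^sub>R z)) + M)"
proof -
  have "compact (F ` cball 0 (1/2))"
    by (intro compact_continuous_image holomorphic_on_imp_continuous_on holomorphic_on_subset[OF F]) auto
  then obtain M where M: "\<And>w. w \<in> cball 0 (1/2) \<Longrightarrow> norm (F w) \<le> M"
    by (metis bounded_iff compact_imp_bounded imageI)
  have M0: "M \<ge> 0" using M[of 0] by (simp add: order_trans[OF norm_ge_zero])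
  show ?thesis
  proof (rule that)
    \<comment> \<open>The bound M is moved under an integral over an interval of length 1/2, hence
      the factor 2.\<close>
    show "2 * M \<ge> 0" using M0 by simp
    fix z :: complex assume z: "z \<in> ball 0 1"
    have tz: "t *\<^sub>R z \<in> ball 0 1" if "t \<in> {1/2..1}" for t
      using z that mult_left_le_one_le[of "norm z" t] by auto
    have "((\<lambda>t. z * deriv F (t *\<^sub>R z)) has_integral (F (1 *\<^sub>R z) - F ((1/2) *\<^sub>R z))) {1/2..1}"
    proof (rule fundamental_theorem_of_calculus)
      fix t :: real assume t: "t \<in> {1/2..1}"
      have "((\<lambda>t. t *\<^sub>R z) has_vector_derivative z) (at t within {1/2..1})"
        by (auto intro!: derivative_eq_intros)
      from field_vector_diff_chain_within[OF this has_field_derivative_at_within[OF holomorphic_derivI[OF F _ tz[OF t]]]]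
      show "((\<lambda>t. F (t *\<^sub>R z)) has_vector_derivative z * deriv F (t *\<^sub>R z)) (at t within {1/2..1})"
        by (simp add: o_def)
    qed auto
    then have I: "(\<lambda>t. z * deriv F (t *\<^sub>R z)) integrable_on {1/2..1}"
      "F z - F ((1/2) *\<^sub>R z) = integral {1/2..1} (\<lambda>t. z * deriv F (t *\<^sub>R z))"
      by (auto simp: has_integral_iff)
    have c: "continuous_on {1/2..1} (\<lambda>t. deriv F (t *\<^sub>R z))"
      by (rule continuous_on_compose2[OF holomorphic_on_imp_continuous_on[OF holomorphic_deriv[OF F open_ball]]])
         (use tz in \<open>auto intro!: continuous_intros\<close>)
    have n: "(\<lambda>t. norm (deriv F (t *\<^sub>R z))) integrable_on {1/2..1}"
      by (intro integrable_continuous_interval continuous_intros c)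
    have "norm (z * deriv F (t *\<^sub>R z)) \<le> norm (deriv F (t *\<^sub>R z))" for t
      using z mult_left_le_one_le[of "norm (deriv F (t *\<^sub>R z))" "norm z"] by (simp add: norm_mult)
    from integral_norm_bound_integral[OF I(1) n this]
    have 1: "norm (F z - F ((1/2) *\<^sub>R z)) \<le> integral {1/2..1} (\<lambda>t. norm (deriv F (t *\<^sub>R z)))"
      by (simp add: I(2))
    have 2: "norm (F ((1/2) *\<^sub>R z)) \<le> M" using z by (intro M) auto
    have "norm (F z) \<le> norm (F z - F ((1/2) *\<^sub>R z)) + norm (F ((1/2) *\<^sub>R z))"
      by (metis norm_triangle_sub add.commute)
    also have "\<dots> \<le> integral {1/2..1} (\<lambda>t. norm (deriv F (t *\<^sub>R z))) + integral {1/2..1::real} (\<lambda>t. 2 * M)"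
      using 1 2 by simp
    also have "\<dots> = integral {1/2..1} (\<lambda>t. norm (deriv F (t *\<^sub>R z)) + 2 * M)"
      by (intro integral_add[symmetric] n integrable_continuous_interval continuous_intros)
    finally show "norm (F z) \<le> integral {1/2..1} (\<lambda>t. norm (deriv F (t *\<^sub>R z)) + 2 * M)" .
  qed
qed

text \<open>Hardy's inequality for |F'| + M. The constant M contributes a finite amount since
  \<alpha> + p > 0 and the disc has finite area. As M depends on F, the conclusion is finiteness and
  not a norm inequality.\<close>

lemma weighted_Lp_deriv_imp_weighted_Lp:
  fixes \<alpha> p :: real
  assumes F: "F holomorphic_on ball 0 1" and \<alpha>: "\<alpha> > -1" and p: "p > 1"
    and fin: "disc_Lp p (\<alpha> + p) (deriv F) < \<infinity>"
  shows "disc_Lp p \<alpha> F < \<infinity>"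
proof -
  from holomorphic_radial_bound[OF F] obtain M where M: "M \<ge> 0"
    and FM: "\<And>z. z \<in> ball 0 1 \<Longrightarrow> norm (F z) \<le> integral {1/2..1} (\<lambda>t. norm (deriv F (t *\<^sub>R z)) + M)" by blast
  define h where "h z = norm (deriv F z) + M" for z
  have dF: "continuous_on (ball 0 1) (deriv F)"
    by (intro holomorphic_on_imp_continuous_on holomorphic_deriv F) auto
  have h: "continuous_on (ball 0 1) h" unfolding h_def by (intro continuous_intros dF)
  have hnn: "0 \<le> h z" for z using M by (simp add: h_def)
  from Hardy_inequality_disc[OF \<alpha> p] obtain C where C: "C \<ge> 0" and H: "\<And>h. continuous_on (ball (0::complex) 1) h \<Longrightarrow> (\<And>z. 0 \<le> h z) \<Longrightarrow>
    radial_Lp p \<alpha> (\<lambda>z. integral {1/2..1} (\<lambda>t. h (t *\<^sub>R z)))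
    \<le> ennreal C * radial_Lp p (\<alpha> + p) h"
    by blast
  let ?D = "\<lambda>z. ennreal (indicator (ball 0 1) z * ((1 - (norm z)\<^sup>2) powr (\<alpha> + p) * norm (deriv F z) powr p))"
  have [measurable]: "?D \<in> borel_measurable borel"
    using borel_measurable_indicator_ball_powr[OF dF, of "\<lambda>z. (1 - (norm z)\<^sup>2) powr (\<alpha> + p)" p] by auto
  have "disc_Lp p \<alpha> F
    \<le> (\<integral>\<^sup>+z. ennreal (2 powr \<bar>\<alpha>\<bar>) * ennreal (indicator (ball 0 1) z * ((1 - norm z) powr \<alpha> * norm (F z) powr p)) \<partial>lborel)"
  proof (intro nn_integral_mono)
    fix z :: complex
    show "ennreal (indicator (ball 0 1) z * ((1 - (norm z)\<^sup>2) powr \<alpha> * norm (F z) powr p)) \<le>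
      ennreal (2 powr \<bar>\<alpha>\<bar>) * ennreal (indicator (ball 0 1) z * ((1 - norm z) powr \<alpha> * norm (F z) powr p))"
      using mult_right_mono[OF disc_weight_compare(1)[of "norm z" \<alpha>], of "norm (F z) powr p"]
      by (auto simp: indicator_def ennreal_mult'[symmetric] mult.assoc intro!: ennreal_leI)
  qed
  also have "\<dots> = ennreal (2 powr \<bar>\<alpha>\<bar>) * (\<integral>\<^sup>+z. ennreal (indicator (ball 0 1) z * ((1 - norm z) powr \<alpha> * norm (F z) powr p)) \<partial>lborel)"
    using borel_measurable_indicator_ball_powr[OF holomorphic_on_imp_continuous_on[OF F], of "\<lambda>z. (1 - norm z) powr \<alpha>" p]
    by (intro nn_integral_cmult) auto
  also have "\<dots> \<le> ennreal (2 powr \<bar>\<alpha>\<bar>) * radial_Lp p \<alpha> (\<lambda>z. integral {1/2..1} (\<lambda>t. h (t *\<^sub>R z)))"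
  proof (rule mult_left_mono, rule nn_integral_mono, rule ennreal_leI)
    fix z :: complex
    show "indicator (ball 0 1) z * ((1 - norm z) powr \<alpha> * norm (F z) powr p) \<le>
      indicator (ball 0 1) z * ((1 - norm z) powr \<alpha> * (integral {1/2..1} (\<lambda>t. h (t *\<^sub>R z))) powr p)"
    proof (cases "z \<in> ball 0 1")
      case True
      from FM[OF this] p have "norm (F z) powr p \<le> (integral {1/2..1} (\<lambda>t. h (t *\<^sub>R z))) powr p"
        by (intro powr_mono2) (auto simp: h_def)
      then show ?thesis by (intro mult_left_mono) auto
    qed auto
  qed auto
  also have "\<dots> \<le> ennreal (2 powr \<bar>\<alpha>\<bar>) * (ennreal C * radial_Lp p (\<alpha> + p) h)"
    by (intro mult_left_mono H h hnn) auto
  also have "\<dots> \<le> ennreal (2 powr \<bar>\<alpha>\<bar>) * (ennreal C * (\<integral>\<^sup>+w. ennreal (2 powr \<bar>\<alpha> + p\<bar> * 2 powr p) * ?D w + ennreal (2 powr p * M powr p) * indicator (ball 0 1) w \<partial>lborel))"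
  proof (intro mult_left_mono nn_integral_mono)
    fix w :: complex
    show "ennreal (indicator (ball 0 1) w * ((1 - norm w) powr (\<alpha> + p) * h w powr p)) \<le>
       ennreal (2 powr \<bar>\<alpha> + p\<bar> * 2 powr p) * ?D w + ennreal (2 powr p * M powr p) * indicator (ball 0 1) w"
    proof (cases "w \<in> ball 0 1")
      case True
      let ?d = "norm (deriv F w)"
      have "(1 - norm w) powr (\<alpha> + p) * h w powr p \<le> (1 - norm w) powr (\<alpha> + p) * (2 powr p * (?d powr p + M powr p))"
        using M p unfolding h_def by (intro mult_left_mono powr_add_le) auto
      also have "\<dots> = 2 powr p * ((1 - norm w) powr (\<alpha> + p) * ?d powr p) + 2 powr p * ((1 - norm w) powr (\<alpha> + p) * M powr p)"
        by (simp add: algebra_simps)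
      also have "\<dots> \<le> 2 powr p * ((2 powr \<bar>\<alpha> + p\<bar> * (1 - (norm w)\<^sup>2) powr (\<alpha> + p)) * ?d powr p) + 2 powr p * (1 * M powr p)"
        using disc_weight_compare(2)[of "norm w" "\<alpha> + p"] True \<alpha> p powr_mono2[of "\<alpha> + p" "1 - norm w" 1]
        by (intro add_mono mult_left_mono mult_right_mono) auto
      finally show ?thesis using True
        by (simp add: ennreal_mult'[symmetric] ennreal_plus[symmetric] ennreal_leI algebra_simps del: ennreal_plus)
    qed auto
  qed auto
  also have "(\<integral>\<^sup>+w. ennreal (2 powr \<bar>\<alpha> + p\<bar> * 2 powr p) * ?D w + ennreal (2 powr p * M powr p) * indicator (ball 0 1) w \<partial>lborel)
     = ennreal (2 powr \<bar>\<alpha> + p\<bar> * 2 powr p) * (\<integral>\<^sup>+w. ?D w \<partial>lborel) + ennreal (2 powr p * M powr p) * emeasure lborel (ball (0::complex) 1)"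
  proof (subst nn_integral_add)
    have 1: "(\<integral>\<^sup>+w. c * ?D w \<partial>lborel) = c * (\<integral>\<^sup>+w. ?D w \<partial>lborel)" for c
      by (rule nn_integral_cmult) measurable
    have 2: "(\<integral>\<^sup>+w. c * indicator (ball (0::complex) 1) w \<partial>lborel) = c * emeasure lborel (ball (0::complex) 1)" for c
      by (rule nn_integral_cmult_indicator) auto
    show "(\<integral>\<^sup>+w. ennreal (2 powr \<bar>\<alpha> + p\<bar> * 2 powr p) * ?D w \<partial>lborel) + (\<integral>\<^sup>+w. ennreal (2 powr p * M powr p) * indicator (ball (0::complex) 1) w \<partial>lborel)
      = ennreal (2 powr \<bar>\<alpha> + p\<bar> * 2 powr p) * (\<integral>\<^sup>+w. ?D w \<partial>lborel) + ennreal (2 powr p * M powr p) * emeasure lborel (ball (0::complex) 1)"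
      by (simp only: 1 2)
  qed measurable
  also have "ennreal (2 powr \<bar>\<alpha>\<bar>) * (ennreal C * \<dots>) < \<infinity>"
    using fin emeasure_lborel_ball_finite[of "0::complex" 1] by (simp add: ennreal_mult_less_top)
  finally show ?thesis .
qed

section \<open>Splitting on a slice\<close>

definition emb :: "quat \<Rightarrow> complex \<Rightarrow> quat"
  where "emb i z = slice_pt i (Re z) (Im z)"

definition coord :: "quat \<Rightarrow> quat \<Rightarrow> complex"
  where "coord i q = Complex (qre q) (q \<bullet> i)"

text \<open>If q = u + v j then q j = - v + u j, and \<open>coord i\<close> annihilates C(i) j.
  Right multiplication by j thus brings v into first position, and it commutes with left
  multiplication by C(i).\<close>

definition coord2 :: "quat \<Rightarrow> quat \<Rightarrow> quat \<Rightarrow> complex"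
  where "coord2 i j q = - coord i (q * j)"

lemma qre_simps [simp]:
  "qre 0 = 0" "qre 1 = 1" "qre (p + q) = qre p + qre q" "qre (p - q) = qre p - qre q" "qre (- q) = - qre q"
  "qre (r *\<^sub>R q) = r * qre q" "qre (of_real r) = r"
  "qim1 0 = 0" "qim1 1 = 0" "qim1 (p + q) = qim1 p + qim1 q" "qim1 (p - q) = qim1 p - qim1 q" "qim1 (- q) = - qim1 q"
  "qim1 (r *\<^sub>R q) = r * qim1 q" "qim1 (of_real r) = 0"
  "qim2 0 = 0" "qim2 1 = 0" "qim2 (p + q) = qim2 p + qim2 q" "qim2 (p - q) = qim2 p - qim2 q" "qim2 (- q) = - qim2 q"
  "qim2 (r *\<^sub>R q) = r * qim2 q" "qim2 (of_real r) = 0"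
  "qim3 0 = 0" "qim3 1 = 0" "qim3 (p + q) = qim3 p + qim3 q" "qim3 (p - q) = qim3 p - qim3 q" "qim3 (- q) = - qim3 q"
  "qim3 (r *\<^sub>R q) = r * qim3 q" "qim3 (of_real r) = 0"
  by (simp_all add: zero_quat_def one_quat_def plus_quat_def minus_quat_def uminus_quat_def scaleR_quat_def of_real_def)

lemma quat_mult_components:
  "qre (p * q) = qre p * qre q - qim1 p * qim1 q - qim2 p * qim2 q - qim3 p * qim3 q"
  "qim1 (p * q) = qre p * qim1 q + qim1 p * qre q + qim2 p * qim3 q - qim3 p * qim2 q"
  "qim2 (p * q) = qre p * qim2 q - qim1 p * qim3 q + qim2 p * qre q + qim3 p * qim1 q"
  "qim3 (p * q) = qre p * qim3 q + qim1 p * qim2 q - qim2 p * qim1 q + qim3 p * qre q"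
  by (simp_all add: times_quat_def)

lemma norm_quat_sq: "(norm q)\<^sup>2 = (qre q)\<^sup>2 + (qim1 q)\<^sup>2 + (qim2 q)\<^sup>2 + (qim3 q)\<^sup>2"
  by (simp add: norm_quat_def inner_quat_def power2_eq_square)

lemma imag_sphereD:
  assumes "i \<in> imag_sphere"
  shows "qre i = 0" "norm i = 1" "(qim1 i)\<^sup>2 + (qim2 i)\<^sup>2 + (qim3 i)\<^sup>2 = 1"
  using assms norm_quat_sq[of i] by (auto simp: imag_sphere_def)

lemma imag_sphere_square:
  assumes "i \<in> imag_sphere"
  shows "i * i = -1"
  using imag_sphereD[OF assms] by (simp add: quat_eq_iff quat_mult_components power2_eq_square)

text \<open>Space and seminorm depend on i alone, but they are analysed through a splitting that
  needs some j.\<close>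

lemma imag_sphere_orthogonal_exists:
  assumes "i \<in> imag_sphere"
  obtains j where "j \<in> imag_sphere" "i \<bullet> j = 0"
proof -
  have "\<exists>v. v \<noteq> 0 \<and> qre v = 0 \<and> i \<bullet> v = 0"
  proof (cases "qim1 i = 0")
    case True
    then have "Quat 0 1 0 0 \<noteq> 0 \<and> qre (Quat 0 1 0 0) = 0 \<and> i \<bullet> Quat 0 1 0 0 = 0"
      by (simp add: inner_quat_def quat_eq_iff)
    then show ?thesis by blast
  next
    case False
    let ?v = "Quat 0 (- qim2 i) (qim1 i) 0"
    have "?v \<noteq> 0 \<and> qre ?v = 0 \<and> i \<bullet> ?v = 0"
      using False by (simp add: inner_quat_def quat_eq_iff)
    then show ?thesis by blast
  qed
  then obtain v where v: "v \<noteq> 0" "qre v = 0" "i \<bullet> v = 0" by blast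
  have "sgn v \<in> imag_sphere" using v by (simp add: imag_sphere_def norm_sgn sgn_quat_def)
  moreover have "i \<bullet> sgn v = 0" using v by (simp add: sgn_quat_def)
  ultimately show ?thesis using that by blast
qed

section \<open>The embedding of the complex plane as a slice, and the two complex coordinates of a
  quaternion\<close>

lemma emb_add: "emb i (z + w) = emb i z + emb i w"
  by (simp add: emb_def slice_pt_def distrib_left)

lemma emb_scaleR: "emb i (r *\<^sub>R z) = r *\<^sub>R emb i z"
  by (simp add: emb_def slice_pt_def scaleR_conv_of_real[symmetric] of_real_def algebra_simps)

lemma emb_of_real: "emb i (of_real x) = of_real x"
  by (simp add: emb_def slice_pt_def)

lemma emb_0 [simp]: "emb i 0 = 0" and emb_1 [simp]: "emb i 1 = 1"
  by (simp_all add: emb_def slice_pt_def)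

lemma emb_ii [simp]: "emb i \<i> = i"
  by (simp add: emb_def slice_pt_def)

lemma bounded_linear_emb: "bounded_linear (emb i)"
  by (rule linear_conv_bounded_linear[THEN iffD1], rule linearI)
     (simp_all add: emb_add emb_scaleR)

lemma emb_mult:
  assumes "i \<in> imag_sphere"
  shows "emb i (z * w) = emb i z * emb i w"
proof -
  have "emb i z * emb i w = (Re z *\<^sub>R 1 + Im z *\<^sub>R i) * (Re w *\<^sub>R 1 + Im w *\<^sub>R i)"
    by (simp add: emb_def slice_pt_def of_real_def)
  also have "\<dots> = (Re z * Re w) *\<^sub>R 1 + (Re z * Im w + Im z * Re w) *\<^sub>R i + (Im z * Im w) *\<^sub>R (i * i)"
    by (simp add: algebra_simps)
  also have "\<dots> = emb i (z * w)"
    using imag_sphere_square[OF assms] by (simp add: emb_def slice_pt_def of_real_def algebra_simps)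
  finally show ?thesis ..
qed

lemma emb_power:
  assumes "i \<in> imag_sphere"
  shows "emb i (z ^ n) = emb i z ^ n"
  by (induction n) (simp_all add: emb_mult[OF assms])

lemma emb_components:
  assumes "i \<in> imag_sphere"
  shows "qre (emb i z) = Re z" "qim1 (emb i z) = Im z * qim1 i"
    "qim2 (emb i z) = Im z * qim2 i" "qim3 (emb i z) = Im z * qim3 i"
  using imag_sphereD[OF assms] by (simp_all add: emb_def slice_pt_def of_real_def)

lemma norm_emb:
  assumes "i \<in> imag_sphere"
  shows "norm (emb i z) = norm z"
proof -
  have "(norm (emb i z))\<^sup>2 = (Re z)\<^sup>2 + (Im z)\<^sup>2 * ((qim1 i)\<^sup>2 + (qim2 i)\<^sup>2 + (qim3 i)\<^sup>2)"
    unfolding norm_quat_sq emb_components[OF assms] by (simp add: algebra_simps power_mult_distrib)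
  then have "(norm (emb i z))\<^sup>2 = (norm z)\<^sup>2"
    using imag_sphereD(3)[OF assms] by (simp add: cmod_power2)
  then show ?thesis by (simp add: power2_eq_iff_nonneg)
qed

lemma slice_pt_emb: "slice_pt i x y = emb i (Complex x y)"
  by (simp add: emb_def)

lemma slice_plane_eq: "slice_plane i = range (emb i)"
proof -
  have "emb i z = emb i (Complex (Re z) (Im z))" for z by simp
  then show ?thesis unfolding slice_plane_def slice_pt_emb by blast
qed

lemma slice_ball_eq:
  assumes "i \<in> imag_sphere"
  shows "slice_ball i = emb i ` ball 0 1"
  by (auto simp: slice_ball_def slice_plane_eq norm_emb[OF assms])

lemma emb_qball_iff:
  assumes "i \<in> imag_sphere"
  shows "emb i z \<in> qball \<longleftrightarrow> z \<in> ball 0 1"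
  by (simp add: norm_emb[OF assms])

lemma coord_add: "coord i (p + q) = coord i p + coord i q"
  by (simp add: coord_def inner_add_left complex_eq_iff)

lemma coord_scaleR: "coord i (r *\<^sub>R q) = r *\<^sub>R coord i q"
  by (simp add: coord_def complex_eq_iff)

lemma bounded_linear_coord: "bounded_linear (coord i)"
  by (rule linear_conv_bounded_linear[THEN iffD1], rule linearI)
     (simp_all add: coord_add coord_scaleR)

lemma bounded_linear_coord2: "bounded_linear (coord2 i j)"
  unfolding coord2_def
  by (intro bounded_linear_minus bounded_linear_compose[OF bounded_linear_coord bounded_linear_mult_left])

lemma coord_emb:
  assumes "i \<in> imag_sphere"
  shows "coord i (emb i z) = z"
proof -
  have "emb i z \<bullet> i = Im z * ((qim1 i)\<^sup>2 + (qim2 i)\<^sup>2 + (qim3 i)\<^sup>2)"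
    unfolding inner_quat_def emb_components[OF assms]
    by (simp add: imag_sphereD[OF assms] algebra_simps power2_eq_square)
  then show ?thesis using imag_sphereD(3)[OF assms]
    by (simp add: coord_def complex_eq_iff emb_components[OF assms])
qed

text \<open>Left multiplication by C(i) respects the splitting C(i) + C(i) j. This complex linearity
  turns derivatives along a slice into complex derivatives of the coordinates.\<close>

lemma coord_mult:
  assumes "i \<in> imag_sphere"
  shows "coord i (emb i z * q) = z * coord i q"
proof -
  note i = imag_sphereD[OF assms]
  have "qre (emb i z * q) = Re (z * coord i q)"
    unfolding quat_mult_components emb_components[OF assms]
    by (simp add: coord_def inner_quat_def i algebra_simps)
  moreover have "(emb i z * q) \<bullet> i = Re z * (q \<bullet> i) + Im z * qre q * ((qim1 i)\<^sup>2 + (qim2 i)\<^sup>2 + (qim3 i)\<^sup>2)"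
    unfolding inner_quat_def quat_mult_components emb_components[OF assms]
    by (simp add: i algebra_simps power2_eq_square)
  ultimately show ?thesis using i(3) by (simp add: coord_def complex_eq_iff)
qed

lemma coord2_mult:
  assumes "i \<in> imag_sphere"
  shows "coord2 i j (emb i z * q) = z * coord2 i j q"
  by (simp add: coord2_def mult.assoc coord_mult[OF assms])

text \<open>a, b and their cross product are the orthonormal columns of a 3 by 3 matrix; the claims
  say that its rows are orthonormal too.\<close>

lemma orthonormal_frame_rows:
  fixes a1 a2 a3 b1 b2 b3 :: real
  assumes a: "a1\<^sup>2 + a2\<^sup>2 + a3\<^sup>2 = 1" and b: "b1\<^sup>2 + b2\<^sup>2 + b3\<^sup>2 = 1" and ab: "a1 * b1 + a2 * b2 + a3 * b3 = 0"
  shows "a1\<^sup>2 + b1\<^sup>2 + (a2 * b3 - a3 * b2)\<^sup>2 = 1" "a2\<^sup>2 + b2\<^sup>2 + (a3 * b1 - a1 * b3)\<^sup>2 = 1"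
    "a3\<^sup>2 + b3\<^sup>2 + (a1 * b2 - a2 * b1)\<^sup>2 = 1"
    "a1 * a2 + b1 * b2 + (a2 * b3 - a3 * b2) * (a3 * b1 - a1 * b3) = 0"
    "a1 * a3 + b1 * b3 + (a2 * b3 - a3 * b2) * (a1 * b2 - a2 * b1) = 0"
    "a2 * a3 + b2 * b3 + (a3 * b1 - a1 * b3) * (a1 * b2 - a2 * b1) = 0"
  using a b ab by algebra+

locale slice_frame =
  fixes i j :: quat
  assumes i: "i \<in> imag_sphere" and j: "j \<in> imag_sphere" and ij: "i \<bullet> j = 0"
begin

lemma coord_emb_j: "coord i (emb i z * j) = 0"
proof -
  have "coord i j = 0"
    using imag_sphereD[OF j] ij by (simp add: coord_def complex_eq_iff inner_commute)
  then show ?thesis by (simp add: coord_mult[OF i])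
qed

lemma coord_join: "coord i (emb i u + emb i v * j) = u"
  by (simp add: coord_add coord_emb[OF i] coord_emb_j)

lemma coord2_join: "coord2 i j (emb i u + emb i v * j) = v"
proof -
  have "(emb i u + emb i v * j) * j = emb i u * j + emb i (- v)"
    using imag_sphere_square[OF j]
    by (simp add: distrib_right mult.assoc linear_neg[OF bounded_linear.linear[OF bounded_linear_emb]])
  then show ?thesis
    by (simp add: coord2_def coord_add coord_emb[OF i] coord_emb_j)
qed

text \<open>1, i, j and i j form an orthonormal basis, the imaginary part of i j being the cross
  product. In the proof s, t, r are the coordinates of q along i, j, i j, and the row relations
  rebuild the imaginary components from them.\<close>

lemma slice_split: "emb i (coord i q) + emb i (coord2 i j q) * j = q"
proof -
  define a1 a2 a3 b1 b2 b3 where d: "a1 = qim1 i" "a2 = qim2 i" "a3 = qim3 i" "b1 = qim1 j" "b2 = qim2 j" "b3 = qim3 j"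
  define w0 w1 w2 w3 where w: "w0 = qre q" "w1 = qim1 q" "w2 = qim2 q" "w3 = qim3 q"
  have a: "a1\<^sup>2 + a2\<^sup>2 + a3\<^sup>2 = 1" and b: "b1\<^sup>2 + b2\<^sup>2 + b3\<^sup>2 = 1" and ab: "a1 * b1 + a2 * b2 + a3 * b3 = 0"
    using imag_sphereD[OF i] imag_sphereD[OF j] ij by (auto simp: d inner_quat_def)
  note n = orthonormal_frame_rows[OF a b ab]
  have c: "emb i z = Quat (Re z) (Im z * a1) (Im z * a2) (Im z * a3)" for z
    using emb_components[OF i, of z] by (simp add: quat_eq_iff d)
  have j': "j = Quat 0 b1 b2 b3" and i': "i = Quat 0 a1 a2 a3"
    using imag_sphereD[OF j] imag_sphereD[OF i] by (simp_all add: quat_eq_iff d)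
  have q': "q = Quat w0 w1 w2 w3" by (simp add: quat_eq_iff w)
  have u: "coord i q = Complex w0 (w1 * a1 + w2 * a2 + w3 * a3)"
    by (simp add: coord_def q' i' inner_quat_def)
  have v: "coord2 i j q = Complex (w1 * b1 + w2 * b2 + w3 * b3)
     (w1 * (a2 * b3 - a3 * b2) + w2 * (a3 * b1 - a1 * b3) + w3 * (a1 * b2 - a2 * b1))"
  proof -
    have "w0 * (a1 * b1 + a2 * b2 + a3 * b3) = 0" using ab by simp
    then show ?thesis
      by (simp add: coord2_def coord_def q' i' j' inner_quat_def quat_mult_components complex_eq_iff algebra_simps)
  qed
  define s where "s = w1 * a1 + w2 * a2 + w3 * a3"
  define t where "t = w1 * b1 + w2 * b2 + w3 * b3"
  define c1 where "c1 = a2 * b3 - a3 * b2"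
  define c2 where "c2 = a3 * b1 - a1 * b3"
  define c3 where "c3 = a1 * b2 - a2 * b1"
  define r where "r = w1 * c1 + w2 * c2 + w3 * c3"
  have "emb i (coord i q) + emb i (coord2 i j q) * j =
      Quat (w0 - r * (a1 * b1 + a2 * b2 + a3 * b3)) (s * a1 + t * b1 + r * c1) (s * a2 + t * b2 + r * c2) (s * a3 + t * b3 + r * c3)"
    unfolding u v c by (simp add: quat_eq_iff j' quat_mult_components s_def t_def r_def c1_def c2_def c3_def algebra_simps)
  also have "s * a1 + t * b1 + r * c1 = w1 * (a1\<^sup>2 + b1\<^sup>2 + c1\<^sup>2) + w2 * (a1 * a2 + b1 * b2 + c1 * c2) + w3 * (a1 * a3 + b1 * b3 + c1 * c3)"
    by (simp add: s_def t_def r_def algebra_simps power2_eq_square)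
  also have "\<dots> = w1" using n by (simp add: c1_def c2_def c3_def)
  also have "s * a2 + t * b2 + r * c2 = w2 * (a2\<^sup>2 + b2\<^sup>2 + c2\<^sup>2) + w1 * (a1 * a2 + b1 * b2 + c1 * c2) + w3 * (a2 * a3 + b2 * b3 + c2 * c3)"
    by (simp add: s_def t_def r_def algebra_simps power2_eq_square)
  also have "\<dots> = w2" using n by (simp add: c1_def c2_def c3_def)
  also have "s * a3 + t * b3 + r * c3 = w3 * (a3\<^sup>2 + b3\<^sup>2 + c3\<^sup>2) + w1 * (a1 * a3 + b1 * b3 + c1 * c3) + w2 * (a2 * a3 + b2 * b3 + c2 * c3)"
    by (simp add: s_def t_def r_def algebra_simps power2_eq_square)
  also have "\<dots> = w3" using n by (simp add: c1_def c2_def c3_def)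
  finally show ?thesis using ab by (simp add: q')
qed

lemma norm_join_sq: "(norm (emb i u + emb i v * j))\<^sup>2 = (norm u)\<^sup>2 + (norm v)\<^sup>2"
proof -
  have 1: "emb i u \<bullet> (emb i v * j) = 0"
  proof -
    have "emb i u \<bullet> q = Re u * Re (coord i q) + Im u * Im (coord i q)" for q
      unfolding inner_quat_def emb_components[OF i] by (simp add: coord_def inner_quat_def imag_sphereD[OF i] algebra_simps)
    then show ?thesis by (simp add: coord_emb_j)
  qed
  have "(norm (emb i u + emb i v * j))\<^sup>2 = (norm (emb i u))\<^sup>2 + (norm (emb i v * j))\<^sup>2"
    by (rule norm_add_Pythagorean) (simp add: 1 orthogonal_def)
  then show ?thesis by (simp add: norm_mult norm_emb[OF i] imag_sphereD[OF j])
qed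

lemma slice_fst_eq: "slice_fst i j q = emb i (coord i q)"
  unfolding slice_fst_def
proof (rule the_equality)
  show "emb i (coord i q) \<in> slice_plane i \<and> (\<exists>v\<in>slice_plane i. q = emb i (coord i q) + v * j)"
    by (intro conjI bexI[of _ "emb i (coord2 i j q)"] slice_split[symmetric]) (auto simp: slice_plane_eq)
qed (auto simp: slice_plane_eq coord_join)

lemma slice_snd_eq: "slice_snd i j q = emb i (coord2 i j q)"
  unfolding slice_snd_def
proof (rule the_equality)
  show "emb i (coord2 i j q) \<in> slice_plane i \<and> (\<exists>u\<in>slice_plane i. q = u + emb i (coord2 i j q) * j)"
    by (intro conjI bexI[of _ "emb i (coord i q)"] slice_split[symmetric]) (auto simp: slice_plane_eq)
qed (auto simp: slice_plane_eq coord2_join)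

lemma norm_coord_le: "norm (coord i q) \<le> norm q" "norm (coord2 i j q) \<le> norm q"
  using norm_join_sq[of "coord i q" "coord2 i j q"] unfolding slice_split
  by (simp_all add: power2_le_imp_le[OF _ norm_ge_zero])

end

text \<open>Only the values of g on the slice of i enter, so the notion also covers functions
  meaningful there alone, such as composites with a Moebius map, before they are extended.\<close>

definition slice_hol :: "quat \<Rightarrow> quat \<Rightarrow> (quat \<Rightarrow> quat) \<Rightarrow> bool"
  where "slice_hol i j g \<longleftrightarrow>
    (\<lambda>z. coord i (g (emb i z))) holomorphic_on ball 0 1 \<and>
    (\<lambda>z. coord2 i j (g (emb i z))) holomorphic_on ball 0 1"

definition slice_join :: "quat \<Rightarrow> quat \<Rightarrow> complex \<Rightarrow> complex \<Rightarrow> quat"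
  where "slice_join i j u v = emb i u + emb i v * j"

definition slice_deriv :: "quat \<Rightarrow> quat \<Rightarrow> (quat \<Rightarrow> quat) \<Rightarrow> complex \<Rightarrow> quat"
  where "slice_deriv i j g z = slice_join i j
    (deriv (\<lambda>z. coord i (g (emb i z))) z) (deriv (\<lambda>z. coord2 i j (g (emb i z))) z)"

lemma emb_expand: "emb i h * d = Re h *\<^sub>R d + Im h *\<^sub>R (i * d)"
  by (simp add: emb_def slice_pt_def of_real_def distrib_right)

lemma emb_plus_real: "emb i z + of_real t = emb i (z + of_real t)"
  by (simp add: emb_add emb_of_real)

lemma slice_partial_derivatives:
  assumes A: "((\<lambda>z. f (emb i z)) has_derivative A) (at z)"
  shows "vector_derivative (\<lambda>s. f (slice_pt i s (Im z))) (at (Re z)) = A 1"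
    and "vector_derivative (\<lambda>t. f (slice_pt i (Re z) t)) (at (Im z)) = A \<i>"
proof -
  have linA: "linear A" using A by (rule has_derivative_linear)
  have sc: "A (of_real x) = x *\<^sub>R A 1" "A (of_real x * \<i>) = x *\<^sub>R A \<i>" for x
    using linear_scale[OF linA, of x 1] linear_scale[OF linA, of x \<i>] by (simp_all add: scaleR_conv_of_real)
  have "((\<lambda>s. Complex s (Im z)) has_derivative (\<lambda>h. of_real h)) (at (Re z))"
    by (auto intro!: derivative_eq_intros simp: complex_eq_iff Complex_eq)
  from has_derivative_compose[OF this, of "\<lambda>z. f (emb i z)" A] A
  have "((\<lambda>s. f (slice_pt i s (Im z))) has_vector_derivative A 1) (at (Re z))"
    by (simp add: slice_pt_emb has_vector_derivative_def sc)
  then show "vector_derivative (\<lambda>s. f (slice_pt i s (Im z))) (at (Re z)) = A 1"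
    by (rule vector_derivative_at)
  have "((\<lambda>t. Complex (Re z) t) has_derivative (\<lambda>h. of_real h * \<i>)) (at (Im z))"
    by (auto intro!: derivative_eq_intros simp: complex_eq_iff Complex_eq)
  from has_derivative_compose[OF this, of "\<lambda>z. f (emb i z)" A] A
  have "((\<lambda>t. f (slice_pt i (Re z) t)) has_vector_derivative A \<i>) (at (Im z))"
    by (simp add: slice_pt_emb has_vector_derivative_def sc)
  then show "vector_derivative (\<lambda>t. f (slice_pt i (Re z) t)) (at (Im z)) = A \<i>"
    by (rule vector_derivative_at)
qed

lemma quat_in_slice:
  obtains k where "k \<in> imag_sphere" "q = emb k (Complex (qre q) (norm (qimag q)))"
proof (cases "qimag q = 0")
  case True
  \<comment> \<open>A real q lies in every slice, so any unit serves.\<close>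
  have "Quat 0 1 0 0 \<in> imag_sphere" by (simp add: imag_sphere_def norm_quat_def inner_quat_def)
  moreover have "q = emb (Quat 0 1 0 0) (Complex (qre q) (norm (qimag q)))"
    using True by (simp add: emb_def slice_pt_def) (simp add: qimag_def)
  ultimately show ?thesis using that by blast
next
  case False
  have "sgn (qimag q) \<in> imag_sphere"
    using False by (simp add: imag_sphere_def norm_sgn sgn_quat_def) (simp add: qimag_def)
  moreover have "q = emb (sgn (qimag q)) (Complex (qre q) (norm (qimag q)))"
    using False by (simp add: emb_def slice_pt_def sgn_quat_def of_real_def) (simp add: qimag_def of_real_def)
  ultimately show ?thesis using that by blast
qed

context slice_frame
begin

lemma slice_join_coords: "slice_join i j (coord i q) (coord2 i j q) = q"
  by (simp add: slice_join_def slice_split)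

text \<open>In both coordinates the derivative is multiplication by h, which factors out on the
  left. The resulting shape, h mapped to h d, looks the same on every slice and no longer needs
  coordinates; \<open>slice_holI\<close> is the converse.\<close>

lemma slice_hol_has_derivative:
  assumes g: "slice_hol i j g" and z: "z \<in> ball 0 1"
  shows "((\<lambda>z. g (emb i z)) has_derivative (\<lambda>h. emb i h * slice_deriv i j g z)) (at z)"
proof -
  let ?F = "\<lambda>z. coord i (g (emb i z))" and ?G = "\<lambda>z. coord2 i j (g (emb i z))"
  have "(?F has_derivative (\<lambda>h. deriv ?F z * h)) (at z)" "(?G has_derivative (\<lambda>h. deriv ?G z * h)) (at z)"
    using g z holomorphic_derivI[OF _ open_ball] by (auto simp: slice_hol_def has_field_derivative_def)
  note this[THEN bounded_linear.has_derivative[OF bounded_linear_emb[of i]]]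
  from has_derivative_add[OF this(1) has_derivative_mult_left[OF this(2), of j]]
  have "((\<lambda>z. emb i (?F z) + emb i (?G z) * j) has_derivative
     (\<lambda>h. emb i (deriv ?F z * h) + emb i (deriv ?G z * h) * j)) (at z)" .
  then show ?thesis
    unfolding slice_split slice_deriv_def slice_join_def
    by (simp add: distrib_left emb_mult[OF i, symmetric] mult.assoc[symmetric] mult.commute[of "_ :: complex"])
qed

lemma slice_holI:
  assumes "\<And>z. z \<in> ball 0 1 \<Longrightarrow> ((\<lambda>z. g (emb i z)) has_derivative (\<lambda>h. emb i h * d z)) (at z)"
  shows "slice_hol i j g"
proof -
  have "((\<lambda>z. coord i (g (emb i z))) has_field_derivative coord i (d z)) (at z)"
       "((\<lambda>z. coord2 i j (g (emb i z))) has_field_derivative coord2 i j (d z)) (at z)" if "z \<in> ball 0 1" for z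
    using bounded_linear.has_derivative[OF bounded_linear_coord[of i] assms[OF that]]
      bounded_linear.has_derivative[OF bounded_linear_coord2[of i j] assms[OF that]]
    unfolding coord_mult[OF i] coord2_mult[OF i] has_field_derivative_def
    by (simp_all add: mult_commute_abs)
  then show ?thesis
    unfolding slice_hol_def holomorphic_on_open[OF open_ball] by blast
qed

lemma real_deriv_slice:
  assumes g: "slice_hol i j g" and z: "z \<in> ball 0 1"
  shows "real_deriv g (emb i z) = slice_deriv i j g z"
proof -
  have "((\<lambda>t. z + of_real t) has_derivative (\<lambda>h. of_real h)) (at 0)"
    by (auto intro!: derivative_eq_intros)
  from has_derivative_compose[OF this, of "\<lambda>z. g (emb i z)"] slice_hol_has_derivative[OF g z]
  have "((\<lambda>t. g (emb i (z + of_real t))) has_derivative (\<lambda>h. emb i (of_real h) * slice_deriv i j g z)) (at 0)"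
    by simp
  then have "((\<lambda>t. g (emb i z + of_real t)) has_vector_derivative slice_deriv i j g z) (at 0)"
    by (simp add: emb_plus_real has_vector_derivative_def emb_of_real scaleR_conv_of_real)
  then show ?thesis unfolding real_deriv_def by (rule vector_derivative_at)
qed

lemma slice_hol_real_deriv:
  assumes g: "slice_hol i j g"
  shows "slice_hol i j (real_deriv g)"
    and "\<And>z. z \<in> ball 0 1 \<Longrightarrow> coord i (real_deriv g (emb i z)) = deriv (\<lambda>z. coord i (g (emb i z))) z"
    and "\<And>z. z \<in> ball 0 1 \<Longrightarrow> coord2 i j (real_deriv g (emb i z)) = deriv (\<lambda>z. coord2 i j (g (emb i z))) z"
proof -
  show 1: "coord i (real_deriv g (emb i z)) = deriv (\<lambda>z. coord i (g (emb i z))) z" if "z \<in> ball 0 1" for z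
    using real_deriv_slice[OF g that] by (simp add: slice_deriv_def slice_join_def coord_join)
  show 2: "coord2 i j (real_deriv g (emb i z)) = deriv (\<lambda>z. coord2 i j (g (emb i z))) z" if "z \<in> ball 0 1" for z
    using real_deriv_slice[OF g that] by (simp add: slice_deriv_def slice_join_def coord2_join)
  show "slice_hol i j (real_deriv g)"
    using g unfolding slice_hol_def
    by (auto intro!: holomorphic_transform[OF holomorphic_deriv[OF _ open_ball] 1[symmetric]]
        holomorphic_transform[OF holomorphic_deriv[OF _ open_ball] 2[symmetric]])
qed

lemma slice_hol_real_deriv_funpow:
  "slice_hol i j g \<Longrightarrow> slice_hol i j ((real_deriv ^^ n) g)"
  by (induction n) (simp_all add: slice_hol_real_deriv)

text \<open>If A is the real derivative along the slice, the regularity equation says A 1 + i A \<i>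
  = 0. Multiplied by i it becomes A \<i> = i A 1, so A sends h to h times A 1.\<close>

lemma slice_regular_imp_slice_hol:
  assumes f: "f \<in> slice_regular"
  shows "slice_hol i j f"
proof -
  have "\<exists>d. ((\<lambda>z. f (emb i z)) has_derivative (\<lambda>h. emb i h * d)) (at z)" if z: "z \<in> ball 0 1" for z
  proof -
    have "f differentiable (at (emb i z))"
      using f emb_qball_iff[OF i, of z] z
      by (auto simp: slice_regular_def differentiable_on_def at_within_open[OF _ open_ball])
    then obtain L where L: "(f has_derivative L) (at (emb i z))"
      by (auto simp: differentiable_def)
    define A where "A h = L (emb i h)" for h
    have A: "((\<lambda>z. f (emb i z)) has_derivative A) (at z)"
      unfolding A_def
      by (rule has_derivative_compose[OF bounded_linear_imp_has_derivative[OF bounded_linear_emb] L])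
    then have linA: "linear A" by (rule has_derivative_linear)
    note 1 = slice_partial_derivatives[OF A]
    have "slice_pt i (Re z) (Im z) \<in> slice_ball i"
      using z by (auto simp: slice_ball_eq[OF i] slice_pt_emb)
    then have "vector_derivative (\<lambda>s. f (slice_pt i s (Im z))) (at (Re z)) +
        i * vector_derivative (\<lambda>t. f (slice_pt i (Re z) t)) (at (Im z)) = 0"
      using f i unfolding slice_regular_def by blast
    then have "i * (A 1 + i * A \<i>) = 0" by (simp only: 1 mult_zero_right)
    then have "i * A 1 + (i * i) * A \<i> = 0"
      by (simp only: distrib_left mult.assoc)
    then have Ai: "A \<i> = i * A 1" using imag_sphere_square[OF i] by simp
    have "A h = emb i h * A 1" for h
    proof -
      have "A h = A (Re h *\<^sub>R 1 + Im h *\<^sub>R \<i>)" by (rule arg_cong[of _ _ A]) (simp add: complex_eq_iff)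
      also have "\<dots> = emb i h * A 1"
        using linA by (simp add: linear_add linear_scale emb_expand Ai)
      finally show ?thesis .
    qed
    then have "((\<lambda>z. f (emb i z)) has_derivative (\<lambda>h. emb i h * A 1)) (at z)"
      by (intro has_derivative_eq_rhs[OF A] ext)
    then show ?thesis by blast
  qed
  then have "\<exists>d. \<forall>z\<in>ball 0 1. ((\<lambda>z. f (emb i z)) has_derivative (\<lambda>h. emb i h * d z)) (at z)"
    by (intro bchoice) blast
  then show ?thesis using slice_holI by blast
qed

end

lemma slice_regular_const_if_const_on_slice:
  assumes i: "i \<in> imag_sphere" and f: "f \<in> slice_regular"
    and c: "\<And>z. z \<in> ball 0 1 \<Longrightarrow> f (emb i z) = c" and q: "q \<in> qball"
  shows "f q = c"
proof -
  obtain k where k: "k \<in> imag_sphere" and "q = emb k (Complex (qre q) (norm (qimag q)))"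
    by (rule quat_in_slice)
  then obtain z where qz: "q = emb k z" by blast
  obtain j where j: "j \<in> imag_sphere" "k \<bullet> j = 0" using imag_sphere_orthogonal_exists[OF k] .
  interpret K: slice_frame k j by unfold_locales (use k j in auto)
  have z: "z \<in> ball 0 1" using q qz emb_qball_iff[OF k] by simp
  have hol: "slice_hol k j f" by (rule K.slice_regular_imp_slice_hol[OF f])
  \<comment> \<open>The real axis lies in every slice, so f is already known on this diameter of the
    slice of k, which accumulates at 0.\<close>
  define U where "U = complex_of_real ` {-1<..<1}"
  have U: "U \<subseteq> ball 0 1" by (auto simp: U_def)
  have lim: "0 islimpt U"
    unfolding islimpt_approachable
  proof safe
    fix e :: real assume "e > 0"
    then show "\<exists>x'\<in>U. x' \<noteq> 0 \<and> dist x' 0 < e"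
      by (intro bexI[of _ "complex_of_real (min (1/2) (e/2))"]) (auto simp: U_def min_def)
  qed
  have real: "f (emb k (of_real x)) = c" if "complex_of_real x \<in> ball 0 1" for x
    using c[OF that] by (simp add: emb_of_real)
  have 1: "coord k (f (emb k z)) - coord k c = 0"
    by (rule analytic_continuation[of "\<lambda>z. coord k (f (emb k z)) - coord k c" "ball 0 1" U 0 z])
       (use hol U lim z real in \<open>auto simp: slice_hol_def U_def intro!: holomorphic_intros\<close>)
  have 2: "coord2 k j (f (emb k z)) - coord2 k j c = 0"
    by (rule analytic_continuation[of "\<lambda>z. coord2 k j (f (emb k z)) - coord2 k j c" "ball 0 1" U 0 z])
       (use hol U lim z real in \<open>auto simp: slice_hol_def U_def intro!: holomorphic_intros\<close>)
  have "coord k (f q) = coord k c" "coord2 k j (f q) = coord2 k j c"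
    using 1 2 unfolding qz by simp_all
  then show ?thesis using K.slice_split[of "f q"] K.slice_split[of c] by argo
qed

section \<open>Slice regular extension\<close>

text \<open>For h = x + y i the terms with x add up to 2 x d, and those with y to - 2 y k i i d = 2
  y k d.\<close>

lemma emb_cnj_formula:
  assumes "i \<in> imag_sphere"
  shows "emb k h * d = (1/2) *\<^sub>R ((1 + k * i) * (emb i (cnj h) * d) + (1 - k * i) * (emb i h * d))"
proof -
  have i2: "i * (i * d) = - d" for d
    using imag_sphere_square[OF assms] by (metis mult.assoc mult_minus1)
  have "(1 + k * i) * (emb i (cnj h) * d) + (1 - k * i) * (emb i h * d) = emb k h * d + emb k h * d"
    unfolding emb_expand by (simp add: algebra_simps i2)
  then show ?thesis by (simp only: scaleR_half_double)
qed

text \<open>\<open>slice_ext\<close> always writes q with a nonnegative imaginary coordinate. For Im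
  z < 0 this means the unit -k and the point conjugate to z, and the formula is invariant under that
  exchange; for real z the terms with the unit cancel.\<close>

lemma slice_ext_on_slice:
  assumes k: "k \<in> imag_sphere" and z: "z \<in> ball 0 1"
  shows "slice_ext i g (emb k z) =
    (1/2) *\<^sub>R ((1 + k * i) * g (emb i (cnj z)) + (1 - k * i) * g (emb i z))"
proof -
  have q: "emb k z \<in> qball" using z emb_qball_iff[OF k] by simp
  have re: "qre (emb k z) = Re z" using emb_components[OF k] by simp
  have im: "qimag (emb k z) = Im z *\<^sub>R k"
    unfolding qimag_def re by (simp add: emb_def slice_pt_def of_real_def)
  have n: "norm (qimag (emb k z)) = \<bar>Im z\<bar>" using imag_sphereD[OF k] by (simp add: im)
  have s: "sgn (qimag (emb k z)) = sgn (Im z) *\<^sub>R k"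
    using imag_sphereD[OF k] by (simp add: im sgn_scaleR) (simp add: sgn_quat_def)
  have e: "slice_ext i g (emb k z) = (1/2) *\<^sub>R ((1 + (sgn (Im z) *\<^sub>R k) * i) * g (emb i (Complex (Re z) (- \<bar>Im z\<bar>)))
     + (1 - (sgn (Im z) *\<^sub>R k) * i) * g (emb i (Complex (Re z) \<bar>Im z\<bar>)))"
    unfolding slice_ext_def Let_def n s re slice_pt_emb using q by simp
  consider "Im z > 0" | "Im z < 0" | "Im z = 0" by linarith
  then show ?thesis
  proof cases
    case 1
    then have "Complex (Re z) (- \<bar>Im z\<bar>) = cnj z" "Complex (Re z) \<bar>Im z\<bar> = z" by (auto simp: complex_eq_iff)
    with 1 show ?thesis unfolding e by simp
  next
    case 2
    then have "Complex (Re z) (- \<bar>Im z\<bar>) = z" "Complex (Re z) \<bar>Im z\<bar> = cnj z" by (auto simp: complex_eq_iff)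
    with 2 show ?thesis unfolding e by (simp add: add.commute)
  next
    case 3
    then have "Complex (Re z) (- \<bar>Im z\<bar>) = z" "Complex (Re z) \<bar>Im z\<bar> = z" "cnj z = z" by (auto simp: complex_eq_iff)
    with 3 show ?thesis unfolding e by (simp add: algebra_simps)
  qed
qed

lemma slice_ext_same_slice:
  assumes i: "i \<in> imag_sphere" and z: "z \<in> ball 0 1"
  shows "slice_ext i g (emb i z) = g (emb i z)"
  unfolding slice_ext_on_slice[OF assms] using imag_sphere_square[OF i] by (simp add: scaleR_2[symmetric])

lemma bounded_linear_qre: "bounded_linear qre"
  by (rule linear_conv_bounded_linear[THEN iffD1], rule linearI) simp_all

lemma bounded_linear_qimag: "bounded_linear qimag"
  by (rule linear_conv_bounded_linear[THEN iffD1], rule linearI)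
     (simp_all add: qimag_def quat_eq_iff algebra_simps del: of_real_mult)

context slice_frame
begin

lemma slice_ext_has_derivative_on_slice:
  assumes g: "slice_hol i j g" and k: "k \<in> imag_sphere" and z: "z \<in> ball 0 1"
  shows "((\<lambda>w. slice_ext i g (emb k w)) has_derivative
    (\<lambda>h. (1/2) *\<^sub>R ((1 + k * i) * (emb i (cnj h) * slice_deriv i j g (cnj z)) +
      (1 - k * i) * (emb i h * slice_deriv i j g z)))) (at z)"
proof -
  have c: "(cnj has_derivative cnj) (at z)"
    by (rule bounded_linear_imp_has_derivative[OF bounded_linear_cnj])
  have cz: "cnj z \<in> ball 0 1" using z by simp
  note d1 = has_derivative_compose[OF c slice_hol_has_derivative[OF g cz]]
  note d2 = slice_hol_has_derivative[OF g z]
  have "((\<lambda>w. (1/2) *\<^sub>R ((1 + k * i) * g (emb i (cnj w)) + (1 - k * i) * g (emb i w))) has_derivative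
    (\<lambda>h. (1/2) *\<^sub>R ((1 + k * i) * (emb i (cnj h) * slice_deriv i j g (cnj z)) +
      (1 - k * i) * (emb i h * slice_deriv i j g z)))) (at z)"
    by (intro has_derivative_scaleR_right has_derivative_add has_derivative_mult_right d1 d2)
  then show ?thesis
    by (rule has_derivative_transform_within_open[OF _ open_ball[of 0 1]])
       (use z in \<open>auto simp: slice_ext_on_slice[OF k]\<close>)
qed

text \<open>Off the real axis the norm of the imaginary part and the imaginary unit are
  differentiable in q, so the chain rule applies to the formula with \<open>sgn\<close> written
  out.\<close>

lemma slice_ext_differentiable_nonreal:
  assumes g: "slice_hol i j g" and q: "q \<in> qball" "qimag q \<noteq> 0"
  shows "slice_ext i g differentiable (at q)"
proof -
  define S where "S = qball \<inter> {p. qimag p \<noteq> 0}"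
  have S: "open S" unfolding S_def
    by (intro open_Int open_ball open_Collect_neq linear_continuous_on bounded_linear_qimag continuous_on_const)
  have im: "qimag differentiable (at q)" and re: "qre differentiable (at q)"
    by (auto intro!: bounded_linear_imp_differentiable bounded_linear_qimag bounded_linear_qre)
  have n: "(\<lambda>p. norm (qimag p)) differentiable (at q)"
    using differentiable_compose[OF differentiable_norm_at im] q by simp
  have sg: "(\<lambda>p. inverse (norm (qimag p)) *\<^sub>R qimag p) differentiable (at q)"
    by (intro differentiable_scaleR differentiable_inverse n im) (use q in auto)
  have nq: "norm (Complex (qre q) (norm (qimag q))) = norm q" "norm (Complex (qre q) (- norm (qimag q))) = norm q"
  proof -
    obtain k where k: "k \<in> imag_sphere" "q = emb k (Complex (qre q) (norm (qimag q)))"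
      by (rule quat_in_slice)
    show 1: "norm (Complex (qre q) (norm (qimag q))) = norm q"
      using norm_emb[OF k(1)] k(2) by metis
    then show "norm (Complex (qre q) (- norm (qimag q))) = norm q" by (simp add: cmod_def)
  qed
  have G: "(\<lambda>z. g (emb i z)) differentiable (at z)" if "z \<in> ball 0 1" for z
    using slice_hol_has_derivative[OF g that] by (auto simp: differentiable_def)
  have zp: "(\<lambda>p. Complex (qre p) (norm (qimag p))) differentiable (at q)"
    and zm: "(\<lambda>p. Complex (qre p) (- norm (qimag p))) differentiable (at q)"
  proof -
    have "(\<lambda>p. qre p *\<^sub>R 1 + norm (qimag p) *\<^sub>R \<i>) differentiable (at q)"
         "(\<lambda>p. qre p *\<^sub>R 1 + (- norm (qimag p)) *\<^sub>R \<i>) differentiable (at q)"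
      by (intro differentiable_add differentiable_scaleR differentiable_minus re n differentiable_const)+
    moreover have "Complex a b = a *\<^sub>R 1 + b *\<^sub>R \<i>" for a b by (simp add: complex_eq_iff)
    ultimately show "(\<lambda>p. Complex (qre p) (norm (qimag p))) differentiable (at q)"
       "(\<lambda>p. Complex (qre p) (- norm (qimag p))) differentiable (at q)" by simp_all
  qed
  have gp: "(\<lambda>p. g (emb i (Complex (qre p) (norm (qimag p))))) differentiable (at q)"
    using differentiable_compose[OF G zp] q nq by simp
  have gm: "(\<lambda>p. g (emb i (Complex (qre p) (- norm (qimag p))))) differentiable (at q)"
    using differentiable_compose[OF G zm] q nq by simp
  let ?E = "\<lambda>p. (1/2) *\<^sub>R ((1 + (inverse (norm (qimag p)) *\<^sub>R qimag p) * i) * g (emb i (Complex (qre p) (- norm (qimag p))))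
     + (1 - (inverse (norm (qimag p)) *\<^sub>R qimag p) * i) * g (emb i (Complex (qre p) (norm (qimag p)))))"
  have "?E differentiable (at q)"
    by (rule differentiable_scaleR[OF differentiable_const], rule differentiable_add)
       (rule differentiable_mult differentiable_add differentiable_diff differentiable_const sg gp gm)+
  then obtain D where D: "(?E has_derivative D) (at q)"
    by (auto simp: differentiable_def)
  have "(slice_ext i g has_derivative D) (at q)"
    by (rule has_derivative_transform_within_open[OF D S])
       (use q in \<open>auto simp: S_def slice_ext_def Let_def slice_pt_emb sgn_quat_def\<close>)
  then show ?thesis by (auto simp: differentiable_def)
qed

text \<open>
  The imaginary unit of q jumps at real points. Since the map h \<mapsto> h d on the whole space is itself
  the extension of its restriction to the slice of i, the remainder at q is a combination, with
  coefficients of norm at most 2, of the remainders of g at the two points over q in that slice.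
\<close>

lemma slice_ext_differentiable_real:
  assumes g: "slice_hol i j g" and q: "q \<in> qball" "qimag q = 0"
  shows "slice_ext i g differentiable (at q)"
proof -
  define z where "z = complex_of_real (qre q)"
  have qz: "q = emb k z" for k
    using q(2) by (simp add: z_def emb_of_real qimag_def)
  have z: "z \<in> ball 0 1" using q(1) emb_qball_iff[OF i] qz by metis
  define G where "G w = g (emb i w)" for w
  define d where "d = slice_deriv i j g z"
  have D: "(G has_derivative (\<lambda>h. emb i h * d)) (at z)"
    unfolding G_def d_def by (rule slice_hol_has_derivative[OF g z])
  have q0: "slice_ext i g q = G z"
    using slice_ext_same_slice[OF i z, of g] qz[of i] by (simp add: G_def)
  have "(slice_ext i g has_derivative (\<lambda>h. h * d)) (at q)"
    unfolding has_derivative_at_alt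
  proof (intro conjI bounded_linear_mult_left allI impI)
    fix e :: real assume "e > 0"
    then obtain \<delta> where \<delta>: "\<delta> > 0" and
      err: "\<And>w. norm (w - z) < \<delta> \<Longrightarrow> norm (G w - G z - emb i (w - z) * d) \<le> e / 2 * norm (w - z)"
      using D unfolding has_derivative_at_alt by (meson half_gt_zero)
    show "\<exists>\<delta>>0. \<forall>y. norm (y - q) < \<delta> \<longrightarrow> norm (slice_ext i g y - slice_ext i g q - (y - q) * d) \<le> e * norm (y - q)"
    \<comment> \<open>The second bound keeps y in the ball, where the extension formula is in
      force.\<close>
    proof (intro exI[of _ "min \<delta> (1 - norm q)"] conjI allI impI)
      show "min \<delta> (1 - norm q) > 0" using \<delta> q by simp
      fix y assume y: "norm (y - q) < min \<delta> (1 - norm q)"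
      obtain k where k: "k \<in> imag_sphere" and "y = emb k (Complex (qre y) (norm (qimag y)))"
        by (rule quat_in_slice)
      then obtain w where yw: "y = emb k w" by blast
      have "norm y \<le> norm (y - q) + norm q" by (metis norm_triangle_sub add.commute)
      then have "y \<in> qball" using y by simp
      then have w: "w \<in> ball 0 1" using emb_qball_iff[OF k] yw by simp
      have ydiff: "y - q = emb k (w - z)"
        unfolding yw qz[of k] by (simp add: linear_diff bounded_linear.linear[OF bounded_linear_emb])
      have nw: "norm (w - z) = norm (y - q)" unfolding ydiff by (simp add: norm_emb[OF k])
      have cz: "cnj w - z = cnj (w - z)" by (simp add: z_def)
      have nc: "norm (cnj w - z) = norm (y - q)" unfolding cz complex_mod_cnj by (rule nw)
      define e1 where "e1 = G (cnj w) - G z - emb i (cnj w - z) * d"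
      define e2 where "e2 = G w - G z - emb i (w - z) * d"
      have E: "norm e1 \<le> e / 2 * norm (y - q)" "norm e2 \<le> e / 2 * norm (y - q)"
        using err[of "cnj w"] err[of w] y by (auto simp: e1_def e2_def nw nc)
      have "slice_ext i g y - slice_ext i g q - (y - q) * d =
         (1/2) *\<^sub>R ((1 + k * i) * G (cnj w) + (1 - k * i) * G w) - (1/2) *\<^sub>R ((1 + k * i) * G z + (1 - k * i) * G z)
         - (1/2) *\<^sub>R ((1 + k * i) * (emb i (cnj w - z) * d) + (1 - k * i) * (emb i (w - z) * d))"
      proof -
        have "(1/2) *\<^sub>R ((1 + k * i) * G z + (1 - k * i) * G z) = G z"
          by (simp add: distrib_right[symmetric] scaleR_2[symmetric])
        moreover have "(y - q) * d = (1/2) *\<^sub>R ((1 + k * i) * (emb i (cnj w - z) * d) + (1 - k * i) * (emb i (w - z) * d))"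
          unfolding ydiff cz by (rule emb_cnj_formula[OF i])
        moreover have "slice_ext i g y = (1/2) *\<^sub>R ((1 + k * i) * G (cnj w) + (1 - k * i) * G w)"
          unfolding yw G_def by (rule slice_ext_on_slice[OF k w])
        ultimately show ?thesis by (simp only: q0)
      qed
      also have "\<dots> = (1/2) *\<^sub>R ((1 + k * i) * e1 + (1 - k * i) * e2)"
        unfolding e1_def e2_def by (simp only: scaleR_diff_right[symmetric] right_diff_distrib) (simp add: algebra_simps)
      also have "norm \<dots> \<le> 1/2 * (norm (1 + k * i) * norm e1 + norm (1 - k * i) * norm e2)"
        using norm_triangle_ineq[of "(1 + k * i) * e1" "(1 - k * i) * e2"] by (simp add: norm_mult)
      also have "\<dots> \<le> 1/2 * (2 * (e / 2 * norm (y - q)) + 2 * (e / 2 * norm (y - q)))"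
      proof -
        have "norm (k * i) = 1" using imag_sphereD[OF i] imag_sphereD[OF k] by (simp add: norm_mult)
        then have "norm (1 + k * i) \<le> 2" "norm (1 - k * i) \<le> 2"
          using norm_triangle_ineq[of 1 "k * i"] norm_triangle_ineq4[of 1 "k * i"] by simp_all
        then have "norm (1 + k * i) * norm e1 \<le> 2 * norm e1" "norm (1 - k * i) * norm e2 \<le> 2 * norm e2"
          by (auto intro: mult_right_mono)
        moreover have "1/2 * (a + b) \<le> 1/2 * (2 * c + 2 * c)" if "a \<le> 2 * x" "b \<le> 2 * y" "x \<le> c" "y \<le> c" for a b c x y :: real
          using that by (intro mult_left_mono add_mono order_trans[OF \<open>a \<le> 2 * x\<close>] order_trans[OF \<open>b \<le> 2 * y\<close>]) simp_all
        ultimately show ?thesis using E by blast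
      qed
      finally show "norm (slice_ext i g y - slice_ext i g q - (y - q) * d) \<le> e * norm (y - q)" by simp
    qed
  qed
  then show ?thesis by (auto simp: differentiable_def)
qed

text \<open>On the slice of k the equation holds since
  \<open>k * (1 + k * i) * (- i) = - (1 + k * i)\<close> and
  \<open>k * (1 - k * i) * i = - (1 - k * i)\<close>: each term of the derivative in y cancels its
  partner in x.\<close>

lemma slice_ext_slice_regular:
  assumes g: "slice_hol i j g"
  shows "slice_ext i g \<in> slice_regular"
  unfolding slice_regular_def
proof (safe)
  fix q assume "q \<notin> qball"
  then show "slice_ext i g q = 0" by (simp add: slice_ext_def)
next
  show "slice_ext i g differentiable_on qball"
    unfolding differentiable_on_def
    using slice_ext_differentiable_real[OF g] slice_ext_differentiable_nonreal[OF g]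
    by (metis differentiable_at_withinI)
next
  fix k x y assume k: "k \<in> imag_sphere" and "slice_pt k x y \<in> slice_ball k"
  then have z: "Complex x y \<in> ball 0 1"
    using emb_qball_iff[OF k] by (simp add: slice_ball_def slice_pt_emb)
  let ?d1 = "slice_deriv i j g (cnj (Complex x y))" and ?d2 = "slice_deriv i j g (Complex x y)"
  have kk: "k * (k * u) = - u" and ii: "i * (i * u) = - u" for u
    using imag_sphere_square[OF k] imag_sphere_square[OF i] by (metis mult.assoc mult_minus1)+
  have m: "emb i (- \<i>) = - i" "emb i (cnj \<i>) = - i"
    by (simp_all add: emb_def slice_pt_def)
  show "vector_derivative (\<lambda>s. slice_ext i g (slice_pt k s y)) (at x) +
       k * vector_derivative (\<lambda>t. slice_ext i g (slice_pt k x t)) (at y) = 0"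
    unfolding slice_partial_derivatives[OF slice_ext_has_derivative_on_slice[OF g k z], unfolded complex.sel]
    by (simp add: m algebra_simps kk ii)
qed

end

section \<open>Moebius maps of a slice\<close>

definition disc_moebius :: "complex \<Rightarrow> complex \<Rightarrow> complex"
  where "disc_moebius \<alpha> z = (\<alpha> - z) / (1 - cnj \<alpha> * z)"

lemma disc_moebius_denominator:
  assumes "norm \<alpha> < 1" "norm z < 1"
  shows "1 - cnj \<alpha> * z \<noteq> 0"
proof
  assume "1 - cnj \<alpha> * z = 0"
  then have "norm (cnj \<alpha> * z) = 1" by simp
  moreover have "norm (cnj \<alpha> * z) < 1 * 1"
    unfolding norm_mult complex_mod_cnj using assms by (intro mult_strict_mono') auto
  ultimately show False by simp
qed

text \<open>Rests on |1 - cnj \<alpha> z|^2 - |\<alpha> - z|^2 = (1 - |\<alpha>|^2) (1 - |z|^2). It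
  shows that the disc is preserved and, set against the derivative, that hyperbolic length
  is.\<close>

lemma disc_moebius_defect:
  assumes "norm \<alpha> < 1" "norm z < 1"
  shows "1 - (norm (disc_moebius \<alpha> z))\<^sup>2 = (1 - (norm \<alpha>)\<^sup>2) * (1 - (norm z)\<^sup>2) / (norm (1 - cnj \<alpha> * z))\<^sup>2"
proof -
  have "(norm (1 - cnj \<alpha> * z))\<^sup>2 \<noteq> 0" using disc_moebius_denominator[OF assms] by simp
  moreover have "(norm (1 - cnj \<alpha> * z))\<^sup>2 - (norm (\<alpha> - z))\<^sup>2 = (1 - (norm \<alpha>)\<^sup>2) * (1 - (norm z)\<^sup>2)"
    unfolding cmod_power2 by (simp add: power2_eq_square algebra_simps)
  ultimately show ?thesis
    by (simp add: disc_moebius_def norm_divide power_divide field_simps)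
qed

lemma disc_moebius_in_disc:
  assumes "norm \<alpha> < 1" "norm z < 1"
  shows "norm (disc_moebius \<alpha> z) < 1"
proof -
  have "norm (1 - cnj \<alpha> * z) > 0" using disc_moebius_denominator[OF assms] by simp
  moreover have "(norm \<alpha>)\<^sup>2 < 1" "(norm z)\<^sup>2 < 1"
    using assms by (simp_all add: abs_square_less_1)
  ultimately have "1 - (norm (disc_moebius \<alpha> z))\<^sup>2 > 0"
    unfolding disc_moebius_defect[OF assms] by (intro divide_pos_pos mult_pos_pos) auto
  then show ?thesis by (simp add: abs_square_less_1)
qed

lemma disc_moebius_involution:
  assumes "norm \<alpha> < 1" "norm z < 1"
  shows "disc_moebius \<alpha> (disc_moebius \<alpha> z) = z"
proof -
  define d where "d = 1 - cnj \<alpha> * z"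
  have d: "d \<noteq> 0" using disc_moebius_denominator[OF assms] by (simp add: d_def)
  have c: "1 - cnj \<alpha> * \<alpha> \<noteq> 0" using disc_moebius_denominator[OF assms(1) assms(1)] .
  have "\<alpha> - (\<alpha> - z) / d = (z * (1 - cnj \<alpha> * \<alpha>)) / d"
    using d by (simp add: field_simps) (simp add: d_def algebra_simps)
  moreover have "1 - cnj \<alpha> * ((\<alpha> - z) / d) = (1 - cnj \<alpha> * \<alpha>) / d"
    using d by (simp add: field_simps) (simp add: d_def algebra_simps)
  ultimately show ?thesis
    using c d unfolding disc_moebius_def d_def[symmetric] by simp
qed

lemma disc_moebius_DERIV:
  assumes "norm \<alpha> < 1" "norm z < 1"
  shows "(disc_moebius \<alpha> has_field_derivative - (1 - cnj \<alpha> * \<alpha>) / (1 - cnj \<alpha> * z)\<^sup>2) (at z)"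
proof -
  have d: "1 - cnj \<alpha> * z \<noteq> 0" using disc_moebius_denominator[OF assms] .
  have "((\<lambda>z. (\<alpha> - z) / (1 - cnj \<alpha> * z)) has_field_derivative
     ((- 1) * (1 - cnj \<alpha> * z) - (\<alpha> - z) * (- cnj \<alpha>)) / ((1 - cnj \<alpha> * z) * (1 - cnj \<alpha> * z))) (at z)"
    by (rule DERIV_divide) (use d in \<open>auto intro!: derivative_eq_intros\<close>)
  then show ?thesis
    unfolding disc_moebius_def[abs_def] by (simp add: power2_eq_square algebra_simps)
qed

lemma disc_moebius_holomorphic:
  assumes "norm \<alpha> < 1"
  shows "disc_moebius \<alpha> holomorphic_on ball 0 1"
  unfolding holomorphic_on_open[OF open_ball] using disc_moebius_DERIV[OF assms] by (meson mem_ball_0)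

lemma disc_moebius_inj:
  assumes "norm \<alpha> < 1"
  shows "inj_on (disc_moebius \<alpha>) (ball 0 1)"
  by (rule inj_on_inverseI[where g = "disc_moebius \<alpha>"]) (simp add: disc_moebius_involution[OF assms])

lemma disc_moebius_image:
  assumes "norm \<alpha> < 1"
  shows "disc_moebius \<alpha> ` ball 0 1 = ball 0 1"
proof
  show "disc_moebius \<alpha> ` ball 0 1 \<subseteq> ball 0 1" using disc_moebius_in_disc[OF assms] by auto
  show "ball 0 1 \<subseteq> disc_moebius \<alpha> ` ball 0 1"
  proof
    fix z :: complex assume "z \<in> ball 0 1"
    then show "z \<in> disc_moebius \<alpha> ` ball 0 1"
      using disc_moebius_in_disc[OF assms, of z] disc_moebius_involution[OF assms, of z]
      by (intro image_eqI[of _ _ "disc_moebius \<alpha> z"]) auto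
  qed
qed

text \<open>Infinitesimal form of the hyperbolic isometry: both sides are (1 - |\<alpha>|^2) (1 -
  |z|^2) / |1 - cnj \<alpha> z|^2.\<close>

lemma norm_deriv_disc_moebius:
  assumes "norm \<alpha> < 1" "norm z < 1"
  shows "(1 - (norm z)\<^sup>2) * norm (deriv (disc_moebius \<alpha>) z) = 1 - (norm (disc_moebius \<alpha> z))\<^sup>2"
proof -
  have "deriv (disc_moebius \<alpha>) z = - (1 - cnj \<alpha> * \<alpha>) / (1 - cnj \<alpha> * z)\<^sup>2"
    by (rule DERIV_imp_deriv[OF disc_moebius_DERIV[OF assms]])
  moreover have "norm (1 - cnj \<alpha> * \<alpha>) = 1 - (norm \<alpha>)\<^sup>2"
  proof -
    have "1 - cnj \<alpha> * \<alpha> = complex_of_real (1 - (norm \<alpha>)\<^sup>2)"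
      using complex_norm_square[of \<alpha>] by (simp add: mult.commute)
    moreover have "(norm \<alpha>)\<^sup>2 < 1" using assms by (simp add: abs_square_less_1)
    ultimately show ?thesis by (simp only: norm_of_real)
  qed
  ultimately show ?thesis
    unfolding disc_moebius_defect[OF assms] by (simp only: norm_divide norm_power norm_minus_cancel) simp
qed

lemma qcnj_emb: "i \<in> imag_sphere \<Longrightarrow> qcnj (emb i z) = emb i (cnj z)"
  by (simp add: qcnj_def quat_eq_iff emb_components)

text \<open>For a in the slice all coefficients of the star product lie in the commutative field
  C(i), so the series can be summed in the complex plane: \<alpha> and z each multiply the geometric
  series with ratio cnj \<alpha> z.\<close>

lemma slice_moebius_on_slice:
  assumes i: "i \<in> imag_sphere" and a: "norm \<alpha> < 1" and z: "norm z < 1"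
  shows "slice_moebius (emb i \<alpha>) (emb i z) = emb i (disc_moebius \<alpha> z)"
proof -
  define b where "b n = (if n = 0 then emb i \<alpha> else if n = 1 then - 1 else 0)" for n :: nat
  define \<gamma> where "\<gamma> n = (case n of 0 \<Rightarrow> \<alpha> | Suc m \<Rightarrow> cnj \<alpha> ^ Suc m * \<alpha> - cnj \<alpha> ^ m)" for n
  have neg: "emb i (u - v) = emb i u - emb i v" for u v
    by (simp add: linear_diff bounded_linear.linear[OF bounded_linear_emb])
  have coeff: "star_coeff (\<lambda>n. qcnj (emb i \<alpha>) ^ n) b n = emb i (\<gamma> n)" for n
  proof (cases n)
    case 0
    then show ?thesis by (simp add: star_coeff_def b_def \<gamma>_def)
  next
    case (Suc m)
    let ?f = "\<lambda>k. qcnj (emb i \<alpha>) ^ k * b (n - k)"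
    \<comment> \<open>Since a - q has degree 1, only the last two terms of the convolution
      survive.\<close>
    have "(\<Sum>k\<le>n. ?f k) = (\<Sum>k<m. ?f k) + ?f m + ?f (Suc m)"
      unfolding Suc by (simp only: lessThan_Suc_atMost[symmetric] sum.lessThan_Suc)
    also have "(\<Sum>k<m. ?f k) = 0" by (rule sum.neutral) (auto simp: b_def Suc)
    finally show ?thesis
      by (simp add: star_coeff_def Suc b_def \<gamma>_def neg emb_mult[OF i] emb_power[OF i] qcnj_emb[OF i])
  qed
  have w: "norm (cnj \<alpha> * z) < 1"
  proof -
    have "norm (cnj \<alpha> * z) < 1 * 1"
      unfolding norm_mult complex_mod_cnj using a z by (intro mult_strict_mono') auto
    then show ?thesis by simp
  qed
  have g: "(\<lambda>n. (cnj \<alpha> * z) ^ n) sums (1 / (1 - cnj \<alpha> * z))" by (rule geometric_sums[OF w])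
  have 1: "(\<lambda>n. \<alpha> * (cnj \<alpha> * z) ^ n) sums (\<alpha> * (1 / (1 - cnj \<alpha> * z)))" by (rule sums_mult[OF g])
  \<comment> \<open>The factor z shifts the geometric series by one index, which matches the
    subtracted power of cnj \<alpha> in \<gamma>.\<close>
  have "(\<lambda>n. case n of 0 \<Rightarrow> 0 | Suc m \<Rightarrow> z * (cnj \<alpha> * z) ^ m) sums (z * (1 / (1 - cnj \<alpha> * z)))"
    using sums_mult[OF g, of z]
      sums_Suc[of "\<lambda>n. case n of 0 \<Rightarrow> 0 | Suc m \<Rightarrow> z * (cnj \<alpha> * z) ^ m" "z * (1 / (1 - cnj \<alpha> * z))"] by simp
  from sums_diff[OF 1 this]
  have "(\<lambda>n. z ^ n * \<gamma> n) sums (\<alpha> * (1 / (1 - cnj \<alpha> * z)) - z * (1 / (1 - cnj \<alpha> * z)))"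
    by (rule sums_cong[THEN iffD1, rotated]) (auto simp: \<gamma>_def power_mult_distrib algebra_simps split: nat.split)
  also have "\<alpha> * (1 / (1 - cnj \<alpha> * z)) - z * (1 / (1 - cnj \<alpha> * z)) = disc_moebius \<alpha> z"
    by (simp add: disc_moebius_def diff_divide_distrib)
  finally have "(\<lambda>n. emb i (z ^ n * \<gamma> n)) sums emb i (disc_moebius \<alpha> z)"
    by (rule bounded_linear.sums[OF bounded_linear_emb])
  then have "(\<lambda>n. emb i z ^ n * star_coeff (\<lambda>n. qcnj (emb i \<alpha>) ^ n) b n) sums emb i (disc_moebius \<alpha> z)"
    by (simp add: coeff emb_mult[OF i] emb_power[OF i])
  then show ?thesis
    unfolding slice_moebius_def qseries_def b_def by (rule sums_unique[symmetric])
qed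

context slice_frame
begin

text \<open>\<open>slice_ext\<close> is right linear, so the two extended pieces recombine to the
  extension of the undivided composite. In particular j disappears.\<close>

lemma slice_comp_eq: "slice_comp i j f a = slice_ext i (\<lambda>z. f (slice_moebius a z))"
proof
  fix q
  let ?g = "\<lambda>z. f (slice_moebius a z)"
  have s: "slice_fst i j w + slice_snd i j w * j = w" for w
    by (simp add: slice_fst_eq slice_snd_eq slice_split)
  have e: "(1/2) *\<^sub>R (A * u1 + B * u2) + (1/2) *\<^sub>R (A * v1 + B * v2) * j
     = (1/2) *\<^sub>R (A * (u1 + v1 * j) + B * (u2 + v2 * j))" for A B u1 u2 v1 v2 :: quat
    by (simp add: algebra_simps)
  show "slice_comp i j f a q = slice_ext i ?g q"
  proof (cases "q \<in> qball")
    case True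
    then show ?thesis
      by (simp only: slice_comp_def slice_ext_def Let_def if_True e s)
  qed (simp add: slice_comp_def slice_ext_def)
qed

text \<open>The Moebius map sends the slice disc to itself, so this is the chain rule there. The
  complex factor of the inner derivative commutes with h and is absorbed into d from the
  left.\<close>

lemma slice_hol_comp_moebius:
  assumes f: "slice_hol i j f" and a: "norm \<alpha> < 1"
  shows "slice_hol i j (\<lambda>q. f (slice_moebius (emb i \<alpha>) q))"
    and "\<And>z. norm z < 1 \<Longrightarrow> norm (real_deriv (\<lambda>q. f (slice_moebius (emb i \<alpha>) q)) (emb i z)) =
      norm (deriv (disc_moebius \<alpha>) z) * norm (real_deriv f (emb i (disc_moebius \<alpha> z)))"
proof -
  let ?g = "\<lambda>q. f (slice_moebius (emb i \<alpha>) q)"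
  let ?d = "\<lambda>z. emb i (deriv (disc_moebius \<alpha>) z) * slice_deriv i j f (disc_moebius \<alpha> z)"
  have D: "((\<lambda>z. ?g (emb i z)) has_derivative (\<lambda>h. emb i h * ?d z)) (at z)" if z: "z \<in> ball 0 1" for z
  proof -
    have T: "(disc_moebius \<alpha> has_derivative (\<lambda>h. deriv (disc_moebius \<alpha>) z * h)) (at z)"
      using holomorphic_derivI[OF disc_moebius_holomorphic[OF a] open_ball z] by (simp add: has_field_derivative_def)
    have "disc_moebius \<alpha> z \<in> ball 0 1" using disc_moebius_in_disc[OF a] z by simp
    from has_derivative_compose[OF T slice_hol_has_derivative[OF f this]]
    have "((\<lambda>z. f (emb i (disc_moebius \<alpha> z))) has_derivative (\<lambda>h. emb i h * ?d z)) (at z)"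
      by (simp add: mult.commute[of "deriv _ _"] emb_mult[OF i] mult.assoc)
    then show ?thesis
      by (rule has_derivative_transform_within_open[OF _ open_ball[of 0 1]])
         (use z a in \<open>auto simp: slice_moebius_on_slice[OF i]\<close>)
  qed
  from slice_holI[OF D] show hol: "slice_hol i j ?g" .
  fix z :: complex assume "norm z < 1"
  then have z: "z \<in> ball 0 1" by simp
  have "(\<lambda>h. emb i h * slice_deriv i j ?g z) = (\<lambda>h. emb i h * ?d z)"
    by (rule has_derivative_unique[OF slice_hol_has_derivative[OF hol z] D[OF z]])
  from fun_cong[OF this, of 1] have "slice_deriv i j ?g z = ?d z" by simp
  then show "norm (real_deriv ?g (emb i z)) =
      norm (deriv (disc_moebius \<alpha>) z) * norm (real_deriv f (emb i (disc_moebius \<alpha> z)))"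
    using disc_moebius_in_disc[OF a, of z] z
    by (simp add: real_deriv_slice[OF hol] real_deriv_slice[OF f] norm_mult norm_emb[OF i])
qed

end

section \<open>Quotients of complete seminormed spaces\<close>

context quat_seminormed_space
begin

text \<open>The quotient by the null space of a seminorm is built for arbitrary seminormed spaces;
  only later is that null space identified with the constant functions.\<close>

definition null_rel :: "('v \<times> 'v) set"
  where "null_rel = {(u, v). u \<in> V \<and> v \<in> V \<and> nrm (add u (scale v (- 1))) = 0}"

definition cls :: "'v \<Rightarrow> 'v set"
  where "cls v = null_rel `` {v}"

lemma scale_zero_scalar: "v \<in> V \<Longrightarrow> scale v 0 = zero"
  using scale_add_scalar[of v 1 "- 1"] scale_one[of v] add_neg[of v] by simp

lemma nrm_zero: "nrm zero = 0"
  using nrm_scale[OF zero_closed, of 0] scale_zero_scalar[OF zero_closed] by simp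

lemma diff_closed: "u \<in> V \<Longrightarrow> v \<in> V \<Longrightarrow> add u (scale v (- 1)) \<in> V"
  by (intro add_closed scale_closed)

lemma scale_neg_neg: "v \<in> V \<Longrightarrow> scale (scale v (- 1)) (- 1) = v"
  by (simp add: scale_scale scale_one)

lemma add_swap: "\<lbrakk>a \<in> V; b \<in> V; c \<in> V; d \<in> V\<rbrakk> \<Longrightarrow> add (add a b) (add c d) = add (add a c) (add b d)"
  by (metis add_assoc add_closed add_commute)

lemma diff_self_chain:
  assumes "u \<in> V" "v \<in> V" "w \<in> V"
  shows "add (add u (scale v (- 1))) (add v (scale w (- 1))) = add u (scale w (- 1))"
proof -
  have "add (add u (scale v (- 1))) (add v (scale w (- 1))) = add (add u (scale w (- 1))) (add v (scale v (- 1)))"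
    using add_swap[of u "scale v (- 1)" "scale w (- 1)" v]
      add_commute[of v "scale w (- 1)"] add_commute[of v "scale v (- 1)"] assms scale_closed by simp
  then show ?thesis using assms by (simp add: add_neg add_zero diff_closed)
qed

lemma nrm_diff_commute:
  assumes "u \<in> V" "v \<in> V"
  shows "nrm (add u (scale v (- 1))) = nrm (add v (scale u (- 1)))"
proof -
  have "scale (add u (scale v (- 1))) (- 1) = add v (scale u (- 1))"
    using assms by (simp add: scale_add scale_closed scale_neg_neg add_commute)
  then show ?thesis using nrm_scale[OF diff_closed[OF assms], of "- 1"] by simp
qed

lemma nrm_diff_triangle:
  assumes "u \<in> V" "v \<in> V" "w \<in> V"
  shows "nrm (add u (scale w (- 1))) \<le> nrm (add u (scale v (- 1))) + nrm (add v (scale w (- 1)))"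
  using nrm_triangle[OF diff_closed diff_closed, of u v v w] assms by (simp add: diff_self_chain)

lemma nrm_le_diff:
  assumes "u \<in> V" "v \<in> V"
  shows "nrm u \<le> nrm (add u (scale v (- 1))) + nrm v"
proof -
  have "add (add u (scale v (- 1))) v = u"
    using assms by (simp add: add_assoc scale_closed add_commute[of "scale v (- 1)" v] add_neg add_zero)
  then show ?thesis using nrm_triangle[OF diff_closed[OF assms] assms(2)] by simp
qed

lemma equiv_null_rel: "equiv V null_rel"
proof (rule equivI)
  show "null_rel \<subseteq> V \<times> V" by (auto simp: null_rel_def)
  show "refl_on V null_rel" by (auto simp: refl_on_def null_rel_def add_neg nrm_zero)
  show "sym null_rel" by (auto simp: sym_def null_rel_def nrm_diff_commute)
  show "trans null_rel"
  proof (rule transI)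
    fix u v w assume "(u, v) \<in> null_rel" "(v, w) \<in> null_rel"
    then show "(u, w) \<in> null_rel"
      using nrm_diff_triangle[of u v w] nrm_nonneg[OF diff_closed, of u w]
      by (auto simp: null_rel_def)
  qed
qed

lemma cls_eq_iff: "\<lbrakk>u \<in> V; v \<in> V\<rbrakk> \<Longrightarrow> cls u = cls v \<longleftrightarrow> nrm (add u (scale v (- 1))) = 0"
  using eq_equiv_class_iff[OF equiv_null_rel] by (simp add: cls_def null_rel_def)

lemma in_cls: "v \<in> V \<Longrightarrow> v \<in> cls v"
  unfolding cls_def by (rule equiv_class_self[OF equiv_null_rel])

lemma cls_memD: "\<lbrakk>v \<in> V; u \<in> cls v\<rbrakk> \<Longrightarrow> u \<in> V \<and> cls u = cls v"
  using equiv_class_eq[OF equiv_null_rel, of v u] by (auto simp: cls_def null_rel_def)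

lemma cls_in_quotient: "v \<in> V \<Longrightarrow> cls v \<in> V // null_rel"
  by (simp add: cls_def quotientI)

lemma quotient_cases:
  assumes "X \<in> V // null_rel"
  obtains v where "v \<in> V" "X = cls v"
  using assms by (auto simp: quotient_def cls_def)

text \<open>Unions over representatives, in the shape of \<open>quot_add\<close> and
  \<open>quot_scale\<close>, so that the operations agree by unfolding once the two relations
  do.\<close>

definition cls_add :: "'v set \<Rightarrow> 'v set \<Rightarrow> 'v set"
  where "cls_add X Y = (\<Union>u\<in>X. \<Union>v\<in>Y. cls (add u v))"

definition cls_scale :: "'v set \<Rightarrow> quat \<Rightarrow> 'v set"
  where "cls_scale X c = (\<Union>u\<in>X. cls (scale u c))"

definition cls_nrm :: "'v set \<Rightarrow> real"
  where "cls_nrm X = the_elem (nrm ` X)"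

lemma cls_add_eq:
  assumes u: "u \<in> V" and v: "v \<in> V"
  shows "cls_add (cls u) (cls v) = cls (add u v)"
proof -
  have "cls (add u' v') = cls (add u v)" if "u' \<in> cls u" "v' \<in> cls v" for u' v'
  proof -
    have V: "u' \<in> V" "v' \<in> V" using cls_memD[OF u that(1)] cls_memD[OF v that(2)] by simp_all
    have 0: "nrm (add u' (scale u (- 1))) = 0" "nrm (add v' (scale v (- 1))) = 0"
      using cls_memD[OF u that(1)] cls_memD[OF v that(2)] cls_eq_iff[OF V(1) u] cls_eq_iff[OF V(2) v] by simp_all
    have "add (add u' v') (scale (add u v) (- 1)) = add (add u' (scale u (- 1))) (add v' (scale v (- 1)))"
      using u v V by (simp add: scale_add add_swap scale_closed)
    then have "nrm (add (add u' v') (scale (add u v) (- 1))) \<le> 0"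
      using nrm_triangle[OF diff_closed diff_closed, of u' u v' v] 0 u v V by simp
    then show ?thesis
      using nrm_nonneg[OF diff_closed[OF add_closed add_closed], of u' v' u v] u v V
      by (subst cls_eq_iff) (auto simp: add_closed)
  qed
  then show ?thesis unfolding cls_add_def using in_cls[OF u] in_cls[OF v] by blast
qed

lemma cls_scale_eq:
  assumes u: "u \<in> V"
  shows "cls_scale (cls u) c = cls (scale u c)"
proof -
  have "cls (scale u' c) = cls (scale u c)" if "u' \<in> cls u" for u'
  proof -
    have V: "u' \<in> V" using cls_memD[OF u that] by simp
    have 0: "nrm (add u' (scale u (- 1))) = 0"
      using cls_memD[OF u that] cls_eq_iff[OF V u] by simp
    have "add (scale u' c) (scale (scale u c) (- 1)) = scale (add u' (scale u (- 1))) c"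
      using u V by (simp add: scale_add scale_scale scale_closed)
    then have "nrm (add (scale u' c) (scale (scale u c) (- 1))) = 0"
      using nrm_scale[OF diff_closed[OF V u], of c] 0 by simp
    then show ?thesis using u V by (subst cls_eq_iff) (auto simp: scale_closed)
  qed
  then show ?thesis unfolding cls_scale_def using in_cls[OF u] by blast
qed

text \<open>By the triangle inequality in both directions the seminorm is constant on a class, so
  \<open>the_elem\<close> is applied to a singleton.\<close>

lemma cls_nrm_eq:
  assumes u: "u \<in> V"
  shows "cls_nrm (cls u) = nrm u"
proof -
  have "nrm u' = nrm u" if "u' \<in> cls u" for u'
  proof -
    have V: "u' \<in> V" using cls_memD[OF u that] by simp
    have 0: "nrm (add u' (scale u (- 1))) = 0"
      using cls_memD[OF u that] cls_eq_iff[OF V u] by simp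
    then show ?thesis
      using nrm_le_diff[OF V u] nrm_le_diff[OF u V] nrm_diff_commute[OF u V] by simp
  qed
  then have "nrm ` cls u = (\<lambda>_. nrm u) ` cls u" by (rule image_cong[OF refl])
  then have "nrm ` cls u = {nrm u}" using in_cls[OF u] by (simp add: image_constant)
  then show ?thesis by (simp add: cls_nrm_def)
qed

end

context quat_complete_seminormed_space
begin

theorem quotient_banach: "quat_banach_space (V // null_rel) cls_add (cls zero) cls_scale cls_nrm"
proof
  show "cls zero \<in> V // null_rel" by (intro cls_in_quotient zero_closed)
next
  fix X Y assume "X \<in> V // null_rel" "Y \<in> V // null_rel"
  then obtain u v where uv: "u \<in> V" "v \<in> V" "X = cls u" "Y = cls v" by (auto elim!: quotient_cases)
  show "cls_add X Y \<in> V // null_rel"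
    using uv by (simp add: cls_add_eq cls_in_quotient add_closed)
  show "cls_add X Y = cls_add Y X" using uv by (simp add: cls_add_eq add_commute)
  show "cls_nrm (cls_add X Y) \<le> cls_nrm X + cls_nrm Y"
    using uv by (simp add: cls_add_eq cls_nrm_eq add_closed nrm_triangle)
  fix c show "cls_scale (cls_add X Y) c = cls_add (cls_scale X c) (cls_scale Y c)"
    using uv by (simp add: cls_add_eq cls_scale_eq add_closed scale_closed scale_add)
next
  fix X Y Z assume "X \<in> V // null_rel" "Y \<in> V // null_rel" "Z \<in> V // null_rel"
  then obtain u v w where "u \<in> V" "v \<in> V" "w \<in> V" "X = cls u" "Y = cls v" "Z = cls w" by (auto elim!: quotient_cases)
  then show "cls_add (cls_add X Y) Z = cls_add X (cls_add Y Z)"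
    by (simp add: cls_add_eq add_closed add_assoc)
next
  fix X assume "X \<in> V // null_rel"
  then obtain v where v: "v \<in> V" "X = cls v" by (rule quotient_cases)
  fix c d
  show "cls_scale X c \<in> V // null_rel" using v by (simp add: cls_scale_eq cls_in_quotient scale_closed)
  show "cls_add X (cls zero) = X" using v by (simp add: cls_add_eq zero_closed add_zero)
  show "cls_add X (cls_scale X (- 1)) = cls zero" using v by (simp add: cls_add_eq cls_scale_eq scale_closed add_neg)
  show "cls_scale X (c + d) = cls_add (cls_scale X c) (cls_scale X d)"
    using v by (simp add: cls_add_eq cls_scale_eq scale_closed scale_add_scalar)
  show "cls_scale (cls_scale X c) d = cls_scale X (c * d)"
    using v by (simp add: cls_scale_eq scale_closed scale_scale)
  show "cls_scale X 1 = X" using v by (simp add: cls_scale_eq scale_one)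
  show "0 \<le> cls_nrm X" using v by (simp add: cls_nrm_eq nrm_nonneg)
  show "cls_nrm (cls_scale X c) = cls_nrm X * norm c"
    using v by (simp add: cls_scale_eq cls_nrm_eq scale_closed nrm_scale)
  show "X = cls zero" if "cls_nrm X = 0"
  proof -
    have "nrm v \<le> 0" using that v by (simp add: cls_nrm_eq)
    moreover have "add v (scale zero (- 1)) = v"
      using v add_neg[OF zero_closed] add_zero[OF scale_closed[OF zero_closed, of "- 1"]]
        add_commute[OF zero_closed scale_closed[OF zero_closed, of "- 1"]] add_zero[of v] by simp
    ultimately show ?thesis using v nrm_nonneg[of v] cls_eq_iff[OF _ zero_closed, of v] by simp
  qed
next
  fix S :: "nat \<Rightarrow> 'v set"
  assume S: "\<And>n. S n \<in> V // null_rel"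
    and cauchy: "\<And>e. e > 0 \<Longrightarrow> \<exists>N. \<forall>m\<ge>N. \<forall>n\<ge>N. cls_nrm (cls_add (S m) (cls_scale (S n) (- 1))) < e"
  \<comment> \<open>Arbitrary representatives do: every one of them attains the quotient norm, so a
    Cauchy sequence of classes lifts to a Cauchy sequence in V.\<close>
  have "\<exists>v. v \<in> V \<and> S n = cls v" for n by (rule quotient_cases[OF S]) blast
  then have "\<exists>s. \<forall>n. s n \<in> V \<and> S n = cls (s n)" by (intro choice) blast
  then obtain s where s: "\<And>n. s n \<in> V" "\<And>n. S n = cls (s n)" by blast
  have diff: "cls_nrm (cls_add (cls u) (cls_scale (cls v) (- 1))) = nrm (add u (scale v (- 1)))" if "u \<in> V" "v \<in> V" for u v
    using that by (simp add: cls_scale_eq cls_add_eq cls_nrm_eq scale_closed add_closed)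
  have "\<exists>v\<in>V. (\<lambda>n. nrm (add (s n) (scale v (- 1)))) \<longlonglongrightarrow> 0"
    by (rule complete) (use s cauchy diff in auto)
  then obtain v where v: "v \<in> V" "(\<lambda>n. nrm (add (s n) (scale v (- 1)))) \<longlonglongrightarrow> 0" by blast
  show "\<exists>X\<in>V // null_rel. (\<lambda>n. cls_nrm (cls_add (S n) (cls_scale X (- 1)))) \<longlonglongrightarrow> 0"
    using v s diff by (intro bexI[of _ "cls v"] cls_in_quotient) auto
qed

end

section \<open>Besov integrals on a slice\<close>

text \<open>With the regularity equation recast as a derivative sending h to h d, closure is
  immediate: for sums d adds up, and a scalar on the right of d does not interfere with h on its
  left.\<close>

lemma slice_regular_iff:
  "f \<in> slice_regular \<longleftrightarrow> (\<forall>q. q \<notin> qball \<longrightarrow> f q = 0) \<and> f differentiable_on qball \<and>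
    (\<forall>k\<in>imag_sphere. \<forall>z\<in>ball 0 1. \<exists>d. ((\<lambda>w. f (emb k w)) has_derivative (\<lambda>h. emb k h * d)) (at z))"
    (is "_ \<longleftrightarrow> ?A \<and> ?B \<and> ?C")
proof
  assume f: "f \<in> slice_regular"
  have ?C
  proof safe
    fix k and z :: complex assume k: "k \<in> imag_sphere" and z: "z \<in> ball 0 1"
    obtain j where "j \<in> imag_sphere" "k \<bullet> j = 0" using imag_sphere_orthogonal_exists[OF k] .
    then interpret K: slice_frame k j by unfold_locales (use k in auto)
    show "\<exists>d. ((\<lambda>w. f (emb k w)) has_derivative (\<lambda>h. emb k h * d)) (at z)"
      using K.slice_hol_has_derivative[OF K.slice_regular_imp_slice_hol[OF f] z] by blast
  qed
  then show "?A \<and> ?B \<and> ?C" using f by (simp add: slice_regular_def)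
next
  assume *: "?A \<and> ?B \<and> ?C"
  have "vector_derivative (\<lambda>s. f (slice_pt k s y)) (at x) + k * vector_derivative (\<lambda>t. f (slice_pt k x t)) (at y) = 0"
    if k: "k \<in> imag_sphere" and xy: "slice_pt k x y \<in> slice_ball k" for k x y
  proof -
    have "Complex x y \<in> ball 0 1"
      using xy emb_qball_iff[OF k] by (simp add: slice_ball_def slice_pt_emb)
    then obtain d where d: "((\<lambda>w. f (emb k w)) has_derivative (\<lambda>h. emb k h * d)) (at (Complex x y))"
      using * k by blast
    have "k * (k * d) = - d" using imag_sphere_square[OF k] by (metis mult.assoc mult_minus1)
    then show ?thesis
      unfolding slice_partial_derivatives[OF d, unfolded complex.sel] by simp
  qed
  then show "f \<in> slice_regular" using * by (simp add: slice_regular_def)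
qed

section \<open>Right linear structure and real derivatives of functions on a slice\<close>

lemma slice_regular_add:
  assumes f: "f \<in> slice_regular" and g: "g \<in> slice_regular"
  shows "fun_add f g \<in> slice_regular"
  unfolding slice_regular_iff fun_add_def
proof (intro conjI allI impI ballI)
  show "f q + g q = 0" if "q \<notin> qball" for q using f g that by (simp add: slice_regular_iff)
  show "(\<lambda>q. f q + g q) differentiable_on qball"
    using f g by (intro differentiable_on_add) (auto simp: slice_regular_iff)
  fix k z assume k: "k \<in> imag_sphere" and z: "z \<in> ball (0::complex) 1"
  obtain d e where "((\<lambda>w. f (emb k w)) has_derivative (\<lambda>h. emb k h * d)) (at z)"
     "((\<lambda>w. g (emb k w)) has_derivative (\<lambda>h. emb k h * e)) (at z)"
    using f g k z unfolding slice_regular_iff by blast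
  from has_derivative_add[OF this]
  show "\<exists>d. ((\<lambda>w. f (emb k w) + g (emb k w)) has_derivative (\<lambda>h. emb k h * d)) (at z)"
    by (auto simp: distrib_left intro!: exI[of _ "d + e"])
qed

lemma slice_regular_scale:
  assumes f: "f \<in> slice_regular"
  shows "fun_scale f c \<in> slice_regular"
  unfolding slice_regular_iff fun_scale_def
proof (intro conjI allI impI ballI)
  show "f q * c = 0" if "q \<notin> qball" for q using f that by (simp add: slice_regular_iff)
  show "(\<lambda>q. f q * c) differentiable_on qball"
    using f by (intro differentiable_on_mult differentiable_on_const) (auto simp: slice_regular_iff)
  fix k z assume k: "k \<in> imag_sphere" and z: "z \<in> ball (0::complex) 1"
  obtain d where "((\<lambda>w. f (emb k w)) has_derivative (\<lambda>h. emb k h * d)) (at z)"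
    using f k z unfolding slice_regular_iff by blast
  from has_derivative_mult_left[OF this, of c]
  show "\<exists>d. ((\<lambda>w. f (emb k w) * c) has_derivative (\<lambda>h. emb k h * d)) (at z)"
    by (auto simp: mult.assoc)
qed

lemma slice_regular_zero: "fun_zero \<in> slice_regular"
  unfolding slice_regular_iff fun_zero_def by (auto intro!: exI[of _ 0])

context slice_frame
begin

lemma slice_hol_has_real_deriv:
  assumes g: "slice_hol i j g" and z: "z \<in> ball 0 1"
  shows "((\<lambda>z. g (emb i z)) has_derivative (\<lambda>h. emb i h * real_deriv g (emb i z))) (at z)"
  using slice_hol_has_derivative[OF g z] real_deriv_slice[OF g z] by simp

lemma slice_hol_real_derivI:
  assumes "\<And>z. z \<in> ball 0 1 \<Longrightarrow> ((\<lambda>z. g (emb i z)) has_derivative (\<lambda>h. emb i h * d z)) (at z)"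
  shows "slice_hol i j g" "\<And>z. z \<in> ball 0 1 \<Longrightarrow> real_deriv g (emb i z) = d z"
proof -
  show g: "slice_hol i j g" using slice_holI[OF assms] .
  fix z :: complex assume z: "z \<in> ball 0 1"
  have "(\<lambda>h. emb i h * real_deriv g (emb i z)) = (\<lambda>h. emb i h * d z)"
    by (rule has_derivative_unique[OF slice_hol_has_real_deriv[OF g z] assms[OF z]])
  from fun_cong[OF this, of 1] show "real_deriv g (emb i z) = d z" by simp
qed

text \<open>\<open>real_deriv\<close> moves in the real direction and so stays inside the slice.
  This carries derivatives from a function on the slice to its extension.\<close>

lemma slice_hol_cong:
  assumes f: "slice_hol i j f" and eq: "\<And>z. z \<in> ball 0 1 \<Longrightarrow> g (emb i z) = f (emb i z)"
  shows "slice_hol i j g" "\<And>z. z \<in> ball 0 1 \<Longrightarrow> real_deriv g (emb i z) = real_deriv f (emb i z)"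
proof -
  have "((\<lambda>z. g (emb i z)) has_derivative (\<lambda>h. emb i h * real_deriv f (emb i z))) (at z)" if "z \<in> ball 0 1" for z
    by (rule has_derivative_transform_within_open[OF slice_hol_has_real_deriv[OF f that] open_ball[of 0 1]])
       (use that eq in auto)
  from slice_hol_real_derivI[OF this]
  show "slice_hol i j g" "\<And>z. z \<in> ball 0 1 \<Longrightarrow> real_deriv g (emb i z) = real_deriv f (emb i z)"
    by auto
qed

lemma slice_hol_add:
  assumes f: "slice_hol i j f" and g: "slice_hol i j g"
  shows "slice_hol i j (fun_add f g)"
    "\<And>z. z \<in> ball 0 1 \<Longrightarrow> real_deriv (fun_add f g) (emb i z) = real_deriv f (emb i z) + real_deriv g (emb i z)"
proof -
  have "((\<lambda>z. fun_add f g (emb i z)) has_derivative (\<lambda>h. emb i h * (real_deriv f (emb i z) + real_deriv g (emb i z)))) (at z)"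
    if z: "z \<in> ball 0 1" for z
    using has_derivative_add[OF slice_hol_has_real_deriv[OF f z] slice_hol_has_real_deriv[OF g z]]
    by (simp add: fun_add_def distrib_left)
  from slice_hol_real_derivI[OF this]
  show "slice_hol i j (fun_add f g)"
    "\<And>z. z \<in> ball 0 1 \<Longrightarrow> real_deriv (fun_add f g) (emb i z) = real_deriv f (emb i z) + real_deriv g (emb i z)"
    by auto
qed

lemma slice_hol_scale:
  assumes f: "slice_hol i j f"
  shows "slice_hol i j (fun_scale f c)"
    "\<And>z. z \<in> ball 0 1 \<Longrightarrow> real_deriv (fun_scale f c) (emb i z) = real_deriv f (emb i z) * c"
proof -
  have "((\<lambda>z. fun_scale f c (emb i z)) has_derivative (\<lambda>h. emb i h * (real_deriv f (emb i z) * c))) (at z)"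
    if z: "z \<in> ball 0 1" for z
    using has_derivative_mult_left[OF slice_hol_has_real_deriv[OF f z], of c]
    by (simp add: fun_scale_def mult.assoc)
  from slice_hol_real_derivI[OF this]
  show "slice_hol i j (fun_scale f c)"
    "\<And>z. z \<in> ball 0 1 \<Longrightarrow> real_deriv (fun_scale f c) (emb i z) = real_deriv f (emb i z) * c"
    by auto
qed

lemma slice_hol_continuous:
  assumes "slice_hol i j g"
  shows "continuous_on (ball 0 1) (\<lambda>z. g (emb i z))"
  using has_derivative_continuous[OF slice_hol_has_derivative[OF assms]]
  by (auto intro: continuous_at_imp_continuous_on)

definition slice_density :: "real \<Rightarrow> real \<Rightarrow> (quat \<Rightarrow> quat) \<Rightarrow> complex \<Rightarrow> real"
  where "slice_density p a g z = indicator (ball 0 1) z * ((1 - (norm z)\<^sup>2) powr a * norm (g (emb i z)) powr p)"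

definition slice_energy :: "real \<Rightarrow> real \<Rightarrow> (quat \<Rightarrow> quat) \<Rightarrow> ennreal"
  where "slice_energy p a g = (\<integral>\<^sup>+z. ennreal (slice_density p a g z) \<partial>lborel)"

text \<open>The exponent p - 2 is that of the factor (1 - |z|^2)^p of the seminorm less the 2 from
  the hyperbolic density. The factor 1 / pi is left out, so rho^p is the energy divided by
  pi.\<close>

abbreviation besov_energy :: "real \<Rightarrow> (quat \<Rightarrow> quat) \<Rightarrow> ennreal"
  where "besov_energy p f \<equiv> slice_energy p (p - 2) (real_deriv f)"

lemma slice_density_nonneg: "0 \<le> slice_density p a g z"
  by (simp add: slice_density_def)

lemma slice_density_measurable:
  assumes "slice_hol i j g"
  shows "slice_density p a g \<in> borel_measurable borel"
  unfolding slice_density_def[abs_def]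
  by (rule borel_measurable_indicator_ball_powr[OF slice_hol_continuous[OF assms]]) measurable

lemma slice_energy_cong:
  assumes "\<And>z. z \<in> ball 0 1 \<Longrightarrow> norm (g (emb i z)) = norm (h (emb i z))"
  shows "slice_energy p a g = slice_energy p a h"
  unfolding slice_energy_def slice_density_def using assms
  by (intro nn_integral_cong) (auto simp: indicator_def)

text \<open>The complex result is applied to both coordinates, whose derivatives are dominated by
  the norm of \<open>real_deriv g\<close>; the norm of g is then at most the sum of theirs.\<close>

lemma slice_energy_real_deriv_step:
  assumes g: "slice_hol i j g" and a: "a > -1" and p: "p > 1"
    and fin: "slice_energy p (a + p) (real_deriv g) < \<infinity>"
  shows "slice_energy p a g < \<infinity>"
proof -
  let ?d = "\<lambda>a F z. ennreal (indicator (ball 0 1) z * ((1 - (norm z)\<^sup>2) powr a * norm (F z :: complex) powr p))"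
  have fin': "(\<integral>\<^sup>+z. ?d a F z \<partial>lborel) < \<infinity>" if F: "F holomorphic_on ball 0 1"
    and le: "\<And>z. z \<in> ball 0 1 \<Longrightarrow> norm (deriv F z) \<le> norm (real_deriv g (emb i z))" for F
  proof (rule weighted_Lp_deriv_imp_weighted_Lp[OF F a p])
    have "(\<integral>\<^sup>+z. ?d (a + p) (deriv F) z \<partial>lborel) \<le> slice_energy p (a + p) (real_deriv g)"
      unfolding slice_energy_def slice_density_def
    proof (rule nn_integral_mono, rule ennreal_leI)
      fix z :: complex
      show "indicator (ball 0 1) z * ((1 - (norm z)\<^sup>2) powr (a + p) * norm (deriv F z) powr p)
        \<le> indicator (ball 0 1) z * ((1 - (norm z)\<^sup>2) powr (a + p) * norm (real_deriv g (emb i z)) powr p)"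
        using le[of z] p by (cases "z \<in> ball 0 1") (auto intro!: mult_left_mono powr_mono2)
    qed
    then show "(\<integral>\<^sup>+z. ?d (a + p) (deriv F) z \<partial>lborel) < \<infinity>"
      using fin by (rule le_less_trans)
  qed
  let ?F = "\<lambda>z. coord i (g (emb i z))" and ?G = "\<lambda>z. coord2 i j (g (emb i z))"
  have F: "?F holomorphic_on ball 0 1" and G: "?G holomorphic_on ball 0 1"
    using g by (auto simp: slice_hol_def)
  have finF: "(\<integral>\<^sup>+z. ?d a ?F z \<partial>lborel) < \<infinity>"
    by (rule fin'[OF F]) (simp add: slice_hol_real_deriv(2)[OF g, symmetric] norm_coord_le)
  have finG: "(\<integral>\<^sup>+z. ?d a ?G z \<partial>lborel) < \<infinity>"
    by (rule fin'[OF G]) (simp add: slice_hol_real_deriv(3)[OF g, symmetric] norm_coord_le)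
  have m: "?d a H \<in> borel_measurable lborel" if "H holomorphic_on ball 0 1" for H
    using borel_measurable_indicator_ball_powr[OF holomorphic_on_imp_continuous_on[OF that], of "\<lambda>z. (1 - (norm z)\<^sup>2) powr a" p]
    by auto
  have "slice_energy p a g \<le> (\<integral>\<^sup>+z. ennreal (2 powr p) * (?d a ?F z + ?d a ?G z) \<partial>lborel)"
    unfolding slice_energy_def slice_density_def
  proof (rule nn_integral_mono)
    fix z :: complex
    have "norm (g (emb i z)) \<le> norm (?F z) + norm (?G z)"
    proof -
      have "norm (g (emb i z)) = norm (emb i (?F z) + emb i (?G z) * j)" by (simp only: slice_split)
      also have "\<dots> \<le> norm (emb i (?F z)) + norm (emb i (?G z) * j)" by (rule norm_triangle_ineq)
      finally show ?thesis using imag_sphereD[OF j] by (simp add: norm_emb[OF i] norm_mult)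
    qed
    then have "norm (g (emb i z)) powr p \<le> (norm (?F z) + norm (?G z)) powr p"
      using p by (intro powr_mono2) auto
    also have "\<dots> \<le> 2 powr p * (norm (?F z) powr p + norm (?G z) powr p)"
      using p by (intro powr_add_le) auto
    finally have "(1 - (norm z)\<^sup>2) powr a * norm (g (emb i z)) powr p \<le>
        (1 - (norm z)\<^sup>2) powr a * (2 powr p * (norm (?F z) powr p + norm (?G z) powr p))"
      by (rule mult_left_mono) auto
    then show "ennreal (indicator (ball 0 1) z * ((1 - (norm z)\<^sup>2) powr a * norm (g (emb i z)) powr p)) \<le>
      ennreal (2 powr p) * (?d a ?F z + ?d a ?G z)"
      by (auto simp: indicator_def ennreal_mult'[symmetric] ennreal_plus[symmetric] algebra_simps simp del: ennreal_plus intro!: ennreal_leI)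
  qed
  also have "\<dots> = ennreal (2 powr p) * (\<integral>\<^sup>+z. ?d a ?F z + ?d a ?G z \<partial>lborel)"
    by (rule nn_integral_cmult) (intro borel_measurable_add m F G)
  also have "(\<integral>\<^sup>+z. ?d a ?F z + ?d a ?G z \<partial>lborel) = (\<integral>\<^sup>+z. ?d a ?F z \<partial>lborel) + (\<integral>\<^sup>+z. ?d a ?G z \<partial>lborel)"
    by (rule nn_integral_add[OF m[OF F] m[OF G]])
  also have "ennreal (2 powr p) * \<dots> < \<infinity>"
    using finF finG by (simp add: ennreal_mult_less_top)
  finally show ?thesis .
qed

end

section \<open>The hyperbolic measure of a slice in disc coordinates\<close>

lemma coord_measurable [measurable]: "coord i \<in> borel_measurable borel"
  by (intro borel_measurable_continuous_onI linear_continuous_on bounded_linear_coord)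

lemma emb_measurable [measurable]: "emb i \<in> borel_measurable borel"
  by (intro borel_measurable_continuous_onI linear_continuous_on bounded_linear_emb)

text \<open>The slice plane is the fixed point set of the continuous projection
  \<open>emb i (coord i q)\<close>, hence closed.\<close>

lemma slice_ball_measurable [measurable]:
  assumes i: "i \<in> imag_sphere"
  shows "slice_ball i \<in> sets borel"
proof -
  have "slice_ball i = qball \<inter> {q. emb i (coord i q) = q}"
  proof
    show "slice_ball i \<subseteq> qball \<inter> {q. emb i (coord i q) = q}"
      by (auto simp: slice_ball_eq[OF i] norm_emb[OF i] coord_emb[OF i])
    show "qball \<inter> {q. emb i (coord i q) = q} \<subseteq> slice_ball i"
      by (auto simp: slice_ball_def slice_plane_eq) (metis rangeI)
  qed
  moreover have "closed {q. emb i (coord i q) = q}"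
    by (intro closed_Collect_eq continuous_on_id linear_continuous_on
        bounded_linear_compose[OF bounded_linear_emb bounded_linear_coord])
  ultimately show ?thesis by simp
qed

text \<open>Merges the two densities of the definition and moves them to the disc, where the measure
  is a weight against Lebesgue measure.\<close>

lemma slice_hyp_distr:
  assumes i: "i \<in> imag_sphere"
  shows "slice_hyp i = distr (density lborel (\<lambda>z. ennreal (indicator (ball 0 1) z / (pi * (1 - (norm z)\<^sup>2)\<^sup>2)))) borel (emb i)"
proof -
  note [measurable] = slice_ball_measurable[OF i]
  have emb: "emb i = (\<lambda>z. slice_pt i (Re z) (Im z))" by (simp add: emb_def[abs_def])
  have "slice_area i = density (distr lborel borel (emb i)) (\<lambda>z. ennreal (indicator (slice_ball i) z / pi))"
    unfolding slice_area_def emb ..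
  then have "slice_hyp i = density (distr lborel borel (emb i))
     (\<lambda>z. ennreal (indicator (slice_ball i) z / pi) * ennreal (1 / (1 - (norm z)\<^sup>2)\<^sup>2))"
    unfolding slice_hyp_def by (simp only:, subst density_density_eq) auto
  also have "\<dots> = distr (density lborel (\<lambda>z. ennreal (indicator (slice_ball i) (emb i z) / pi) * ennreal (1 / (1 - (norm (emb i z))\<^sup>2)\<^sup>2))) borel (emb i)"
    by (rule density_distr) measurable
  also have "(\<lambda>z. ennreal (indicator (slice_ball i) (emb i z) / pi) * ennreal (1 / (1 - (norm (emb i z))\<^sup>2)\<^sup>2))
     = (\<lambda>z. ennreal (indicator (ball 0 1) z / (pi * (1 - (norm z)\<^sup>2)\<^sup>2)))"
  proof
    fix z
    have "emb i z \<in> slice_ball i \<longleftrightarrow> z \<in> ball 0 1"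
      using emb_qball_iff[OF i, of z] by (auto simp: slice_ball_def slice_plane_eq)
    then show "ennreal (indicator (slice_ball i) (emb i z) / pi) * ennreal (1 / (1 - (norm (emb i z))\<^sup>2)\<^sup>2)
      = ennreal (indicator (ball 0 1) z / (pi * (1 - (norm z)\<^sup>2)\<^sup>2))"
      by (simp add: norm_emb[OF i] ennreal_mult'[symmetric] indicator_def)
  qed
  finally show ?thesis .
qed

lemma nn_integral_slice_hyp:
  fixes H :: "complex \<Rightarrow> real"
  assumes i: "i \<in> imag_sphere" and [measurable]: "H \<in> borel_measurable borel"
    and h: "\<And>z. z \<in> ball 0 1 \<Longrightarrow> h (emb i z) = ennreal (H z)"
  shows "(\<integral>\<^sup>+q\<in>slice_ball i. h q \<partial>slice_hyp i) =
    ennreal (1 / pi) * (\<integral>\<^sup>+z. ennreal (indicator (ball 0 1) z * (H z / (1 - (norm z)\<^sup>2)\<^sup>2)) \<partial>lborel)"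
proof -
  note [measurable] = slice_ball_measurable[OF i]
  let ?w = "\<lambda>z. ennreal (indicator (ball 0 1) z / (pi * (1 - (norm z)\<^sup>2)\<^sup>2))"
  have [measurable]: "?w \<in> borel_measurable borel" by measurable
  \<comment> \<open>Off the slice disc h is arbitrary and perhaps not measurable; H composed with
    \<open>coord i\<close> is Borel and agrees with it on the disc.\<close>
  have "(\<integral>\<^sup>+q\<in>slice_ball i. h q \<partial>slice_hyp i) = (\<integral>\<^sup>+q. ennreal (H (coord i q)) * indicator (slice_ball i) q \<partial>slice_hyp i)"
    by (intro nn_integral_cong) (auto simp: indicator_def slice_ball_eq[OF i] h coord_emb[OF i])
  also have "\<dots> = (\<integral>\<^sup>+z. ennreal (H z) * indicator (slice_ball i) (emb i z) \<partial>density lborel ?w)"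
    unfolding slice_hyp_distr[OF i] by (subst nn_integral_distr) (simp_all add: coord_emb[OF i])
  also have "\<dots> = (\<integral>\<^sup>+z. ?w z * (ennreal (H z) * indicator (slice_ball i) (emb i z)) \<partial>lborel)"
    by (subst nn_integral_density) simp_all
  also have "\<dots> = (\<integral>\<^sup>+z. ennreal (1 / pi) * ennreal (indicator (ball 0 1) z * (H z / (1 - (norm z)\<^sup>2)\<^sup>2)) \<partial>lborel)"
  proof (intro nn_integral_cong)
    fix z :: complex
    have "emb i z \<in> slice_ball i \<longleftrightarrow> z \<in> ball 0 1"
      using emb_qball_iff[OF i, of z] by (auto simp: slice_ball_def slice_plane_eq)
    then show "?w z * (ennreal (H z) * indicator (slice_ball i) (emb i z)) = ennreal (1 / pi) * ennreal (indicator (ball 0 1) z * (H z / (1 - (norm z)\<^sup>2)\<^sup>2))"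
      by (simp add: ennreal_mult'[symmetric] indicator_def)
  qed
  also have "\<dots> = ennreal (1 / pi) * (\<integral>\<^sup>+z. ennreal (indicator (ball 0 1) z * (H z / (1 - (norm z)\<^sup>2)\<^sup>2)) \<partial>lborel)"
    by (rule nn_integral_cmult) measurable
  finally show ?thesis .
qed

lemma disc_defect_pos: "norm (z::complex) < 1 \<Longrightarrow> 1 - (norm z)\<^sup>2 > 0"
  by (simp add: abs_square_less_1)

context slice_frame
begin

lemma nn_integral_slice_hyp_energy:
  assumes g: "slice_hol i j g"
    and h: "\<And>z. z \<in> ball 0 1 \<Longrightarrow> h (emb i z) = ennreal ((1 - (norm z)\<^sup>2) powr a * norm (g (emb i z)) powr p)"
  shows "(\<integral>\<^sup>+q\<in>slice_ball i. h q \<partial>slice_hyp i) = ennreal (1 / pi) * slice_energy p (a - 2) g"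
proof -
  have "(\<integral>\<^sup>+q\<in>slice_ball i. h q \<partial>slice_hyp i) =
    ennreal (1 / pi) * (\<integral>\<^sup>+z. ennreal (indicator (ball 0 1) z * (slice_density p a g z / (1 - (norm z)\<^sup>2)\<^sup>2)) \<partial>lborel)"
    by (rule nn_integral_slice_hyp[OF i slice_density_measurable[OF g]]) (simp add: h slice_density_def)
  also have "(\<integral>\<^sup>+z. ennreal (indicator (ball 0 1) z * (slice_density p a g z / (1 - (norm z)\<^sup>2)\<^sup>2)) \<partial>lborel) = slice_energy p (a - 2) g"
    unfolding slice_energy_def
  proof (intro nn_integral_cong arg_cong[where f = ennreal])
    fix z :: complex
    show "indicator (ball 0 1) z * (slice_density p a g z / (1 - (norm z)\<^sup>2)\<^sup>2) = slice_density p (a - 2) g z"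
      using disc_defect_pos[of z] by (auto simp: slice_density_def indicator_def powr_diff)
  qed
  finally show ?thesis .
qed

text \<open>Ties membership, which allows every order n, to the integral of the seminorm. Since n p
  > 1 rules out n = 0, \<open>down\<close> may start from a successor; conversely p > 1 admits n =
  1.\<close>

lemma besov_iff:
  assumes p: "p > 1"
  shows "f \<in> besov p i \<longleftrightarrow> f \<in> slice_regular \<and> besov_energy p f < \<infinity>"
proof (cases "f \<in> slice_regular")
  case True
  then have hol: "slice_hol i j f" by (rule slice_regular_imp_slice_hol)
  have eq: "(\<integral>\<^sup>+z\<in>slice_ball i. ennreal (norm ((1 - (norm z)\<^sup>2) ^ n *\<^sub>R (real_deriv ^^ n) f z) powr p) \<partial>slice_hyp i)
     = ennreal (1 / pi) * slice_energy p (real n * p - 2) ((real_deriv ^^ n) f)" for n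
  proof (rule nn_integral_slice_hyp_energy[OF slice_hol_real_deriv_funpow[OF hol]])
    fix z :: complex assume "z \<in> ball 0 1"
    then have d: "1 - (norm z)\<^sup>2 > 0" using disc_defect_pos by simp
    then have "(1 - (norm z)\<^sup>2) ^ n = (1 - (norm z)\<^sup>2) powr real n" by (simp add: powr_realpow)
    then show "ennreal (norm ((1 - (norm (emb i z))\<^sup>2) ^ n *\<^sub>R (real_deriv ^^ n) f (emb i z)) powr p) =
       ennreal ((1 - (norm z)\<^sup>2) powr (real n * p) * norm ((real_deriv ^^ n) f (emb i z)) powr p)"
      using d by (simp add: norm_emb[OF i] powr_mult powr_powr)
  qed
  have fin: "ennreal (1 / pi) * x < \<infinity> \<longleftrightarrow> x < \<infinity>" for x
    by (auto simp: ennreal_mult_less_top)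
  have down: "slice_energy p (real (Suc n) * p - 2) ((real_deriv ^^ Suc n) f) < \<infinity> \<Longrightarrow> besov_energy p f < \<infinity>" for n
  proof (induction n)
    case (Suc n)
    have "slice_energy p (real (Suc n) * p - 2) ((real_deriv ^^ Suc n) f) < \<infinity>"
    proof (rule slice_energy_real_deriv_step[OF slice_hol_real_deriv_funpow[OF hol] _ p])
      \<comment> \<open>Here the order is at least 1, which is what puts the exponent in the range
        of Hardy's inequality.\<close>
      have "1 * p \<le> real (Suc n) * p" using p by (intro mult_right_mono) auto
      then show "real (Suc n) * p - 2 > -1" using p by linarith
      have eq: "real (Suc n) * p - 2 + p = real (Suc (Suc n)) * p - 2" by (simp add: algebra_simps)
      then show "slice_energy p (real (Suc n) * p - 2 + p) (real_deriv ((real_deriv ^^ Suc n) f)) < \<infinity>"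
        unfolding eq using Suc.prems by simp
    qed
    then show ?case by (rule Suc.IH)
  qed simp
  have "(\<exists>n. real n * p > 1 \<and> slice_energy p (real n * p - 2) ((real_deriv ^^ n) f) < \<infinity>) \<longleftrightarrow> besov_energy p f < \<infinity>"
  proof
    assume "\<exists>n. real n * p > 1 \<and> slice_energy p (real n * p - 2) ((real_deriv ^^ n) f) < \<infinity>"
    then obtain n where n: "real n * p > 1" "slice_energy p (real n * p - 2) ((real_deriv ^^ n) f) < \<infinity>" by blast
    then obtain m where "n = Suc m" by (cases n) auto
    then show "besov_energy p f < \<infinity>" using down n by blast
  next
    assume "besov_energy p f < \<infinity>"
    then show "\<exists>n. real n * p > 1 \<and> slice_energy p (real n * p - 2) ((real_deriv ^^ n) f) < \<infinity>"
      using p by (intro exI[of _ 1]) simp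
  qed
  then show ?thesis using True unfolding besov_def by (simp only: mem_Collect_eq eq fin simp_thms)
qed (simp add: besov_def)

text \<open>A Bochner integral defaults to 0 when the integrand is not integrable; integrability is
  what gives \<open>besov_rho\<close> its intended meaning.\<close>

lemma besov_integrand_integral:
  assumes f: "f \<in> slice_regular" and fin: "besov_energy p f < \<infinity>"
  shows "set_integrable (slice_hyp i) (slice_ball i) (besov_integrand p f)"
    and "(LINT z:slice_ball i|slice_hyp i. besov_integrand p f z) = enn2real (besov_energy p f) / pi"
proof -
  note [measurable] = slice_ball_measurable[OF i]
  have hol: "slice_hol i j (real_deriv f)"
    using slice_hol_real_deriv(1)[OF slice_regular_imp_slice_hol[OF f]] .
  note [measurable] = slice_density_measurable[OF hol]
  have s: "sets (slice_hyp i) = sets borel" by (simp add: slice_hyp_def slice_area_def)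
  let ?k = "\<lambda>q. indicator (slice_ball i) q *\<^sub>R besov_integrand p f q"
  \<comment> \<open>Measurability of \<open>real_deriv f\<close> is known along the slice only, so
    the integrand is rewritten as a disc density composed with \<open>coord i\<close>.\<close>
  have "?k = (\<lambda>q. indicator (slice_ball i) q * slice_density p p (real_deriv f) (coord i q))"
    by (auto simp: fun_eq_iff indicator_def besov_integrand_def slice_density_def slice_ball_eq[OF i]
       norm_emb[OF i] coord_emb[OF i])
  then have m: "?k \<in> borel_measurable (slice_hyp i)"
    unfolding measurable_cong_sets[OF s refl] by (simp only:) measurable
  have nn: "0 \<le> ?k q" for q by (simp add: besov_integrand_def)
  have "(\<integral>\<^sup>+q. ennreal (?k q) \<partial>slice_hyp i) = (\<integral>\<^sup>+q\<in>slice_ball i. ennreal (besov_integrand p f q) \<partial>slice_hyp i)"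
    by (intro nn_integral_cong) (auto simp: indicator_def)
  also have "\<dots> = ennreal (1 / pi) * besov_energy p f"
    by (rule nn_integral_slice_hyp_energy[OF hol]) (simp add: besov_integrand_def norm_emb[OF i])
  finally have I: "(\<integral>\<^sup>+q. ennreal (?k q) \<partial>slice_hyp i) = ennreal (1 / pi) * besov_energy p f" .
  show "set_integrable (slice_hyp i) (slice_ball i) (besov_integrand p f)"
    unfolding set_integrable_def
    by (rule integrableI_nonneg[OF m]) (use nn I fin in \<open>auto simp: ennreal_mult_less_top\<close>)
  show "(LINT z:slice_ball i|slice_hyp i. besov_integrand p f z) = enn2real (besov_energy p f) / pi"
    unfolding set_lebesgue_integral_def
    by (subst integral_eq_nn_integral[OF m]) (use nn I in \<open>auto simp: enn2real_mult\<close>)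
qed

lemma besov_rho_eq:
  assumes f: "f \<in> slice_regular" and fin: "besov_energy p f < \<infinity>"
  shows "besov_rho p i f = (enn2real (besov_energy p f) / pi) powr (1 / p)"
  unfolding besov_rho_def besov_integrand_integral(2)[OF assms] ..

end

section \<open>Minkowski's inequality, limits and Moebius invariance of the energies\<close>

text \<open>Jensen's inequality for the two values u / A and v / B with weights A and B, by tangents
  at c. Equality for u / A = v / B is what makes the integrated version sharp.\<close>

lemma powr_add_le_weighted:
  fixes A B u v p :: real
  assumes p: "p > 1" and A: "A > 0" and B: "B > 0" and u: "u \<ge> 0" and v: "v \<ge> 0"
  shows "(u + v) powr p \<le> (A + B) powr (p - 1) * (A powr (1 - p) * u powr p + B powr (1 - p) * v powr p)"
proof -
  define c where "c = (u + v) / (A + B)"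
  have c: "c \<ge> 0" using assms by (simp add: c_def)
  have AB: "A + B > 0" using A B by simp
  have "A * (c powr p + p * c powr (p - 1) * (u / A - c)) \<le> A * (u / A) powr p"
    using powr_tangent[OF p _ c, of "u / A"] A u by (intro mult_left_mono) auto
  moreover have "B * (c powr p + p * c powr (p - 1) * (v / B - c)) \<le> B * (v / B) powr p"
    using powr_tangent[OF p _ c, of "v / B"] B v by (intro mult_left_mono) auto
  moreover have "A * (c powr p + p * c powr (p - 1) * (u / A - c)) + B * (c powr p + p * c powr (p - 1) * (v / B - c))
      = (A + B) * c powr p"
  proof -
    have "(A + B) * c = u + v" using AB by (simp add: c_def)
    moreover have "A * (c powr p + p * c powr (p - 1) * (u / A - c)) + B * (c powr p + p * c powr (p - 1) * (v / B - c))
      = (A + B) * c powr p + p * c powr (p - 1) * (u + v - (A + B) * c)"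
      using A B by (simp add: field_simps)
    ultimately show ?thesis by simp
  qed
  ultimately have 1: "(A + B) * c powr p \<le> A * (u / A) powr p + B * (v / B) powr p" by linarith
  have "(u + v) powr p = (A + B) powr (p - 1) * ((A + B) * c powr p)"
    using AB by (simp add: c_def powr_divide powr_diff)
  also have "\<dots> \<le> (A + B) powr (p - 1) * (A * (u / A) powr p + B * (v / B) powr p)"
    using 1 by (intro mult_left_mono) auto
  also have "A * (u / A) powr p = A powr (1 - p) * u powr p" using A by (simp add: powr_divide powr_diff)
  also have "B * (v / B) powr p = B powr (1 - p) * v powr p" using B by (simp add: powr_divide powr_diff)
  finally show ?thesis .
qed

context slice_frame
begin

text \<open>A and B play the part of the norms of g and h. Integrating the weighted inequality gives
  c (A + B)^(p-1) (A + B), so roots are avoided. The constant c will be pi.\<close>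

lemma slice_energy_Minkowski:
  assumes p: "p > 1" and g: "slice_hol i j g" and h: "slice_hol i j h" and c: "c \<ge> 0" and A: "A > 0" and B: "B > 0"
    and gA: "slice_energy p a g \<le> ennreal (c * A powr p)" and hB: "slice_energy p a h \<le> ennreal (c * B powr p)"
    and le: "\<And>z. z \<in> ball 0 1 \<Longrightarrow> norm (k (emb i z)) \<le> norm (g (emb i z)) + norm (h (emb i z))"
  shows "slice_energy p a k \<le> ennreal (c * (A + B) powr p)"
proof -
  let ?S = "(A + B) powr (p - 1)"
  note m = slice_density_measurable[OF g, of p a] slice_density_measurable[OF h, of p a]
  have "slice_energy p a k \<le> (\<integral>\<^sup>+z. ennreal (?S * A powr (1 - p)) * ennreal (slice_density p a g z)
      + ennreal (?S * B powr (1 - p)) * ennreal (slice_density p a h z) \<partial>lborel)"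
    unfolding slice_energy_def
  proof (rule nn_integral_mono)
    fix z :: complex
    show "ennreal (slice_density p a k z) \<le> ennreal (?S * A powr (1 - p)) * ennreal (slice_density p a g z)
      + ennreal (?S * B powr (1 - p)) * ennreal (slice_density p a h z)"
    proof (cases "z \<in> ball 0 1")
      case True
      let ?u = "norm (g (emb i z))" and ?v = "norm (h (emb i z))"
      have "norm (k (emb i z)) powr p \<le> (?u + ?v) powr p"
        using le[OF True] p by (intro powr_mono2) auto
      also have "\<dots> \<le> ?S * (A powr (1 - p) * ?u powr p + B powr (1 - p) * ?v powr p)"
        by (rule powr_add_le_weighted[OF p A B]) auto
      finally have "(1 - (norm z)\<^sup>2) powr a * norm (k (emb i z)) powr p \<le>
         (1 - (norm z)\<^sup>2) powr a * (?S * (A powr (1 - p) * ?u powr p + B powr (1 - p) * ?v powr p))"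
        by (rule mult_left_mono) auto
      then show ?thesis using True
        by (simp add: slice_density_def ennreal_mult'[symmetric] ennreal_plus[symmetric] algebra_simps ennreal_leI del: ennreal_plus)
    qed (simp add: slice_density_def)
  qed
  also have "\<dots> = ennreal (?S * A powr (1 - p)) * slice_energy p a g + ennreal (?S * B powr (1 - p)) * slice_energy p a h"
    unfolding slice_energy_def using m by (simp add: nn_integral_add nn_integral_cmult)
  also have "\<dots> \<le> ennreal (?S * A powr (1 - p)) * ennreal (c * A powr p) + ennreal (?S * B powr (1 - p)) * ennreal (c * B powr p)"
    by (intro add_mono mult_left_mono gA hB) auto
  also have "\<dots> = ennreal (?S * A powr (1 - p) * (c * A powr p) + ?S * B powr (1 - p) * (c * B powr p))"
    using c by (simp add: ennreal_mult'[symmetric] ennreal_plus[symmetric] del: ennreal_plus)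
  also have "?S * A powr (1 - p) * (c * A powr p) + ?S * B powr (1 - p) * (c * B powr p) = c * (A + B) powr p"
  proof -
    have "A powr (1 - p) * A powr p = A" "B powr (1 - p) * B powr p = B"
      using A B by (simp_all add: powr_add[symmetric])
    moreover have "?S * (A + B) = (A + B) powr p" using A B by (simp add: powr_diff)
    moreover have "?S * A powr (1 - p) * (c * A powr p) + ?S * B powr (1 - p) * (c * B powr p)
      = c * (?S * (A powr (1 - p) * A powr p + B powr (1 - p) * B powr p))" by (simp add: algebra_simps)
    ultimately show ?thesis by simp
  qed
  finally show ?thesis .
qed

lemma slice_energy_scale:
  assumes p: "p > 1" and g: "slice_hol i j g"
    and eq: "\<And>z. z \<in> ball 0 1 \<Longrightarrow> norm (k (emb i z)) = norm (g (emb i z)) * c" and c: "c \<ge> 0"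
  shows "slice_energy p a k = ennreal (c powr p) * slice_energy p a g"
proof -
  have "slice_energy p a k = (\<integral>\<^sup>+z. ennreal (c powr p) * ennreal (slice_density p a g z) \<partial>lborel)"
    unfolding slice_energy_def
    by (intro nn_integral_cong) (auto simp: slice_density_def indicator_def eq powr_mult ennreal_mult'[symmetric])
  also have "\<dots> = ennreal (c powr p) * slice_energy p a g"
    unfolding slice_energy_def using slice_density_measurable[OF g] by (intro nn_integral_cmult) auto
  finally show ?thesis .
qed

text \<open>Each coordinate is a holomorphic function dominated by g. The factor pi^(1/p) absorbs
  the pi in the energy bound into N.\<close>

lemma slice_energy_point_bound:
  assumes r: "0 \<le> r" "r < 1" and p: "p > 1"
  obtains C where "C > 0" and "\<And>g N z. slice_hol i j g \<Longrightarrow> N > 0 \<Longrightarrow>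
    slice_energy p (p - 2) g \<le> ennreal (pi * N powr p) \<Longrightarrow> norm z \<le> r \<Longrightarrow>
    norm (coord i (g (emb i z))) \<le> C * N \<and> norm (coord2 i j (g (emb i z))) \<le> C * N"
proof -
  have "p \<ge> 1" using p by simp
  from weighted_Lp_point_bound[OF r this] obtain C where C: "C > 0" and
    bound: "\<And>h N z. h holomorphic_on ball 0 1 \<Longrightarrow> N > 0 \<Longrightarrow>
    disc_Lp p (p - 2) h \<le> ennreal (N powr p) \<Longrightarrow>
    norm z \<le> r \<Longrightarrow> norm (h z) \<le> C * N" by blast
  show ?thesis
  proof (rule that)
    show "C * pi powr (1 / p) > 0" using C by simp
    fix g N and z :: complex
    assume g: "slice_hol i j g" and N: "N > 0"
      and E: "slice_energy p (p - 2) g \<le> ennreal (pi * N powr p)" and z: "norm z \<le> r"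
    have N': "pi powr (1 / p) * N > 0" using N by simp
    have eq: "pi * N powr p = (pi powr (1 / p) * N) powr p"
      using p by (simp add: powr_mult powr_powr)
    have comp: "norm (h z) \<le> C * (pi powr (1 / p) * N)"
      if h: "h holomorphic_on ball 0 1" and le: "\<And>w. norm (h w) \<le> norm (g (emb i w))" for h
    proof (rule bound[OF h N' _ z])
      have "disc_Lp p (p - 2) h \<le> slice_energy p (p - 2) g"
        unfolding slice_energy_def
      proof (rule nn_integral_mono, rule ennreal_leI)
        fix w show "indicator (ball 0 1) w * ((1 - (norm w)\<^sup>2) powr (p - 2) * norm (h w) powr p) \<le> slice_density p (p - 2) g w"
          using le[of w] p by (cases "w \<in> ball 0 1") (auto simp: slice_density_def intro!: mult_left_mono powr_mono2)
      qed
      then show "disc_Lp p (p - 2) h \<le> ennreal ((pi powr (1 / p) * N) powr p)"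
        using E unfolding eq by (rule order_trans)
    qed
    show "norm (coord i (g (emb i z))) \<le> C * pi powr (1 / p) * N \<and> norm (coord2 i j (g (emb i z))) \<le> C * pi powr (1 / p) * N"
      using comp[of "\<lambda>z. coord i (g (emb i z))"] comp[of "\<lambda>z. coord2 i j (g (emb i z))"] g
      by (simp add: slice_hol_def norm_coord_le mult.assoc)
  qed
qed

lemma coords_zero_iff: "coord i q = 0 \<Longrightarrow> coord2 i j q = 0 \<Longrightarrow> q = 0"
  using slice_split[of q] by simp

text \<open>Zero energy satisfies the point bound for every N > 0; letting N tend to 0 gives
  vanishing at every point rather than almost everywhere.\<close>

lemma slice_energy_zero_imp:
  assumes p: "p > 1" and g: "slice_hol i j g" and E: "slice_energy p (p - 2) g = 0" and z: "z \<in> ball 0 1"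
  shows "g (emb i z) = 0"
proof -
  obtain C where C: "C > 0" and bd: "\<And>N. N > 0 \<Longrightarrow> norm (coord i (g (emb i z))) \<le> C * N \<and> norm (coord2 i j (g (emb i z))) \<le> C * N"
    using slice_energy_point_bound[of "norm z" p] g z E p by (metis less_eq_real_def mem_ball_0 norm_ge_zero zero_le)
  have "x \<le> 0" if "\<And>N. N > 0 \<Longrightarrow> x \<le> C * N" for x :: real
  proof (rule field_le_epsilon)
    fix e :: real assume "e > 0"
    then show "x \<le> 0 + e" using that[of "e / C"] C by simp
  qed
  from this[of "norm (coord i (g (emb i z)))"] this[of "norm (coord2 i j (g (emb i z)))"] bd
  show ?thesis by (intro coords_zero_iff) auto
qed

text \<open>The point bound makes both coordinates uniformly Cauchy on each smaller disc, and
  locally uniform limits are holomorphic. The limit returned is pointwise; convergence in energy is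
  left to \<open>slice_energy_Fatou\<close>.\<close>

lemma slice_energy_Cauchy_limit:
  assumes p: "p > 1" and g: "\<And>n::nat. slice_hol i j (g n)"
    and cauchy: "\<And>e. e > 0 \<Longrightarrow> \<exists>N. \<forall>m\<ge>N. \<forall>n\<ge>N. slice_energy p (p - 2) (fun_add (g m) (fun_scale (g n) (- 1))) \<le> ennreal (pi * e powr p)"
  obtains h where "slice_hol i j h" "\<And>z. z \<in> ball 0 1 \<Longrightarrow> (\<lambda>n. g n (emb i z)) \<longlonglongrightarrow> h (emb i z)"
proof -
  let ?F = "\<lambda>n z. coord i (g n (emb i z))" and ?G = "\<lambda>n z. coord2 i j (g n (emb i z))"
  define F where "F z = lim (\<lambda>n. ?F n z)" for z
  define G where "G z = lim (\<lambda>n. ?G n z)" for z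
  have diff: "coord i (fun_add u (fun_scale v (- 1)) q) = coord i (u q) - coord i (v q)"
    "coord2 i j (fun_add u (fun_scale v (- 1)) q) = coord2 i j (u q) - coord2 i j (v q)" for u v q
    using linear_diff[OF bounded_linear.linear[OF bounded_linear_coord], of i "u q" "v q"]
      linear_diff[OF bounded_linear.linear[OF bounded_linear_coord2], of i j "u q" "v q"]
    by (simp_all add: fun_add_def fun_scale_def)
  have uc: "uniformly_Cauchy_on (cball 0 r) ?F \<and> uniformly_Cauchy_on (cball 0 r) ?G" if r: "0 \<le> r" "r < 1" for r
  proof -
    obtain C where C: "C > 0" and bd: "\<And>g N z. slice_hol i j g \<Longrightarrow> N > 0 \<Longrightarrow>
      slice_energy p (p - 2) g \<le> ennreal (pi * N powr p) \<Longrightarrow> norm z \<le> r \<Longrightarrow>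
      norm (coord i (g (emb i z))) \<le> C * N \<and> norm (coord2 i j (g (emb i z))) \<le> C * N"
      using slice_energy_point_bound[OF r p] by blast
    have "\<exists>M. \<forall>x\<in>cball 0 r. \<forall>m\<ge>M. \<forall>n\<ge>M. dist (?F m x) (?F n x) < e \<and> dist (?G m x) (?G n x) < e" if e: "e > 0" for e
    proof -
      \<comment> \<open>The point bound multiplies this by C and so leaves e / 2, strictly below
        e.\<close>
      have e': "e / (2 * C) > 0" using e C by simp
      from cauchy[OF this] obtain M where M: "\<And>m n. m \<ge> M \<Longrightarrow> n \<ge> M \<Longrightarrow>
        slice_energy p (p - 2) (fun_add (g m) (fun_scale (g n) (- 1))) \<le> ennreal (pi * (e / (2 * C)) powr p)" by blast
      have "dist (?F m x) (?F n x) < e \<and> dist (?G m x) (?G n x) < e" if "x \<in> cball 0 r" "m \<ge> M" "n \<ge> M" for x m n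
      proof -
        have "norm (?F m x - ?F n x) \<le> C * (e / (2 * C)) \<and> norm (?G m x - ?G n x) \<le> C * (e / (2 * C))"
          using bd[OF slice_hol_add(1)[OF g slice_hol_scale(1)[OF g]] e' M, of m n x] that
          by (simp add: diff)
        moreover have "C * (e / (2 * C)) < e" using e C by simp
        ultimately show ?thesis by (auto simp: dist_norm)
      qed
      then show ?thesis by blast
    qed
    then show ?thesis unfolding uniformly_Cauchy_on_def by meson
  qed
  have lims: "uniform_limit (cball 0 r) ?F F sequentially" "uniform_limit (cball 0 r) ?G G sequentially" if "0 \<le> r" "r < 1" for r
    using uc[OF that] unfolding F_def G_def
    by (auto simp: uniformly_convergent_uniform_limit_iff[symmetric] intro: Cauchy_uniformly_convergent)
  have sub: "\<exists>d>0. cball z d \<subseteq> ball 0 1 \<and> uniform_limit (cball z d) ?F F sequentially \<and> uniform_limit (cball z d) ?G G sequentially"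
    if z: "z \<in> ball 0 1" for z
  proof -
    define d where "d = (1 - norm z) / 2"
    have d: "d > 0" "norm z + d < 1" using z by (auto simp: d_def field_simps)
    have "cball z d \<subseteq> cball 0 (norm z + d)"
      by (auto simp: dist_norm) (metis add_left_mono norm_minus_commute norm_triangle_sub order_trans)
    then show ?thesis
      using lims[of "norm z + d"] d by (intro exI[of _ d]) (auto intro: uniform_limit_on_subset)
  qed
  have Fh: "F holomorphic_on ball 0 1"
  proof (rule holomorphic_uniform_sequence[OF open_ball])
    show "?F n holomorphic_on ball 0 1" for n using g by (simp add: slice_hol_def)
    show "\<exists>d>0. cball z d \<subseteq> ball 0 1 \<and> uniform_limit (cball z d) ?F F sequentially" if "z \<in> ball 0 1" for z
      using sub[OF that] by blast
  qed
  have Gh: "G holomorphic_on ball 0 1"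
  proof (rule holomorphic_uniform_sequence[OF open_ball])
    show "?G n holomorphic_on ball 0 1" for n using g by (simp add: slice_hol_def)
    show "\<exists>d>0. cball z d \<subseteq> ball 0 1 \<and> uniform_limit (cball z d) ?G G sequentially" if "z \<in> ball 0 1" for z
      using sub[OF that] by blast
  qed
  define h where "h q = slice_join i j (F (coord i q)) (G (coord i q))" for q
  have hz: "h (emb i z) = slice_join i j (F z) (G z)" for z by (simp add: h_def coord_emb[OF i])
  show ?thesis
  proof (rule that)
    show "slice_hol i j h"
      unfolding slice_hol_def hz slice_join_def coord_join coord2_join using Fh Gh by simp
    fix z :: complex assume z: "z \<in> ball 0 1"
    have "(\<lambda>n. ?F n z) \<longlonglongrightarrow> F z" "(\<lambda>n. ?G n z) \<longlonglongrightarrow> G z"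
      using lims[of "norm z"] z by (auto intro: tendsto_uniform_limitI)
    then have "(\<lambda>n. emb i (?F n z) + emb i (?G n z) * j) \<longlonglongrightarrow> emb i (F z) + emb i (G z) * j"
      by (intro tendsto_add tendsto_mult tendsto_const bounded_linear.tendsto[OF bounded_linear_emb])
    then show "(\<lambda>n. g n (emb i z)) \<longlonglongrightarrow> h (emb i z)"
      by (simp add: slice_split hz slice_join_def)
  qed
qed

text \<open>The disc is convex, so both coordinates have primitives. Joined, they live on the slice;
  \<open>slice_ext\<close> makes them regular on the ball and preserves values and real derivatives
  on the slice.\<close>

lemma slice_primitive:
  assumes h: "slice_hol i j h"
  obtains v where "v \<in> slice_regular" "\<And>z. z \<in> ball 0 1 \<Longrightarrow> real_deriv v (emb i z) = h (emb i z)"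
proof -
  let ?F = "\<lambda>z. coord i (h (emb i z))" and ?G = "\<lambda>z. coord2 i j (h (emb i z))"
  have "?F holomorphic_on ball 0 1" "?G holomorphic_on ball 0 1" using h by (auto simp: slice_hol_def)
  then obtain F G where FG: "\<And>z. z \<in> ball 0 1 \<Longrightarrow> (F has_field_derivative ?F z) (at z)" "\<And>z. z \<in> ball 0 1 \<Longrightarrow> (G has_field_derivative ?G z) (at z)"
    using holomorphic_convex_primitive'[OF convex_ball open_ball] by (metis at_within_open open_ball)
  define u where "u q = slice_join i j (F (coord i q)) (G (coord i q))" for q
  have uz: "u (emb i z) = emb i (F z) + emb i (G z) * j" for z
    by (simp add: u_def coord_emb[OF i] slice_join_def)
  have u: "slice_hol i j u"
    unfolding slice_hol_def uz coord_join coord2_join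
    unfolding holomorphic_on_open[OF open_ball] using FG by blast
  have du: "real_deriv u (emb i z) = h (emb i z)" if z: "z \<in> ball 0 1" for z
    unfolding real_deriv_slice[OF u z] slice_deriv_def uz coord_join coord2_join
      DERIV_imp_deriv[OF FG(1)[OF z]] DERIV_imp_deriv[OF FG(2)[OF z]] slice_join_coords ..
  show ?thesis
  proof (rule that)
    show "slice_ext i u \<in> slice_regular" by (rule slice_ext_slice_regular[OF u])
    show "real_deriv (slice_ext i u) (emb i z) = h (emb i z)" if "z \<in> ball 0 1" for z
      using slice_hol_cong(2)[OF u, of "slice_ext i u", OF slice_ext_same_slice[OF i] that] du[OF that] by simp
  qed
qed

text \<open>Pointwise convergence of the densities makes each one its own lower limit, so an
  eventual bound passes to the limit function.\<close>

lemma slice_energy_Fatou: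
  assumes p: "p > 1" and g: "\<And>n::nat. slice_hol i j (g n)"
    and lim: "\<And>z. z \<in> ball 0 1 \<Longrightarrow> (\<lambda>n. g n (emb i z)) \<longlonglongrightarrow> h (emb i z)"
    and bd: "eventually (\<lambda>n. slice_energy p a (g n) \<le> B) sequentially"
  shows "slice_energy p a h \<le> B"
proof -
  have "slice_energy p a h = (\<integral>\<^sup>+z. liminf (\<lambda>n. ennreal (slice_density p a (g n) z)) \<partial>lborel)"
    unfolding slice_energy_def
  proof (intro nn_integral_cong)
    fix z :: complex
    have "(\<lambda>n. slice_density p a (g n) z) \<longlonglongrightarrow> slice_density p a h z"
    proof (cases "z \<in> ball 0 1")
      case True
      have "(\<lambda>n. norm (g n (emb i z)) powr p) \<longlonglongrightarrow> norm (h (emb i z)) powr p"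
        using p by (intro tendsto_powr' tendsto_norm lim[OF True] tendsto_const) auto
      then show ?thesis unfolding slice_density_def by (intro tendsto_mult tendsto_const)
    qed (simp add: slice_density_def)
    then have "(\<lambda>n. ennreal (slice_density p a (g n) z)) \<longlonglongrightarrow> ennreal (slice_density p a h z)"
      by (rule tendsto_ennrealI)
    then show "ennreal (slice_density p a h z) = liminf (\<lambda>n. ennreal (slice_density p a (g n) z))"
      by (simp add: lim_imp_Liminf)
  qed
  also have "\<dots> \<le> liminf (\<lambda>n. slice_energy p a (g n))"
    unfolding slice_energy_def using slice_density_measurable[OF g] by (intro nn_integral_liminf) auto
  also have "\<dots> \<le> limsup (\<lambda>n. slice_energy p a (g n))" by (rule Liminf_le_Limsup) simp
  also have "\<dots> \<le> B" by (rule Limsup_bounded[OF bd])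
  finally show ?thesis .
qed

text \<open>With x = 1 - |z|^2 and d = |T'(z)|, the Jacobian d^2 and the transported weight (x
  d)^(p-2) combine to x^(p-2) d^p, and d^p is exactly the factor that the chain rule produces for
  the composite.\<close>

lemma slice_energy_moebius:
  assumes p: "p > 1" and f: "slice_hol i j f" and \<alpha>: "norm \<alpha> < 1"
  shows "slice_energy p (p - 2) (real_deriv (\<lambda>q. f (slice_moebius (emb i \<alpha>) q))) = besov_energy p f"
proof -
  let ?T = "disc_moebius \<alpha>"
  let ?e = "slice_density p (p - 2) (real_deriv f)"
  have "besov_energy p f = (\<integral>\<^sup>+z. ennreal (indicator (?T ` ball 0 1) z * ?e z) \<partial>lborel)"
    unfolding slice_energy_def disc_moebius_image[OF \<alpha>]
    by (intro nn_integral_cong) (simp add: slice_density_def indicator_def)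
  also have "\<dots> = (\<integral>\<^sup>+z. ennreal (indicator (ball 0 1) z * ((norm (deriv ?T z))\<^sup>2 * ?e (?T z))) \<partial>lborel)"
    by (rule nn_integral_holomorphic_change_of_variables[OF open_ball disc_moebius_holomorphic[OF \<alpha>] disc_moebius_inj[OF \<alpha>]
        slice_density_measurable[OF slice_hol_real_deriv(1)[OF f]] slice_density_nonneg])
  also have "\<dots> = slice_energy p (p - 2) (real_deriv (\<lambda>q. f (slice_moebius (emb i \<alpha>) q)))"
    unfolding slice_energy_def
  proof (intro nn_integral_cong arg_cong[where f = ennreal])
    fix z :: complex
    show "indicator (ball 0 1) z * ((norm (deriv ?T z))\<^sup>2 * ?e (?T z)) =
      slice_density p (p - 2) (real_deriv (\<lambda>q. f (slice_moebius (emb i \<alpha>) q))) z"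
    proof (cases "z \<in> ball 0 1")
      case True
      then have z: "norm z < 1" by simp
      define x where "x = 1 - (norm z)\<^sup>2"
      define d where "d = norm (deriv ?T z)"
      have Tz: "norm (?T z) < 1" by (rule disc_moebius_in_disc[OF \<alpha> z])
      have xd: "x * d = 1 - (norm (?T z))\<^sup>2" unfolding x_def d_def by (rule norm_deriv_disc_moebius[OF \<alpha> z])
      have x: "x > 0" unfolding x_def by (rule disc_defect_pos[OF z])
      have d: "d > 0" using xd disc_defect_pos[OF Tz] x zero_less_mult_pos by metis
      have "d\<^sup>2 * (x * d) powr (p - 2) = x powr (p - 2) * d powr p"
        using d by (simp add: powr_mult powr_diff)
      then show ?thesis
        using True Tz slice_hol_comp_moebius(2)[OF f \<alpha> z]
        by (simp add: slice_density_def xd[symmetric] x_def[symmetric] d_def[symmetric] powr_mult mult.assoc[symmetric])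
    qed (simp add: slice_density_def)
  qed
  finally show ?thesis ..
qed

end

section \<open>The Besov space\<close>

context slice_frame
begin

context
  fixes p :: real
  assumes p: "p > 1"
begin

lemma besovD:
  assumes "f \<in> besov p i"
  shows "f \<in> slice_regular" "slice_hol i j f" "slice_hol i j (real_deriv f)"
    "besov_energy p f < \<infinity>"
proof -
  show f: "f \<in> slice_regular" "besov_energy p f < \<infinity>" using assms besov_iff[OF p] by auto
  show "slice_hol i j f" by (rule slice_regular_imp_slice_hol[OF f(1)])
  then show "slice_hol i j (real_deriv f)" by (rule slice_hol_real_deriv(1))
qed

text \<open>The hinge between the real seminorm and the extended-valued energies: the estimates for
  sums, for the limit in the completeness proof and for the null space are read back through
  it.\<close>

lemma besov_rho_le_iff:
  assumes f: "f \<in> besov p i" and A: "A \<ge> 0"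
  shows "besov_rho p i f \<le> A \<longleftrightarrow> besov_energy p f \<le> ennreal (pi * A powr p)"
proof -
  define r where "r = enn2real (besov_energy p f)"
  have r: "r \<ge> 0" by (simp add: r_def)
  have E: "besov_energy p f = ennreal r"
    using besovD(4)[OF f] by (simp add: r_def)
  have rho: "besov_rho p i f = (r / pi) powr (1 / p)"
    using besov_rho_eq[OF besovD(1)[OF f] besovD(4)[OF f]] by (simp add: r_def)
  have "(r / pi) powr (1 / p) \<le> A \<longleftrightarrow> r / pi \<le> A powr p"
  proof
    assume "(r / pi) powr (1 / p) \<le> A"
    then have "((r / pi) powr (1 / p)) powr p \<le> A powr p" using p by (intro powr_mono2) auto
    then show "r / pi \<le> A powr p" using p r by (simp add: powr_powr)
  next
    assume "r / pi \<le> A powr p"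
    then have "(r / pi) powr (1 / p) \<le> (A powr p) powr (1 / p)" using p r by (intro powr_mono2) auto
    then show "(r / pi) powr (1 / p) \<le> A" using p A by (simp add: powr_powr)
  qed
  also have "\<dots> \<longleftrightarrow> r \<le> pi * A powr p" by (simp add: field_simps)
  finally show ?thesis unfolding rho E by (simp add: ennreal_le_iff)
qed

lemma besov_rho_nonneg: "besov_rho p i f \<ge> 0"
  by (simp add: besov_rho_def)

lemma slice_energy_add_le:
  assumes f: "f \<in> slice_regular" and g: "g \<in> slice_regular" and A: "A > 0" and B: "B > 0"
    and "besov_energy p f \<le> ennreal (pi * A powr p)" "besov_energy p g \<le> ennreal (pi * B powr p)"
  shows "besov_energy p (fun_add f g) \<le> ennreal (pi * (A + B) powr p)"
proof -
  have hol: "slice_hol i j f" "slice_hol i j g" using f g slice_regular_imp_slice_hol by auto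
  show ?thesis
    by (rule slice_energy_Minkowski[OF p slice_hol_real_deriv(1)[OF hol(1)] slice_hol_real_deriv(1)[OF hol(2)] _ A B assms(5,6)])
       (simp_all add: slice_hol_add(2)[OF hol] norm_triangle_ineq)
qed

lemma besov_add_rho:
  assumes f: "f \<in> besov p i" and g: "g \<in> besov p i"
  shows "fun_add f g \<in> besov p i" "besov_rho p i (fun_add f g) \<le> besov_rho p i f + besov_rho p i g"
proof -
  \<comment> \<open>Minkowski's inequality was set up for positive bounds, so a positive e is added
    to both seminorms and removed at the end.\<close>
  have bd: "besov_energy p (fun_add f g) \<le> ennreal (pi * (besov_rho p i f + e + (besov_rho p i g + e)) powr p)"
    if "e > 0" for e
    using that besov_rho_nonneg[of f] besov_rho_nonneg[of g]
      besov_rho_le_iff[OF f, of "besov_rho p i f + e"] besov_rho_le_iff[OF g, of "besov_rho p i g + e"]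
    by (intro slice_energy_add_le besovD(1) f g) auto
  show *: "fun_add f g \<in> besov p i"
    using bd[of 1] slice_regular_add[OF besovD(1)[OF f] besovD(1)[OF g]]
    by (auto simp: besov_iff[OF p] intro: le_less_trans)
  show "besov_rho p i (fun_add f g) \<le> besov_rho p i f + besov_rho p i g"
  proof (rule field_le_epsilon)
    fix e :: real assume e: "e > 0"
    then show "besov_rho p i (fun_add f g) \<le> besov_rho p i f + besov_rho p i g + e"
      using bd[of "e / 2"] besov_rho_nonneg[of f] besov_rho_nonneg[of g]
        besov_rho_le_iff[OF *, of "besov_rho p i f + besov_rho p i g + e"]
      by (simp add: algebra_simps)
  qed
qed

lemma besov_scale_rho:
  assumes f: "f \<in> besov p i"
  shows "fun_scale f c \<in> besov p i" "besov_rho p i (fun_scale f c) = besov_rho p i f * norm c"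
proof -
  have E: "besov_energy p (fun_scale f c) = ennreal (norm c powr p) * besov_energy p f"
    by (rule slice_energy_scale[OF p besovD(3)[OF f]])
       (simp_all add: slice_hol_scale(2)[OF besovD(2)[OF f]] norm_mult)
  then have fin: "besov_energy p (fun_scale f c) < \<infinity>"
    using besovD(4)[OF f] by (simp add: ennreal_mult_less_top)
  show "fun_scale f c \<in> besov p i"
    using fin slice_regular_scale[OF besovD(1)[OF f]] by (simp add: besov_iff[OF p])
  have "besov_rho p i (fun_scale f c) = (norm c powr p * (enn2real (besov_energy p f) / pi)) powr (1 / p)"
    using besov_rho_eq[OF slice_regular_scale[OF besovD(1)[OF f]] fin] by (simp add: E enn2real_mult)
  also have "\<dots> = (norm c powr p) powr (1 / p) * (enn2real (besov_energy p f) / pi) powr (1 / p)"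
    by (rule powr_mult)
  also have "\<dots> = norm c * besov_rho p i f"
    using p by (simp add: powr_powr besov_rho_eq[OF besovD(1)[OF f] besovD(4)[OF f]])
  finally show "besov_rho p i (fun_scale f c) = besov_rho p i f * norm c" by simp
qed

lemma besov_zero: "fun_zero \<in> besov p i"
proof -
  have "besov_energy p fun_zero = 0"
    using p by (simp add: slice_energy_def slice_density_def fun_zero_def real_deriv_def)
  then show ?thesis by (simp add: besov_iff[OF p] slice_regular_zero)
qed

lemma besov_complete:
  assumes s: "\<And>n::nat. s n \<in> besov p i"
    and cauchy: "\<And>e. e > 0 \<Longrightarrow> \<exists>N. \<forall>m\<ge>N. \<forall>n\<ge>N. besov_rho p i (fun_add (s m) (fun_scale (s n) (- 1))) < e"
  shows "\<exists>v\<in>besov p i. (\<lambda>n. besov_rho p i (fun_add (s n) (fun_scale v (- 1)))) \<longlonglongrightarrow> 0"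
proof -
  let ?d = "\<lambda>u v. fun_add u (fun_scale v (- 1))"
  have dd: "real_deriv (?d u v) (emb i z) = ?d (real_deriv u) (real_deriv v) (emb i z)"
    if "slice_hol i j u" "slice_hol i j v" "z \<in> ball 0 1" for u v z
  proof -
    have "real_deriv (?d u v) (emb i z) = real_deriv u (emb i z) + real_deriv v (emb i z) * (- 1)"
      using slice_hol_add(2)[OF that(1) slice_hol_scale(1)[OF that(2), of "- 1"] that(3)]
        slice_hol_scale(2)[OF that(2,3), of "- 1"] by simp
    then show ?thesis by (simp only: fun_add_def fun_scale_def)
  qed
  have diffE: "besov_energy p (?d u v) = slice_energy p (p - 2) (?d (real_deriv u) (real_deriv v))"
    if "slice_hol i j u" "slice_hol i j v" for u v
    using dd[OF that] by (intro slice_energy_cong) simp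
  have C: "\<exists>N. \<forall>m\<ge>N. \<forall>n\<ge>N. slice_energy p (p - 2) (?d (real_deriv (s m)) (real_deriv (s n))) \<le> ennreal (pi * e powr p)"
    if e: "e > 0" for e
  proof -
    from cauchy[OF e] obtain N where N: "\<And>m n. m \<ge> N \<Longrightarrow> n \<ge> N \<Longrightarrow> besov_rho p i (?d (s m) (s n)) < e" by blast
    have "slice_energy p (p - 2) (?d (real_deriv (s m)) (real_deriv (s n))) \<le> ennreal (pi * e powr p)" if "m \<ge> N" "n \<ge> N" for m n
      using N[OF that] e besov_rho_le_iff[OF besov_add_rho(1)[OF s besov_scale_rho(1)[OF s]], of e m n "- 1"]
      by (simp add: diffE[OF besovD(2)[OF s] besovD(2)[OF s]])
    then show ?thesis by blast
  qed
  obtain h where h: "slice_hol i j h" and lim: "\<And>z. z \<in> ball 0 1 \<Longrightarrow> (\<lambda>n. real_deriv (s n) (emb i z)) \<longlonglongrightarrow> h (emb i z)"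
    using slice_energy_Cauchy_limit[OF p besovD(3)[OF s] C] by blast
  obtain v where v: "v \<in> slice_regular" and dv: "\<And>z. z \<in> ball 0 1 \<Longrightarrow> real_deriv v (emb i z) = h (emb i z)"
    using slice_primitive[OF h] by blast
  have vh: "slice_hol i j v" by (rule slice_regular_imp_slice_hol[OF v])
  \<comment> \<open>n stays fixed while m tends to infinity: the Cauchy bound for s n - s m becomes
    a bound for s n - v.\<close>
  have bound: "\<exists>N. \<forall>n\<ge>N. besov_energy p (?d (s n) v) \<le> ennreal (pi * e powr p)" if e: "e > 0" for e
  proof -
    from C[OF e] obtain N where N: "\<And>m n. m \<ge> N \<Longrightarrow> n \<ge> N \<Longrightarrow>
      slice_energy p (p - 2) (?d (real_deriv (s m)) (real_deriv (s n))) \<le> ennreal (pi * e powr p)" by blast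
    have "slice_energy p (p - 2) (?d (real_deriv (s n)) (real_deriv v)) \<le> ennreal (pi * e powr p)" if n: "n \<ge> N" for n
    proof (rule slice_energy_Fatou[OF p])
      show "slice_hol i j (?d (real_deriv (s n)) (real_deriv (s m)))" for m
        by (intro slice_hol_add(1) slice_hol_scale(1) besovD(3) s)
      show "\<forall>\<^sub>F m in sequentially. slice_energy p (p - 2) (?d (real_deriv (s n)) (real_deriv (s m))) \<le> ennreal (pi * e powr p)"
        using N[OF n] eventually_sequentially by blast
      show "(\<lambda>m. ?d (real_deriv (s n)) (real_deriv (s m)) (emb i z)) \<longlonglongrightarrow> ?d (real_deriv (s n)) (real_deriv v) (emb i z)"
        if "z \<in> ball 0 1" for z
        unfolding fun_add_def fun_scale_def dv[OF that] by (intro tendsto_intros lim[OF that])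
    qed
    then show ?thesis by (auto simp: diffE[OF besovD(2)[OF s] vh])
  qed
  have sv: "?d (s n) v \<in> slice_regular" for n
    by (intro slice_regular_add slice_regular_scale v besovD(1) s)
  obtain n where "besov_energy p (?d (s n) v) \<le> ennreal (pi * 1 powr p)"
    using bound[of 1] by auto
  then have "?d (s n) v \<in> besov p i"
    using sv[of n] by (auto simp: besov_iff[OF p] intro: le_less_trans)
  \<comment> \<open>v is recovered as s n - (s n - v), a difference of two members of the
    space.\<close>
  from besov_add_rho(1)[OF s[of n] besov_scale_rho(1)[OF this, of "- 1"]]
  have vB: "v \<in> besov p i"
    by (simp add: fun_add_def fun_scale_def)
  have dB: "?d (s n) v \<in> besov p i" for n
    by (intro besov_add_rho(1) besov_scale_rho(1) s vB)
  have "(\<lambda>n. besov_rho p i (?d (s n) v)) \<longlonglongrightarrow> 0"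
  proof (rule LIMSEQ_I)
    fix e :: real assume e: "e > 0"
    \<comment> \<open>Half of e, so that the non-strict bound ends up strict.\<close>
    then obtain N where "\<And>n. n \<ge> N \<Longrightarrow> besov_energy p (?d (s n) v) \<le> ennreal (pi * (e / 2) powr p)"
      using bound[of "e / 2"] by auto
    then have "besov_rho p i (?d (s n) v) \<le> e / 2" if "n \<ge> N" for n
      using besov_rho_le_iff[OF dB, of "e / 2" n] e that by simp
    then have "besov_rho p i (?d (s n) v) < e" if "n \<ge> N" for n
      using e that by fastforce
    then show "\<exists>N. \<forall>n\<ge>N. norm (besov_rho p i (?d (s n) v) - 0) < e"
      using besov_rho_nonneg by auto
  qed
  then show ?thesis using vB by blast
qed

lemma besov_complete_seminormed:
  "quat_complete_seminormed_space (besov p i) fun_add fun_zero fun_scale (besov_rho p i)"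
proof
  show "fun_zero \<in> besov p i" by (rule besov_zero)
  fix u v assume "u \<in> besov p i" "v \<in> besov p i"
  then show "fun_add u v \<in> besov p i" "besov_rho p i (fun_add u v) \<le> besov_rho p i u + besov_rho p i v"
    by (rule besov_add_rho)+
next
  fix u c assume "u \<in> besov p i"
  then show "fun_scale u c \<in> besov p i" "besov_rho p i (fun_scale u c) = besov_rho p i u * norm c"
    by (rule besov_scale_rho)+
next
  fix s :: "nat \<Rightarrow> quat \<Rightarrow> quat"
  assume "\<And>n. s n \<in> besov p i" "\<And>e. e > 0 \<Longrightarrow> \<exists>N. \<forall>m\<ge>N. \<forall>n\<ge>N. besov_rho p i (fun_add (s m) (fun_scale (s n) (- 1))) < e"
  then show "\<exists>v\<in>besov p i. (\<lambda>n. besov_rho p i (fun_add (s n) (fun_scale v (- 1)))) \<longlonglongrightarrow> 0"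
    by (rule besov_complete)
qed (simp_all add: fun_add_def fun_scale_def fun_zero_def besov_rho_nonneg algebra_simps fun_eq_iff)

lemma besov_rho_eq_0_iff:
  assumes f: "f \<in> besov p i"
  shows "besov_rho p i f = 0 \<longleftrightarrow> (\<exists>c. \<forall>q\<in>qball. f q = c)"
proof
  assume "besov_rho p i f = 0"
  then have "besov_energy p f = 0"
    using besov_rho_le_iff[OF f, of 0] p by simp
  then have d0: "real_deriv f (emb i z) = 0" if "z \<in> ball 0 1" for z
    using slice_energy_zero_imp[OF p besovD(3)[OF f] _ that] by simp
  have "\<exists>c. \<forall>z\<in>ball 0 1. f (emb i z) = c"
    by (rule has_derivative_zero_constant[OF convex_ball])
       (use slice_hol_has_real_deriv[OF besovD(2)[OF f]] d0 in \<open>auto intro: has_derivative_at_withinI\<close>)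
  then show "\<exists>c. \<forall>q\<in>qball. f q = c"
    using slice_regular_const_if_const_on_slice[OF i besovD(1)[OF f]] by blast
next
  assume "\<exists>c. \<forall>q\<in>qball. f q = c"
  then obtain c where c: "\<And>q. q \<in> qball \<Longrightarrow> f q = c" by blast
  have "((\<lambda>z. f (emb i z)) has_derivative (\<lambda>h. emb i h * 0)) (at z)" if z: "z \<in> ball 0 1" for z
    by (rule has_derivative_transform_within_open[of "\<lambda>_. c" _ _ _ "ball 0 1"])
       (use z c emb_qball_iff[OF i] in auto)
  from slice_hol_real_derivI(2)[OF this]
  have "besov_energy p f = slice_energy p (p - 2) (\<lambda>_. 0)"
    by (intro slice_energy_cong) simp
  also have "\<dots> = 0" using p by (simp add: slice_energy_def slice_density_def)
  finally show "besov_rho p i f = 0"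
    using besov_rho_le_iff[OF f, of 0] besov_rho_nonneg[of f] by simp
qed

text \<open>\<open>slice_ext\<close> leaves the composite unchanged on the slice, so the energy is
  the one evaluated in \<open>slice_energy_moebius\<close>; its finiteness also yields
  membership.\<close>

lemma besov_comp_moebius:
  assumes f: "f \<in> besov p i" and a: "a \<in> slice_ball i"
  shows "slice_comp i j f a \<in> besov p i" "besov_rho p i (slice_comp i j f a) = besov_rho p i f"
proof -
  obtain \<alpha> where \<alpha>: "norm \<alpha> < 1" "a = emb i \<alpha>" using a by (auto simp: slice_ball_eq[OF i])
  let ?g = "\<lambda>q. f (slice_moebius (emb i \<alpha>) q)"
  have g: "slice_hol i j ?g" by (rule slice_hol_comp_moebius(1)[OF besovD(2)[OF f] \<alpha>(1)])
  have eq: "slice_comp i j f a = slice_ext i ?g" by (simp add: slice_comp_eq \<alpha>)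
  have reg: "slice_ext i ?g \<in> slice_regular" by (rule slice_ext_slice_regular[OF g])
  have "besov_energy p (slice_ext i ?g) = slice_energy p (p - 2) (real_deriv ?g)"
    using slice_hol_cong(2)[OF g, of "slice_ext i ?g", OF slice_ext_same_slice[OF i]] by (intro slice_energy_cong) simp
  then have E: "besov_energy p (slice_ext i ?g) = besov_energy p f"
    using slice_energy_moebius[OF p besovD(2)[OF f] \<alpha>(1)] by simp
  show "slice_comp i j f a \<in> besov p i"
    unfolding eq besov_iff[OF p] E using reg besovD(4)[OF f] by simp
  show "besov_rho p i (slice_comp i j f a) = besov_rho p i f"
    unfolding eq using besov_rho_eq[OF reg] besov_rho_eq[OF besovD(1)[OF f]] besovD(4)[OF f] by (simp add: E)
qed

end

end

text \<open>The first conjunct ensures that the integral in the seminorm is a genuine one, the third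
  that \<open>the_elem\<close> picks a value common to the whole class. In the last, the splitting
  unit is arbitrary; for the others the proof picks one.\<close>

theorem lemma4p9:
  fixes i :: quat and p :: real
  assumes "i \<in> imag_sphere" and "p > 1"
  shows "(\<forall>f\<in>besov p i. set_integrable (slice_hyp i) (slice_ball i) (besov_integrand p f)) \<and>
    quat_complete_seminormed_space (besov p i) fun_add fun_zero fun_scale (besov_rho p i) \<and>
    (\<forall>f\<in>besov p i. quot_norm p i (besov_class p i f) = besov_rho p i f) \<and>
    quat_banach_space (besov_quot p i) (quot_add p i) (besov_class p i fun_zero)
      (quot_scale p i) (quot_norm p i) \<and>
    (\<forall>j\<in>imag_sphere. i \<bullet> j = 0 \<longrightarrow> (\<forall>f\<in>besov p i. \<forall>a\<in>slice_ball i.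
      slice_comp i j f a \<in> besov p i \<and>
      besov_rho p i (slice_comp i j f a) = besov_rho p i f))"
proof -
  note p = assms(2)
  obtain j where j: "j \<in> imag_sphere" "i \<bullet> j = 0" by (rule imag_sphere_orthogonal_exists[OF assms(1)])
  interpret slice_frame i j by unfold_locales (use assms j in auto)
  interpret B: quat_complete_seminormed_space "besov p i" fun_add fun_zero fun_scale "besov_rho p i"
    by (rule besov_complete_seminormed[OF p])
  \<comment> \<open>f - g has seminorm zero exactly when it is constant on the ball, so the quotient
    by constants is the general quotient by the null space.\<close>
  have rel: "besov_rel p i = B.null_rel"
  proof -
    have "(\<exists>c. \<forall>q\<in>qball. f q = g q + c) \<longleftrightarrow> besov_rho p i (fun_add f (fun_scale g (- 1))) = 0"
      if "f \<in> besov p i" "g \<in> besov p i" for f g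
    proof -
      have "f q = g q + c \<longleftrightarrow> fun_add f (fun_scale g (- 1)) q = c" for q c
        by (auto simp: fun_add_def fun_scale_def algebra_simps)
      then show ?thesis using besov_rho_eq_0_iff[OF p B.diff_closed[OF that]] by simp
    qed
    then show ?thesis by (auto simp: besov_rel_def B.null_rel_def)
  qed
  have cls: "besov_class p i = B.cls" by (simp add: fun_eq_iff besov_class_def B.cls_def rel)
  have ops: "quot_add p i = B.cls_add" "quot_scale p i = B.cls_scale" "quot_norm p i = B.cls_nrm"
    by (simp_all add: fun_eq_iff quot_add_def B.cls_add_def quot_scale_def B.cls_scale_def quot_norm_def B.cls_nrm_def cls)
  have quot: "besov_quot p i = besov p i // B.null_rel" by (simp add: besov_quot_def rel)
  show ?thesis
  proof (intro conjI ballI impI)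
    show "set_integrable (slice_hyp i) (slice_ball i) (besov_integrand p f)" if "f \<in> besov p i" for f
      by (rule besov_integrand_integral(1)[OF besovD(1,4)[OF p that]])
    show "quat_complete_seminormed_space (besov p i) fun_add fun_zero fun_scale (besov_rho p i)"
      by (rule B.quat_complete_seminormed_space_axioms)
    show "quot_norm p i (besov_class p i f) = besov_rho p i f" if "f \<in> besov p i" for f
      using B.cls_nrm_eq[OF that] by (simp add: ops cls)
    show "quat_banach_space (besov_quot p i) (quot_add p i) (besov_class p i fun_zero) (quot_scale p i) (quot_norm p i)"
      unfolding quot ops cls by (rule B.quotient_banach)
    fix k f a assume k: "k \<in> imag_sphere" "i \<bullet> k = 0" and fa: "f \<in> besov p i" "a \<in> slice_ball i"
    \<comment> \<open>A second frame with the given unit k; the space and the seminorm are the same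
      in both frames.\<close>
    interpret K: slice_frame i k by unfold_locales (use assms k in auto)
    show "slice_comp i k f a \<in> besov p i" "besov_rho p i (slice_comp i k f a) = besov_rho p i f"
      using K.besov_comp_moebius[OF p fa] by auto
  qed
qed

end
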